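(* There exist absolute constants $c,C>0$ such that the following holds. Let $n,m\geq2$ and $1\leq k\leq n$. Let $U_1,\ldots,U_m$ be independent Haar-distributed orthogonal transformations of $\mathbb{R}^n$, let $F$ be an independent Haar-distributed element of $G_{n,k}$, and put $$ A_m=\frac1m\sum_{j=1}^mU_j^*(Q_n^\circ),\qquad Q_n=[-1/2,1/2]^n. $$ For $p\geq2k/m$ set $$ \ell_p=\ln\left(e+\frac{n}{1+p}\right),\qquad\Delta_p=mp-k+1. $$ Then, with probability at least $1-Ce^{-ck}$, $$ d_{\rm G}(P_FA_m,B_F)\leq C\left(\sqrt{\frac{\ln(en)}{\ell_p}}+\sqrt{\frac{k}{m\ell_p}}\right)\left(C\sqrt{\frac n{\ell_p}}\right)^{\frac{k-1}{\Delta_p}}\exp\left(\frac{Ck}{\Delta_p}\right). $$ In particular, if $$ L_{m,k}=\ln\left(e+\min\left\{n,\frac{mn}{k\ln(en)}\right\}\right), $$ then $$ d_{\rm G}(P_FA_m,B_F)\leq C\left(\sqrt{\frac{\ln(en)}{L_{m,k}}}+\sqrt{\frac{k}{mL_{m,k}}}\right) $$ with probability at least $1-Ce^{-ck}$.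
   Context: $K^\circ=\{x:\langle x,y\rangle\leq1\ \forall y\in K\}$ is the polar body, $U^*$ is the adjoint of $U$, and sums of sets are Minkowski sums. $G_{n,k}$ is the Grassmannian of $k$-dimensional subspaces of $\mathbb{R}^n$ with its rotationally invariant (Haar) probability measure, $P_F$ is the orthogonal projection onto $F$, and $B_F=B_2^n\cap F$ is the Euclidean unit ball of $F$. The geometric distance of symmetric convex bodies $K,L$ in the same space is $d_{\rm G}(K,L)=\inf\{ab:a^{-1}L\subseteq K\subseteq bL,\ a,b>0\}$. *)

theory Defs
  imports
    "HOL-Probability.Probability"
    "HOL-Library.Function_Algebras"
    "HOL-Library.Set_Algebras"
    "HOL-Analysis.Abstract_Euclidean_Space"
begin

text \<open>
  The constants of the theorem have to be chosen before the dimension \<open>n\<close>, so \<open>\<real>\<^sup>n\<close> cannot be a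
  type. It is the carrier of the topological space \<^const>\<open>Euclidean_space\<close>, that is, the set of
  all \<open>x :: nat \<Rightarrow> real\<close> with \<open>x i = 0\<close> for all \<open>i \<ge> n\<close>. With the pointwise vector space structure
  on functions, \<^const>\<open>subspace\<close> and \<^const>\<open>dim\<close> are the library notions, and \<open>+\<close> and \<open>\<Sum>\<close> on sets
  of vectors are Minkowski sums.
\<close>

instantiation "fun" :: (type, real_vector) real_vector
begin

definition scaleR_fun :: "real \<Rightarrow> ('a \<Rightarrow> 'b) \<Rightarrow> 'a \<Rightarrow> 'b"
  where "scaleR_fun r f = (\<lambda>x. r *\<^sub>R f x)"

instance
  by standard (auto simp: scaleR_fun_def fun_eq_iff scaleR_add_right scaleR_add_left)

end

type_synonym vector = "nat \<Rightarrow> real"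
type_synonym matrix = "nat \<Rightarrow> nat \<Rightarrow> real"

abbreviation Rn :: "nat \<Rightarrow> vector set"
  where "Rn n \<equiv> topspace (Euclidean_space n)"

definition ip :: "nat \<Rightarrow> vector \<Rightarrow> vector \<Rightarrow> real"
  where "ip n x y = (\<Sum>i<n. x i * y i)"

definition polar :: "nat \<Rightarrow> vector set \<Rightarrow> vector set"
  where "polar n K = {x \<in> Rn n. \<forall>y\<in>K. ip n x y \<le> 1}"

definition cube :: "nat \<Rightarrow> vector set"
  where "cube n = {x \<in> Rn n. \<forall>i<n. - 1 / 2 \<le> x i \<and> x i \<le> 1 / 2}"

definition unit_ball_in :: "nat \<Rightarrow> vector set \<Rightarrow> vector set"
  where "unit_ball_in n F = {x \<in> Rn n. sqrt (ip n x x) \<le> 1} \<inter> F"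

definition mat_vec :: "nat \<Rightarrow> matrix \<Rightarrow> vector \<Rightarrow> vector"
  where "mat_vec n U x = (\<lambda>i. \<Sum>j<n. U i j * x j)"

definition mat_mul :: "nat \<Rightarrow> matrix \<Rightarrow> matrix \<Rightarrow> matrix"
  where "mat_mul n U V = (\<lambda>i j. \<Sum>l<n. U i l * V l j)"

definition adj :: "matrix \<Rightarrow> matrix"
  where "adj U = (\<lambda>i j. U j i)"

text \<open>Entries outside the leading \<open>n \<times> n\<close> block are 0, so that a linear map of \<open>\<real>\<^sup>n\<close> has exactly one
  matrix.\<close>

definition orthogonal_group :: "nat \<Rightarrow> matrix set"
  where "orthogonal_group n =
    {U. (\<forall>i j. n \<le> i \<or> n \<le> j \<longrightarrow> U i j = 0) \<and>
        (\<forall>x\<in>Rn n. \<forall>y\<in>Rn n. ip n (mat_vec n U x) (mat_vec n U y) = ip n x y)}"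

definition grassmannian :: "nat \<Rightarrow> nat \<Rightarrow> vector set set"
  where "grassmannian n k = {F. subspace F \<and> F \<subseteq> Rn n \<and> dim F = k}"

definition orth_proj :: "nat \<Rightarrow> vector set \<Rightarrow> vector \<Rightarrow> vector"
  where "orth_proj n F x = (THE y. y \<in> F \<and> (\<forall>z\<in>F. ip n (x - y) z = 0))"

definition proj_matrix :: "nat \<Rightarrow> vector set \<Rightarrow> matrix"
  where "proj_matrix n F = (\<lambda>i j. orth_proj n F (\<lambda>l. if l = j then 1 else 0) i)"

text \<open>The usual topology of the Grassmannian is the one that makes \<open>F \<mapsto> P\<^sub>F\<close> a topological
  embedding into the matrices; its Borel sets are the preimages of Borel sets under this map.\<close>

definition grassmannian_borel :: "nat \<Rightarrow> nat \<Rightarrow> vector set measure"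
  where "grassmannian_borel n k = vimage_algebra (grassmannian n k) (proj_matrix n) borel"

text \<open>The group \<open>O(n)\<close> is compact and acts transitively on the Grassmannian, so for \<open>k \<le> n\<close> each of
  the following two predicates holds for exactly one measure.\<close>

definition haar_orthogonal :: "nat \<Rightarrow> matrix measure \<Rightarrow> bool"
  where "haar_orthogonal n \<mu> \<longleftrightarrow>
    prob_space \<mu> \<and> space \<mu> = orthogonal_group n \<and>
    sets \<mu> = sets (restrict_space borel (orthogonal_group n)) \<and>
    (\<forall>V\<in>orthogonal_group n. distr \<mu> \<mu> (mat_mul n V) = \<mu>)"

definition haar_grassmannian :: "nat \<Rightarrow> nat \<Rightarrow> vector set measure \<Rightarrow> bool"
  where "haar_grassmannian n k \<nu> \<longleftrightarrow>
    prob_space \<nu> \<and> space \<nu> = grassmannian n k \<and>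
    sets \<nu> = sets (grassmannian_borel n k) \<and>
    (\<forall>V\<in>orthogonal_group n. distr \<nu> \<nu> (\<lambda>F. mat_vec n V ` F) = \<nu>)"

text \<open>Joint law of independent \<open>U\<^sub>1, \<dots>, U\<^sub>m, F\<close> with laws \<open>\<mu>, \<dots>, \<mu>, \<nu>\<close>.\<close>

definition joint_law ::
    "nat \<Rightarrow> matrix measure \<Rightarrow> vector set measure \<Rightarrow> ((nat \<Rightarrow> matrix) \<times> vector set) measure"
  where "joint_law m \<mu> \<nu> = (\<Pi>\<^sub>M j\<in>{1..m}. \<mu>) \<Otimes>\<^sub>M \<nu>"

definition avg_body :: "nat \<Rightarrow> nat \<Rightarrow> (nat \<Rightarrow> matrix) \<Rightarrow> vector set"
  where "avg_body n m U =
    (\<lambda>x. (1 / real m) *\<^sub>R x) ` (\<Sum>j\<in>{1..m}. mat_vec n (adj (U j)) ` polar n (cube n))"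

definition geom_dist :: "'a::real_vector set \<Rightarrow> 'a set \<Rightarrow> real"
  where "geom_dist K L =
    Inf {a * b |a b. 0 < a \<and> 0 < b \<and>
      (\<lambda>x. inverse a *\<^sub>R x) ` L \<subseteq> K \<and> K \<subseteq> (\<lambda>x. b *\<^sub>R x) ` L}"

definition ell :: "nat \<Rightarrow> real \<Rightarrow> real"
  where "ell n p = ln (exp 1 + real n / (1 + p))"

definition Delta :: "nat \<Rightarrow> nat \<Rightarrow> real \<Rightarrow> real"
  where "Delta m k p = real m * p - real k + 1"

definition Lmk :: "nat \<Rightarrow> nat \<Rightarrow> nat \<Rightarrow> real"
  where "Lmk n m k =
    ln (exp 1 + min (real n) (real m * real n / (real k * ln (exp 1 * real n))))"

end

theory Submission
  imports Defs
begin

text \<open>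
  The support function of \<open>P\<^sub>F A\<^sub>m\<close> at \<open>\<theta> \<in> F\<close> is \<open>2 / m\<close> times \<open>g(\<theta>) = \<Sum>\<^sub>j |U\<^sub>j \<theta>|\<^sub>\<infinity>\<close>, so the
  distance to \<open>B\<^sub>F\<close> is the ratio of the maximum and the minimum of \<open>g\<close> on the unit sphere of \<open>F\<close>, and
  it suffices to bound this ratio for each fixed \<open>F\<close>. Each \<open>U\<^sub>j \<theta>\<close> is uniform on the sphere.

  For the maximum, \<open>E exp (\<lambda> |U\<^sub>j \<theta>|\<^sub>\<infinity>)\<close> is bounded through Gaussian variables, and a union bound over
  a \<open>1/2\<close>-net of the sphere gives \<open>max g \<le> C m (sqrt (ln (en) / n) + sqrt (k / (m n)))\<close>.

  For the minimum, comparison with a Gaussian vector gives a small ball estimate for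
  \<open>|U\<^sub>j \<theta>|\<^sub>\<infinity>\<close>. Together with the deterministic bound \<open>|U\<^sub>j \<theta>|\<^sub>\<infinity> \<ge> 1 / sqrt n\<close> it yields
  \<open>E |U\<^sub>j \<theta>|\<^sub>\<infinity> powr (- p) \<le> D powr p\<close> with \<open>D = C sqrt (n / ell)\<close> for \<open>p \<ge> 1\<close>. By the
  inequality of the means, \<open>g(\<theta>) / m \<le> 2 t\<close> has probability at most \<open>(2 t D) powr (m p)\<close>. As \<open>g / m\<close> is
  1-Lipschitz and the sphere of \<open>F\<close> has a \<open>t\<close>-net of at most \<open>C\<^sup>k t powr (1 - k)\<close> points, \<open>min g \<ge> m t\<close> fails
  with probability at most \<open>C\<^sup>k (2 D) powr (m p) t powr Delta\<close>, which determines the choice of \<open>t\<close>.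
\<close>

section \<open>The space \<open>\<real>\<^sup>n\<close> and its orthogonal group\<close>

text \<open>The law of \<open>U \<theta>\<close> is reached through left invariance alone: the
  integral of a function of \<open>ip n y (X U)\<close> depends on \<open>y\<close> only through its
  length. The Gaussian comparisons are therefore arranged so that the integrand is a function of one
  inner product with \<open>X\<close>, which explains the exponentials and the smoothing in the
  small ball estimate.

  The union bound for the minimum has m p = Delta + k - 1, so making it exp (- k) gives 1 / t = 2 D
  (2 D)^((k - 1) / Delta) exp (C k / Delta). The factor 2 D turns the scale 1 / sqrt n of the
  maximum into 1 / sqrt ell; the other two are the power and the exponential of the theorem.
  Counting the net as that of a ball would cost one more factor 1 / t and spoil both k - 1 and
  Delta.

  The event must be measurable for its probability to mean anything, while \<open>geom_dist\<close>
  is an infimum over pairs of scalings. So \<open>geom_dist\<close> \<le> B is characterised by an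
  equivalence rather than merely implied, and the resulting condition on pairs of vectors is tested
  on a countable dense set.\<close>

lemma mem_Rn: "x \<in> Rn n \<longleftrightarrow> (\<forall>i\<ge>n. x i = 0)"
  by (simp add: topspace_Euclidean_space)

lemma scaleR_fun_apply [simp]: "(r *\<^sub>R f) x = r *\<^sub>R f x"
  by (simp add: scaleR_fun_def)

lemma sum_fun_apply: "(\<Sum>i\<in>I. f i) x = (\<Sum>i\<in>I. (f i x :: real))"
  by (induction I rule: infinite_finite_induct) auto

lemma subspace_Rn: "subspace (Rn n)"
  by (auto simp: subspace_def mem_Rn)

lemma ip_commute: "ip n x y = ip n y x"
  by (simp add: ip_def mult.commute)

lemma ip_add_left: "ip n (x + y) z = ip n x z + ip n y z"
  by (simp add: ip_def algebra_simps sum.distrib)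

lemma ip_diff_left: "ip n (x - y) z = ip n x z - ip n y z"
  by (simp add: ip_def algebra_simps sum_subtractf)

lemma ip_scaleR_left: "ip n (r *\<^sub>R x) z = r * ip n x z"
  by (simp add: ip_def sum_distrib_left algebra_simps)

lemma ip_sum_left: "ip n (\<Sum>i\<in>I. f i) z = (\<Sum>i\<in>I. ip n (f i) z)"
  unfolding ip_def sum_fun_apply sum_distrib_right by (rule sum.swap)

lemma ip_add_right: "ip n z (x + y) = ip n z x + ip n z y"
  and ip_diff_right: "ip n z (x - y) = ip n z x - ip n z y"
  and ip_scaleR_right: "ip n z (r *\<^sub>R x) = r * ip n z x"
  and ip_sum_right: "ip n z (\<Sum>i\<in>I. f i) = (\<Sum>i\<in>I. ip n z (f i))"
  by (simp_all add: ip_commute[of n z] ip_add_left ip_diff_left ip_scaleR_left ip_sum_left)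

lemmas ip_simps = ip_add_left ip_diff_left ip_scaleR_left ip_sum_left
  ip_add_right ip_diff_right ip_scaleR_right ip_sum_right

abbreviation vn :: "nat \<Rightarrow> vector \<Rightarrow> real"
  where "vn n x \<equiv> L2_set x {..<n}"

lemma ip_self: "ip n x x = (vn n x)\<^sup>2"
  by (simp add: ip_def L2_set_def sum_nonneg power2_eq_square)

lemma sqrt_ip_self: "sqrt (ip n x x) = vn n x"
  by (simp add: ip_self)

lemma abs_ip_le: "\<bar>ip n x y\<bar> \<le> vn n x * vn n y"
proof -
  have "\<bar>ip n x y\<bar> \<le> (\<Sum>i<n. \<bar>x i\<bar> * \<bar>y i\<bar>)"
    unfolding ip_def by (rule order_trans[OF sum_abs]) (simp add: abs_mult)
  also have "\<dots> \<le> vn n x * vn n y"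
    by (rule L2_set_mult_ineq)
  finally show ?thesis .
qed

lemma vn_scaleR: "vn n (r *\<^sub>R x) = \<bar>r\<bar> * vn n x"
  unfolding L2_set_def by (simp add: power_mult_distrib flip: sum_distrib_left) (simp add: real_sqrt_mult)

lemma vn_eq_0: "x \<in> Rn n \<Longrightarrow> vn n x = 0 \<longleftrightarrow> x = 0"
  by (auto simp: L2_set_eq_0_iff mem_Rn fun_eq_iff) (metis lessThan_iff not_less)

lemma vn_zero [simp]: "vn n 0 = 0"
  by (simp add: L2_set_def)

section \<open>Orthonormal bases and orthogonal projections\<close>

definition orthonormal_basis :: "nat \<Rightarrow> vector set \<Rightarrow> nat \<Rightarrow> (nat \<Rightarrow> vector) \<Rightarrow> bool"
  where "orthonormal_basis n F k e \<longleftrightarrow> (\<forall>i<k. e i \<in> F) \<and>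
    (\<forall>i<k. \<forall>j<k. ip n (e i) (e j) = (if i = j then 1 else 0)) \<and>
    (\<forall>x\<in>F. x = (\<Sum>i<k. ip n x (e i) *\<^sub>R e i))"

text \<open>Gram-Schmidt, one vector of the independent set at a time.\<close>

lemma orthonormal_basis_span:
  assumes "finite B" "independent B" "B \<subseteq> Rn n"
  shows "\<exists>e. orthonormal_basis n (span B) (card B) e"
  using assms
proof (induction B rule: finite_induct)
  case empty
  show ?case by (auto simp: orthonormal_basis_def)
next
  case (insert b B)
  then obtain e where e: "orthonormal_basis n (span B) (card B) e"
    using independent_mono[of "insert b B" B] by blast
  define r where "r = card B"
  have e1: "e i \<in> span B" if "i < r" for i
    using e that by (simp add: orthonormal_basis_def r_def)
  have e2: "ip n (e i) (e j) = (if i = j then 1 else 0)" if "i < r" "j < r" for i j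
    using e that by (simp add: orthonormal_basis_def r_def)
  have e3: "x = (\<Sum>i<r. ip n x (e i) *\<^sub>R e i)" if "x \<in> span B" for x
    using e that by (auto simp: orthonormal_basis_def r_def)
  \<comment> \<open>The residual of \<open>b\<close>: orthogonal to all earlier basis vectors and
    nonzero because \<open>b\<close> is not in their span.\<close>
  define d where "d = b - (\<Sum>i<r. ip n b (e i) *\<^sub>R e i)"
  have bd: "b - d \<in> span B"
    unfolding d_def by (auto intro!: span_sum span_scale e1)
  have "b \<notin> span B"
    using insert.hyps insert.prems by (meson independent_insert)
  then have d0: "d \<noteq> 0" using bd by auto
  have "span (insert b B) \<subseteq> Rn n"
    by (rule span_minimal[OF _ subspace_Rn]) (use insert.prems in auto)
  moreover have dspan: "d \<in> span (insert b B)"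
    unfolding d_def by (intro span_diff span_sum span_scale span_base[of b])
       (use e1 span_mono[of B "insert b B"] in auto)
  ultimately have vd: "vn n d \<noteq> 0" using d0 vn_eq_0 by blast
  have ide: "ip n d (e j) = 0" if "j < r" for j
    using that unfolding d_def by (simp add: ip_simps e2 if_distrib cong: if_cong)
  have idB: "ip n y d = 0" if "y \<in> span B" for y
  proof -
    have "ip n y d = (\<Sum>i<r. ip n y (e i) * ip n (e i) d)"
      by (subst e3[OF that]) (simp add: ip_simps)
    then show ?thesis by (simp add: ip_commute[of n _ d] ide)
  qed
  define e' where "e' = e(r := (1 / vn n d) *\<^sub>R d)"
  have e'r: "e' r = (1 / vn n d) *\<^sub>R d" and e'l: "i < r \<Longrightarrow> e' i = e i" for i
    by (auto simp: e'_def)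
  have "orthonormal_basis n (span (insert b B)) (Suc r) e'"
    unfolding orthonormal_basis_def
  proof (intro conjI allI impI ballI)
    fix i assume "i < Suc r"
    then show "e' i \<in> span (insert b B)"
      using e1[of i] dspan span_mono[of B "insert b B"]
      by (cases "i = r") (auto simp: e'r e'l intro: span_scale)
  next
    fix i j assume "i < Suc r" "j < Suc r"
    moreover have "ip n d d \<noteq> 0" using vd by (simp add: ip_self)
    ultimately show "ip n (e' i) (e' j) = (if i = j then 1 else 0)"
      using vd ide ide[unfolded ip_commute[of n d]]
      by (auto simp: less_Suc_eq e'r e'l e2 ip_simps ip_self[of n d] power2_eq_square)
  next
    fix x assume "x \<in> span (insert b B)"
    then obtain c where c: "x - c *\<^sub>R b \<in> span B" by (auto simp: span_insert)
    define y where "y = x - c *\<^sub>R d"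
    have "y = (x - c *\<^sub>R b) + c *\<^sub>R (b - d)" by (simp add: y_def algebra_simps)
    with c bd have y: "y \<in> span B" by (metis span_add span_scale)
    have x: "x = y + c *\<^sub>R d" by (simp add: y_def)
    have "(\<Sum>i<Suc r. ip n x (e' i) *\<^sub>R e' i) =
        (\<Sum>i<r. ip n y (e i) *\<^sub>R e i) + ip n x (e' r) *\<^sub>R e' r"
      by (simp add: e'l x ip_simps ide)
    also have "ip n x (e' r) *\<^sub>R e' r = c *\<^sub>R d"
      using vd by (simp add: x e'r ip_simps idB[OF y] ip_self power2_eq_square)
    finally show "x = (\<Sum>i<Suc r. ip n x (e' i) *\<^sub>R e' i)"
      using e3[OF y] x by metis
  qed
  then show ?case using insert.hyps by (auto simp: r_def)
qed

lemma orthonormal_basis_exists: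
  assumes "F \<in> grassmannian n k" "1 \<le> k"
  obtains e where "orthonormal_basis n F k e"
proof -
  have F: "subspace F" "F \<subseteq> Rn n" "dim F = k"
    using assms by (auto simp: grassmannian_def)
  obtain B where B: "B \<subseteq> F" "independent B" "F \<subseteq> span B" "card B = dim F"
    by (rule basis_exists)
  have "finite B" using B(4) F(3) assms(2) by (intro card_ge_0_finite) auto
  moreover have "span B = F"
    using B F(1) by (simp add: span_minimal subset_antisym)
  ultimately show ?thesis
    using orthonormal_basis_span[of B n] B F that by auto
qed

locale onb =
  fixes n :: nat and F :: "vector set" and k :: nat and e :: "nat \<Rightarrow> vector"
  assumes subF: "subspace F" and F_Rn: "F \<subseteq> Rn n" and onb: "orthonormal_basis n F k e"
begin

lemma e_in: "i < k \<Longrightarrow> e i \<in> F"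
  and e_orth: "i < k \<Longrightarrow> j < k \<Longrightarrow> ip n (e i) (e j) = (if i = j then 1 else 0)"
  and e_expand: "x \<in> F \<Longrightarrow> x = (\<Sum>i<k. ip n x (e i) *\<^sub>R e i)"
  using onb by (auto simp: orthonormal_basis_def)

text \<open>The definite description needs existence and uniqueness; both come from the Fourier sum,
  since a vector of F is determined by its inner products with the basis.\<close>

lemma orth_proj_eq: "orth_proj n F x = (\<Sum>i<k. ip n x (e i) *\<^sub>R e i)"
  unfolding orth_proj_def
proof (rule the_equality)
  let ?y = "\<Sum>i<k. ip n x (e i) *\<^sub>R e i"
  have "ip n (x - ?y) (e j) = 0" if "j < k" for j
    using that by (simp add: ip_simps e_orth if_distrib cong: if_cong)
  then have "ip n (x - ?y) z = 0" if "z \<in> F" for z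
    by (subst e_expand[OF that]) (simp add: ip_sum_right ip_scaleR_right)
  then show "?y \<in> F \<and> (\<forall>z\<in>F. ip n (x - ?y) z = 0)"
    by (auto intro!: subspace_sum subspace_scale subF e_in)
next
  fix y assume y: "y \<in> F \<and> (\<forall>z\<in>F. ip n (x - y) z = 0)"
  then have "ip n y (e i) = ip n x (e i)" if "i < k" for i
    using e_in[OF that] by (simp add: ip_diff_left)
  then have "(\<Sum>i<k. ip n x (e i) *\<^sub>R e i) = (\<Sum>i<k. ip n y (e i) *\<^sub>R e i)" by simp
  then show "y = (\<Sum>i<k. ip n x (e i) *\<^sub>R e i)"
    using e_expand[of y] y by metis
qed

lemma orth_proj_in: "orth_proj n F x \<in> F"
  by (auto simp: orth_proj_eq intro!: subspace_sum subspace_scale subF e_in)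

lemma orth_proj_id: "x \<in> F \<Longrightarrow> orth_proj n F x = x"
  using e_expand[of x] by (metis orth_proj_eq)

lemma ip_orth_proj: "z \<in> F \<Longrightarrow> ip n (orth_proj n F x) z = ip n x z"
proof -
  assume z: "z \<in> F"
  have "ip n (orth_proj n F x) z = (\<Sum>i<k. ip n x (e i) * ip n (e i) z)"
    by (simp add: orth_proj_eq ip_simps)
  also have "\<dots> = ip n x (\<Sum>i<k. ip n z (e i) *\<^sub>R e i)"
    by (simp add: ip_simps mult.commute ip_commute[of n z])
  finally show ?thesis using e_expand[OF z] by metis
qed

lemma linear_orth_proj: "linear (orth_proj n F)"
  by (rule linearI) (simp_all add: orth_proj_eq ip_simps scaleR_add_left sum.distrib scaleR_sum_right)

text \<open>Links the map on vectors with the matrix that generates the Borel sets of the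
  Grassmannian, so that projections become measurable in F and continuous in the vector. It holds
  for every \<open>x\<close>, because both sides see only the first n coordinates.\<close>

lemma mat_vec_proj_matrix: "mat_vec n (proj_matrix n F) x = orth_proj n F x"
proof
  fix i
  have d: "ip n (\<lambda>l. if l = j then 1 else 0) y = y j" if "j < n" for j y
    using that by (simp add: ip_def if_distrib[of "\<lambda>t. t * _"] cong: if_cong)
  have "mat_vec n (proj_matrix n F) x i = (\<Sum>j<n. (\<Sum>l<k. e l j * e l i) * x j)"
    by (simp add: mat_vec_def proj_matrix_def orth_proj_eq sum_fun_apply d)
  also have "\<dots> = (\<Sum>l<k. (\<Sum>j<n. x j * e l j) * e l i)"
    unfolding sum_distrib_right by (subst sum.swap) (simp add: mult_ac)
  also have "\<dots> = orth_proj n F x i"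
    by (simp add: orth_proj_eq sum_fun_apply ip_def)
  finally show "mat_vec n (proj_matrix n F) x i = orth_proj n F x i" .
qed

lemma ip_expand: "x \<in> F \<Longrightarrow> y \<in> F \<Longrightarrow> ip n x y = (\<Sum>i<k. ip n x (e i) * ip n y (e i))"
proof -
  assume x: "x \<in> F" and y: "y \<in> F"
  have "ip n x y = ip n x (\<Sum>i<k. ip n y (e i) *\<^sub>R e i)"
    by (rule arg_cong[OF e_expand[OF y]])
  also have "\<dots> = (\<Sum>i<k. ip n x (e i) * ip n y (e i))" by (simp add: ip_simps mult.commute)
  finally show ?thesis .
qed

end

lemma onb_grassmannian:
  assumes "F \<in> grassmannian n k" "1 \<le> k"
  obtains e where "onb n F k e"
proof -
  obtain e where "orthonormal_basis n F k e"
    by (rule orthonormal_basis_exists[OF assms])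
  then have "onb n F k e"
    using assms(1) by (intro onb.intro) (auto simp: grassmannian_def)
  then show ?thesis by (rule that)
qed

section \<open>The action of orthogonal matrices\<close>

lemma mat_vec_in_Rn:
  assumes "U \<in> orthogonal_group n" shows "mat_vec n U x \<in> Rn n"
  using assms by (auto simp: mem_Rn mat_vec_def orthogonal_group_def)

lemma mat_vec_mat_mul: "mat_vec n (mat_mul n V U) x = mat_vec n V (mat_vec n U x)"
proof
  fix i
  show "mat_vec n (mat_mul n V U) x i = mat_vec n V (mat_vec n U x) i"
    unfolding mat_vec_def mat_mul_def sum_distrib_right sum_distrib_left
    by (subst sum.swap) (simp add: mult.assoc)
qed

lemma ip_adj: "ip n (mat_vec n (adj U) x) y = ip n x (mat_vec n U y)"
  unfolding ip_def mat_vec_def adj_def sum_distrib_right sum_distrib_left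
  by (subst sum.swap) (simp add: mult_ac)

lemma vn_mat_vec:
  assumes "U \<in> orthogonal_group n" "x \<in> Rn n"
  shows "vn n (mat_vec n U x) = vn n x"
  using assms unfolding sqrt_ip_self[symmetric] orthogonal_group_def by auto

lemma linear_mat_vec: "linear (mat_vec n U)"
  by (rule linearI) (auto simp: mat_vec_def fun_eq_iff algebra_simps sum.distrib sum_distrib_left)

text \<open>The witness is a Householder reflection.\<close>

lemma orthogonal_group_transitive:
  assumes x: "x \<in> Rn n" and y: "y \<in> Rn n" and eq: "vn n x = vn n y"
  obtains V where "V \<in> orthogonal_group n" "mat_vec n V x = y"
proof -
  define w where "w = x - y"
  have w: "w \<in> Rn n" using x y by (simp add: w_def subspace_diff[OF subspace_Rn])
  \<comment> \<open>With q = 0 for x = y the reflection degenerates to the identity, so one formula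
    for V serves both cases.\<close>
  define q where "q = (if w = 0 then 0 else 2 / ip n w w)"
  have q: "q * ip n w w = (if w = 0 then 0 else 2)"
    using vn_eq_0[OF w] by (simp add: q_def ip_self)
  define V :: matrix where "V = (\<lambda>i j. if i < n \<and> j < n then (if i = j then 1 else 0) - q * w i * w j else 0)"
  have V: "mat_vec n V z = z - (q * ip n w z) *\<^sub>R w" if z: "z \<in> Rn n" for z
  proof
    fix i
    show "mat_vec n V z i = (z - (q * ip n w z) *\<^sub>R w) i"
    proof (cases "i < n")
      case True
      have "mat_vec n V z i = (\<Sum>j<n. (if i = j then z j else 0) - q * w i * (w j * z j))"
        unfolding mat_vec_def V_def using True by (intro sum.cong) (auto simp: algebra_simps)
      then show ?thesis using True
        by (simp add: sum_subtractf ip_def flip: sum_distrib_left)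
    next
      case False
      then show ?thesis using w z by (simp add: mat_vec_def V_def mem_Rn)
    qed
  qed
  have "ip n (mat_vec n V u) (mat_vec n V v) = ip n u v" if "u \<in> Rn n" "v \<in> Rn n" for u v
  proof -
    have "ip n (mat_vec n V u) (mat_vec n V v) =
      ip n u v - q * ip n w u * ip n w v * (2 - q * ip n w w)"
      using that by (simp add: V ip_simps ip_commute[of n u w] ip_commute[of n v w] algebra_simps)
    also have "q * ip n w u * ip n w v * (2 - q * ip n w w) = 0"
      by (simp add: q) (simp add: q_def)
    finally show ?thesis by simp
  qed
  then have "V \<in> orthogonal_group n" by (auto simp: orthogonal_group_def V_def)
  moreover have "mat_vec n V x = y"
  proof -
    have "ip n x x = ip n y y" using eq by (simp add: ip_self)
    then have "ip n w w = 2 * ip n w x"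
      by (simp add: w_def ip_simps ip_commute[of n y x])
    moreover have "w = 0 \<Longrightarrow> q = 0" by (simp add: q_def)
    ultimately have "q * ip n w x = (if w = 0 then 0 else 1)" using q by auto
    then show ?thesis using x by (simp add: V w_def split: if_splits)
  qed
  ultimately show ?thesis using that by blast
qed

section \<open>Support functions\<close>

definition supn :: "nat \<Rightarrow> vector \<Rightarrow> real"
  where "supn n x = Max ((\<lambda>i. \<bar>x i\<bar>) ` {..<n})"

lemma abs_le_supn: "i < n \<Longrightarrow> \<bar>x i\<bar> \<le> supn n x"
  unfolding supn_def by (rule Max_ge) auto

lemma supn_attained:
  assumes "1 \<le> n" obtains i where "i < n" "supn n x = \<bar>x i\<bar>"
proof -
  have "supn n x \<in> (\<lambda>i. \<bar>x i\<bar>) ` {..<n}"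
    unfolding supn_def using assms by (intro Max_in) (auto simp: lessThan_empty_iff)
  then show ?thesis using that by auto
qed

lemma supn_nonneg: "1 \<le> n \<Longrightarrow> 0 \<le> supn n x"
  by (metis supn_attained abs_ge_zero)

lemma supn_triangle: "1 \<le> n \<Longrightarrow> supn n (x + y) \<le> supn n x + supn n y"
proof -
  assume "1 \<le> n"
  then obtain i where i: "i < n" "supn n (x + y) = \<bar>(x + y) i\<bar>" by (rule supn_attained)
  then show ?thesis using abs_le_supn[of i n x] abs_le_supn[of i n y] by simp
qed

lemma supn_scaleR: "1 \<le> n \<Longrightarrow> supn n (r *\<^sub>R x) = \<bar>r\<bar> * supn n x"
proof (rule antisym)
  assume n: "1 \<le> n"
  obtain i where i: "i < n" "supn n x = \<bar>x i\<bar>" using n by (rule supn_attained)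
  then show "\<bar>r\<bar> * supn n x \<le> supn n (r *\<^sub>R x)"
    using abs_le_supn[of i n "r *\<^sub>R x"] by (simp add: abs_mult)
  obtain j where j: "j < n" "supn n (r *\<^sub>R x) = \<bar>(r *\<^sub>R x) j\<bar>" using n by (rule supn_attained)
  then show "supn n (r *\<^sub>R x) \<le> \<bar>r\<bar> * supn n x"
    using abs_le_supn[of j n x] by (simp add: abs_mult mult_left_mono)
qed

lemma supn_le_vn: "1 \<le> n \<Longrightarrow> supn n x \<le> vn n x"
proof -
  assume "1 \<le> n"
  then obtain i where i: "i < n" "supn n x = \<bar>x i\<bar>" by (rule supn_attained)
  then show ?thesis using member_le_L2_set[of "{..<n}" i "\<lambda>i. \<bar>x i\<bar>"] by (simp add: L2_set_def)
qed

lemma vn_le_supn: "vn n x \<le> sqrt (real n) * supn n x"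
proof (cases "n = 0")
  case False
  then have "0 \<le> supn n x" by (intro supn_nonneg) auto
  have "(\<Sum>i<n. (x i)\<^sup>2) \<le> (\<Sum>i<n. (supn n x)\<^sup>2)"
    by (rule sum_mono) (metis abs_le_supn lessThan_iff abs_ge_zero power2_abs power_mono)
  then have "vn n x \<le> sqrt (real n * (supn n x)\<^sup>2)"
    unfolding L2_set_def by (intro real_sqrt_le_mono) simp
  then show ?thesis using \<open>0 \<le> supn n x\<close> by (simp add: real_sqrt_mult)
qed simp

section \<open>The polar of the cube: an l1 ball of radius 2, with support function
  \<open>2 * supn\<close>\<close>

lemma polar_cube: "polar n (cube n) = {x \<in> Rn n. (\<Sum>i<n. \<bar>x i\<bar>) \<le> 2}"
proof (intro equalityI subsetI)
  fix x assume x: "x \<in> polar n (cube n)"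
  \<comment> \<open>On the coordinates where x is nonzero this is the sign pattern of x scaled into
    the cube, which turns the inner product into half the l1 norm.\<close>
  define y :: vector where "y = (\<lambda>i. if i < n then sgn (x i) / 2 else 0)"
  have "y \<in> cube n" by (auto simp: y_def cube_def mem_Rn sgn_if)
  then have "ip n x y \<le> 1" using x by (auto simp: polar_def)
  moreover have "ip n x y = (\<Sum>i<n. \<bar>x i\<bar> / 2)"
    unfolding ip_def by (rule sum.cong) (auto simp: y_def abs_sgn)
  ultimately show "x \<in> {x \<in> Rn n. (\<Sum>i<n. \<bar>x i\<bar>) \<le> 2}"
    using x by (simp add: polar_def flip: sum_divide_distrib)
next
  fix x assume x: "x \<in> {x \<in> Rn n. (\<Sum>i<n. \<bar>x i\<bar>) \<le> 2}"
  have "ip n x y \<le> 1" if y: "y \<in> cube n" for y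
  proof -
    have "x i * y i \<le> \<bar>x i\<bar> / 2" if "i < n" for i
    proof -
      have "\<bar>y i\<bar> \<le> 1 / 2" using y that by (auto simp: cube_def abs_le_iff)
      then have "\<bar>x i\<bar> * \<bar>y i\<bar> \<le> \<bar>x i\<bar> * (1 / 2)" by (intro mult_left_mono) auto
      then show ?thesis using abs_ge_self[of "x i * y i"] by (simp add: abs_mult)
    qed
    then have "ip n x y \<le> (\<Sum>i<n. \<bar>x i\<bar> / 2)"
      unfolding ip_def by (intro sum_mono) auto
    then show ?thesis using x by (simp flip: sum_divide_distrib)
  qed
  then show "x \<in> polar n (cube n)" using x by (simp add: polar_def)
qed

lemma ip_polar_cube_le:
  assumes "w \<in> polar n (cube n)" "1 \<le> n" shows "ip n w v \<le> 2 * supn n v"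
proof -
  have "ip n w v \<le> (\<Sum>i<n. \<bar>w i\<bar> * supn n v)"
    unfolding ip_def
  proof (rule sum_mono)
    fix i assume "i \<in> {..<n}"
    then have "\<bar>w i\<bar> * \<bar>v i\<bar> \<le> \<bar>w i\<bar> * supn n v" by (intro mult_left_mono abs_le_supn) auto
    then show "w i * v i \<le> \<bar>w i\<bar> * supn n v" using abs_ge_self[of "w i * v i"] by (simp add: abs_mult)
  qed
  also have "\<dots> \<le> 2 * supn n v"
    unfolding sum_distrib_right[symmetric] using assms
    by (intro mult_right_mono supn_nonneg) (auto simp: polar_cube)
  finally show ?thesis .
qed

text \<open>A linear functional on the l1 ball peaks at a vertex: the multiple 2 sgn (v_i) of the
  unit vector at a coordinate i where |v_i| is largest. For v_i = 0 the witness is 0 and both sides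
  vanish.\<close>

lemma ip_polar_cube_attained:
  assumes "1 \<le> n" obtains w where "w \<in> polar n (cube n)" "ip n w v = 2 * supn n v"
proof -
  obtain i where i: "i < n" "supn n v = \<bar>v i\<bar>" using assms by (rule supn_attained)
  define w :: vector where "w = (\<lambda>j. if j = i then 2 * sgn (v i) else 0)"
  have "(\<Sum>j<n. \<bar>w j\<bar>) = (\<Sum>j<n. if j = i then 2 * \<bar>sgn (v i)\<bar> else 0)"
    by (rule sum.cong) (auto simp: w_def abs_mult)
  also have "\<dots> \<le> 2" using i by (simp add: abs_sgn_eq)
  finally have "w \<in> polar n (cube n)" using i by (auto simp: polar_cube mem_Rn w_def)
  moreover have "ip n w v = (\<Sum>j<n. if j = i then 2 * \<bar>v i\<bar> else 0)"
    unfolding ip_def by (rule sum.cong) (auto simp: w_def abs_sgn)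
  ultimately show ?thesis using i that by simp
qed

lemma continuous_on_coord [continuous_intros]: "continuous_on A (\<lambda>x :: vector. x i)"
  by (rule continuous_on_subset[OF continuous_on_product_coordinates]) auto

lemma continuous_on_ip [continuous_intros]:
  assumes "continuous_on A f" "continuous_on A g" shows "continuous_on A (\<lambda>x. ip n (f x) (g x))"
  unfolding ip_def
  by (intro continuous_on_sum continuous_on_mult
      continuous_on_product_then_coordinatewise[OF assms(1)]
      continuous_on_product_then_coordinatewise[OF assms(2)])

text \<open>Tychonoff: the l1 ball is a closed part of a product of compact sets, in which the
  coordinates beyond n are pinned to {0}.\<close>

lemma compact_polar_cube: "compact (polar n (cube n))"
proof -
  define S where "S = (\<lambda>i. if i < n then {-2..2} else {0::real})"
  have "compactin (product_topology (\<lambda>i. euclidean) UNIV) (PiE UNIV S)"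
    by (subst compactin_PiE) (auto simp: S_def)
  then have "compact (PiE UNIV S)"
    by (simp add: euclidean_product_topology)
  moreover have "closed {x :: vector. (\<Sum>i<n. \<bar>x i\<bar>) \<le> 2}"
    by (intro closed_Collect_le continuous_intros)
  moreover have "polar n (cube n) = PiE UNIV S \<inter> {x. (\<Sum>i<n. \<bar>x i\<bar>) \<le> 2}"
  proof -
    have "\<bar>x i\<bar> \<le> 2" if "(\<Sum>i<n. \<bar>x i\<bar>) \<le> 2" "i < n" for x :: vector and i
      using member_le_sum[of i "{..<n}" "\<lambda>i. \<bar>x i\<bar>"] that by auto
    moreover have "PiE UNIV S = {x \<in> Rn n. \<forall>i<n. \<bar>x i\<bar> \<le> 2}"
    proof (intro equalityI subsetI)
      fix x assume x: "x \<in> PiE UNIV S"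
      have S: "x i \<in> S i" for i using x by (rule PiE_mem) simp
      have "x i = 0" if "n \<le> i" for i using S[of i] that by (simp add: S_def)
      moreover have "\<bar>x i\<bar> \<le> 2" if "i < n" for i using S[of i] that by (simp add: S_def abs_le_iff)
      ultimately show "x \<in> {x \<in> Rn n. \<forall>i<n. \<bar>x i\<bar> \<le> 2}" by (simp add: mem_Rn)
    next
      fix x assume x: "x \<in> {x \<in> Rn n. \<forall>i<n. \<bar>x i\<bar> \<le> 2}"
      have "x i \<in> S i" for i using x by (cases "i < n") (simp_all add: S_def mem_Rn abs_le_iff minus_le_iff)
      then show "x \<in> PiE UNIV S" by (simp add: PiE_iff)
    qed
    ultimately show ?thesis
      by (auto simp: polar_cube)
  qed
  ultimately show ?thesis by (simp add: compact_Int_closed)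
qed

lemma convex_polar_cube: "convex (polar n (cube n))"
proof (rule convexI)
  fix x y and u v :: real
  assume *: "x \<in> polar n (cube n)" "y \<in> polar n (cube n)" "0 \<le> u" "0 \<le> v" "u + v = 1"
  have "(\<Sum>i<n. \<bar>(u *\<^sub>R x + v *\<^sub>R y) i\<bar>) \<le> (\<Sum>i<n. u * \<bar>x i\<bar> + v * \<bar>y i\<bar>)"
  proof (rule sum_mono)
    fix i show "\<bar>(u *\<^sub>R x + v *\<^sub>R y) i\<bar> \<le> u * \<bar>x i\<bar> + v * \<bar>y i\<bar>"
      using *(3,4) abs_triangle_ineq[of "u * x i" "v * y i"] by (simp add: abs_mult)
  qed
  also have "\<dots> = u * (\<Sum>i<n. \<bar>x i\<bar>) + v * (\<Sum>i<n. \<bar>y i\<bar>)"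
    by (simp add: sum.distrib sum_distrib_left)
  also have "\<dots> \<le> u * 2 + v * 2"
    using * by (intro add_mono mult_left_mono) (auto simp: polar_cube)
  also have "\<dots> = 2" using *(5) by (simp flip: distrib_right)
  finally show "u *\<^sub>R x + v *\<^sub>R y \<in> polar n (cube n)"
    using * by (auto simp: polar_cube intro: subspace_add subspace_scale subspace_Rn)
qed

lemma continuous_on_vector_add [continuous_intros]:
  fixes f g :: "'a::topological_space \<Rightarrow> vector"
  assumes "continuous_on A f" "continuous_on A g" shows "continuous_on A (\<lambda>x. f x + g x)"
  by (rule continuous_on_coordinatewise_then_product)
    (use assms in \<open>auto intro!: continuous_intros intro: continuous_on_product_then_coordinatewise\<close>)

lemma compact_set_plus:
  fixes A B :: "vector set"
  assumes "compact A" "compact B" shows "compact (A + B)"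
  unfolding set_plus_image
  by (rule compact_continuous_image)
    (auto intro!: compact_Times assms continuous_on_vector_add continuous_on_fst continuous_on_snd continuous_on_id simp: split_beta)

lemma compact_set_sum:
  fixes A :: "'a \<Rightarrow> vector set"
  shows "(\<And>i. i \<in> I \<Longrightarrow> compact (A i)) \<Longrightarrow> compact (\<Sum>i\<in>I. A i)"
  by (induction I rule: infinite_finite_induct) (auto simp: compact_set_plus set_zero)

lemma continuous_on_mat_vec: "continuous_on A (mat_vec n U)"
  unfolding mat_vec_def
  by (intro continuous_on_coordinatewise_then_product continuous_intros)

text \<open>Separation by the nearest point of \<open>K\<close> to \<open>v\<close>.\<close>

lemma in_convex_by_support:
  assumes K: "K \<subseteq> F" "convex K" "compact K" and F: "subspace F" "F \<subseteq> Rn n" and v: "v \<in> F"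
    and sup: "\<And>d. d \<in> F \<Longrightarrow> \<exists>z\<in>K. ip n v d \<le> ip n z d"
  shows "v \<in> K"
proof -
  have "K \<noteq> {}" using sup[OF v] by auto
  moreover have "continuous_on K (\<lambda>z. ip n v v - 2 * ip n v z + ip n z z)"
    by (intro continuous_intros)
  ultimately obtain q where q: "q \<in> K"
    "\<And>z. z \<in> K \<Longrightarrow> ip n v v - 2 * ip n v q + ip n q q \<le> ip n v v - 2 * ip n v z + ip n z z"
    using continuous_attains_inf[of K] K(3) by blast
  define d where "d = v - q"
  have d: "d \<in> F" using q K v F by (auto simp: d_def intro: subspace_diff)
  obtain z where z: "z \<in> K" "ip n v d \<le> ip n z d" using sup[OF d] by auto
  define w where "w = z - q"
  \<comment> \<open>First variation: moving from the nearest point q towards z inside K cannot bring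
    the point closer to v. Letting t tend to 0 will give \<open>ip n d w\<close> \<le> 0.\<close>
  have ineq: "2 * ip n d w \<le> t * ip n w w" if t: "0 < t" "t \<le> 1" for t
  proof -
    have "(1 - t) *\<^sub>R q + t *\<^sub>R z \<in> K" using t q z K by (intro convexD) auto
    also have "(1 - t) *\<^sub>R q + t *\<^sub>R z = q + t *\<^sub>R w" by (simp add: w_def algebra_simps)
    finally have "ip n v v - 2 * ip n v q + ip n q q
        \<le> ip n v v - 2 * ip n v (q + t *\<^sub>R w) + ip n (q + t *\<^sub>R w) (q + t *\<^sub>R w)"
      by (rule q)
    then have "t * (2 * ip n d w) \<le> t * (t * ip n w w)"
      by (simp add: ip_simps d_def ip_commute[of n w q] algebra_simps)
    then show ?thesis using t by simp
  qed
  have "2 * ip n d w \<le> 0"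
  proof (rule ccontr)
    assume neg: "\<not> 2 * ip n d w \<le> 0"
    have w0: "0 \<le> ip n w w" by (simp add: ip_self)
    \<comment> \<open>Small enough that t |w|^2 \<le> <d, w>, which contradicts \<open>ineq\<close>
      if <d, w> is positive; the + 1 avoids dividing by 0 when w = 0.\<close>
    define t where "t = min 1 (ip n d w / (ip n w w + 1))"
    have t: "0 < t" "t \<le> 1" "t \<le> ip n d w / (ip n w w + 1)" using neg w0 by (auto simp: t_def)
    have "t * ip n w w \<le> t * (ip n w w + 1)" using t by simp
    also have "\<dots> \<le> ip n d w" using t(3) w0 by (simp add: field_simps)
    finally show False using ineq[OF t(1,2)] neg by simp
  qed
  moreover have "ip n d d \<le> ip n d w"
  proof -
    have "ip n d d = ip n v d - ip n q d" by (metis d_def ip_diff_left)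
    moreover have "ip n d w = ip n z d - ip n q d" by (metis w_def ip_diff_left ip_commute)
    ultimately show ?thesis using z(2) by simp
  qed
  ultimately have "(vn n d)\<^sup>2 \<le> 0" unfolding ip_self[symmetric] by linarith
  then have "d = 0" using vn_eq_0[of d n] d F by (auto simp: ip_self)
  then show ?thesis using q by (simp add: d_def)
qed

section \<open>The function g of the overview, the projected body and its geometric distance to the
  ball\<close>

definition sup_sum :: "nat \<Rightarrow> nat \<Rightarrow> (nat \<Rightarrow> matrix) \<Rightarrow> vector \<Rightarrow> real"
  where "sup_sum n m U x = (\<Sum>j\<in>{1..m}. supn n (mat_vec n (U j) x))"

lemma sup_sum_triangle: "1 \<le> n \<Longrightarrow> sup_sum n m U (x + y) \<le> sup_sum n m U x + sup_sum n m U y"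
  unfolding sup_sum_def sum.distrib[symmetric]
  by (intro sum_mono) (simp add: linear_add[OF linear_mat_vec] supn_triangle del: plus_fun_apply)

lemma sup_sum_scaleR: "1 \<le> n \<Longrightarrow> sup_sum n m U (r *\<^sub>R x) = \<bar>r\<bar> * sup_sum n m U x"
  by (simp add: sup_sum_def linear_scale[OF linear_mat_vec] supn_scaleR sum_distrib_left)

lemma sup_sum_le:
  assumes "1 \<le> n" "\<And>j. j \<in> {1..m} \<Longrightarrow> U j \<in> orthogonal_group n" "x \<in> Rn n"
  shows "sup_sum n m U x \<le> real m * vn n x"
proof -
  have "sup_sum n m U x \<le> (\<Sum>j\<in>{1..m}. vn n x)"
    unfolding sup_sum_def using assms
    by (intro sum_mono) (metis supn_le_vn vn_mat_vec)
  then show ?thesis by simp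
qed

lemma sup_sum_ge:
  assumes "1 \<le> n" "\<And>j. j \<in> {1..m} \<Longrightarrow> U j \<in> orthogonal_group n" "x \<in> Rn n"
  shows "real m * vn n x \<le> sqrt (real n) * sup_sum n m U x"
proof -
  have "(\<Sum>j\<in>{1..m}. vn n x) \<le> sqrt (real n) * sup_sum n m U x"
    unfolding sup_sum_def sum_distrib_left using assms
    by (intro sum_mono) (metis vn_le_supn vn_mat_vec)
  then show ?thesis by simp
qed

lemma avg_body_eq: "avg_body n m U =
  {(1 / real m) *\<^sub>R (\<Sum>j\<in>{1..m}. mat_vec n (adj (U j)) (w j)) |w. \<forall>j\<in>{1..m}. w j \<in> polar n (cube n)}"
  (is "_ = ?R")
proof (intro equalityI subsetI)
  fix x assume "x \<in> avg_body n m U"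
  then obtain s where s: "\<forall>j\<in>{1..m}. s j \<in> mat_vec n (adj (U j)) ` polar n (cube n)"
    "x = (1 / real m) *\<^sub>R sum s {1..m}"
    by (auto simp: avg_body_def set_sum_alt)
  then have "\<forall>j\<in>{1..m}. \<exists>w. w \<in> polar n (cube n) \<and> s j = mat_vec n (adj (U j)) w" by auto
  then obtain w where "\<forall>j\<in>{1..m}. w j \<in> polar n (cube n) \<and> s j = mat_vec n (adj (U j)) (w j)"
    by metis
  then show "x \<in> ?R" using s by (auto intro!: exI[of _ w] sum.cong)
next
  fix x assume "x \<in> ?R"
  then show "x \<in> avg_body n m U"
    by (auto simp: avg_body_def set_sum_alt)
qed

context onb
begin

abbreviation proj_body :: "nat \<Rightarrow> (nat \<Rightarrow> matrix) \<Rightarrow> vector set"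
  where "proj_body m U \<equiv> orth_proj n F ` avg_body n m U"

lemma proj_body_subset: "proj_body m U \<subseteq> F"
  using orth_proj_in by auto

lemma compact_proj_body: "compact (proj_body m U)"
proof -
  have "continuous_on A (\<lambda>x :: vector. r *\<^sub>R x)" for A r
    by (intro continuous_on_coordinatewise_then_product) (auto intro!: continuous_intros)
  moreover have "orth_proj n F = mat_vec n (proj_matrix n F)"
    using mat_vec_proj_matrix by auto
  ultimately show ?thesis
    unfolding avg_body_def
    by (auto intro!: compact_continuous_image compact_set_sum compact_polar_cube continuous_on_mat_vec)
qed

lemma convex_proj_body: "convex (proj_body m U)"
  unfolding avg_body_def
  by (intro convex_linear_image linear_orth_proj convex_scaling convex_set_sum linear_mat_vec convex_polar_cube)

lemma ip_proj_body_le: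
  assumes "z \<in> proj_body m U" "d \<in> F" "1 \<le> n"
  shows "ip n z d \<le> 2 / real m * sup_sum n m U d"
proof -
  obtain w where w: "\<forall>j\<in>{1..m}. w j \<in> polar n (cube n)"
    "z = orth_proj n F ((1 / real m) *\<^sub>R (\<Sum>j\<in>{1..m}. mat_vec n (adj (U j)) (w j)))"
    using assms(1) unfolding avg_body_eq by auto
  have "ip n z d = (\<Sum>j\<in>{1..m}. ip n (w j) (mat_vec n (U j) d)) / real m"
    using assms(2) by (simp add: w(2) ip_orth_proj ip_simps ip_adj)
  also have "\<dots> \<le> (\<Sum>j\<in>{1..m}. 2 * supn n (mat_vec n (U j) d)) / real m"
    using w assms by (intro divide_right_mono sum_mono ip_polar_cube_le) auto
  finally show ?thesis by (simp add: sup_sum_def sum_distrib_left sum_divide_distrib)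
qed

lemma ip_proj_body_attained:
  assumes "d \<in> F" "1 \<le> n"
  obtains z where "z \<in> proj_body m U" "ip n z d = 2 / real m * sup_sum n m U d"
proof -
  have "\<forall>j. \<exists>w. w \<in> polar n (cube n) \<and> ip n w (mat_vec n (U j) d) = 2 * supn n (mat_vec n (U j) d)"
    using ip_polar_cube_attained[OF assms(2)] by metis
  then obtain w where w: "\<And>j. w j \<in> polar n (cube n)"
    "\<And>j. ip n (w j) (mat_vec n (U j) d) = 2 * supn n (mat_vec n (U j) d)" by metis
  define z where "z = orth_proj n F ((1 / real m) *\<^sub>R (\<Sum>j\<in>{1..m}. mat_vec n (adj (U j)) (w j)))"
  have "z \<in> proj_body m U" using w(1) unfolding z_def avg_body_eq by auto
  moreover have "ip n z d = 2 / real m * sup_sum n m U d"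
    using assms(1) by (simp add: z_def ip_orth_proj ip_simps ip_adj w(2) sup_sum_def sum_distrib_left)
  ultimately show ?thesis by (rule that)
qed

text \<open>Inclusion of compact convex sets is comparison of support functions, and that of the
  ball is the norm. One direction tests with the unit vector along d; the converse is the separation
  result \<open>in_convex_by_support\<close>.\<close>

lemma scaled_ball_subset_proj_body:
  assumes n: "1 \<le> n" and r: "0 < r"
  shows "(\<lambda>x. r *\<^sub>R x) ` unit_ball_in n F \<subseteq> proj_body m U \<longleftrightarrow>
    (\<forall>d\<in>F. r * vn n d \<le> 2 / real m * sup_sum n m U d)"
proof (intro iffI ballI)
  fix d assume sub: "(\<lambda>x. r *\<^sub>R x) ` unit_ball_in n F \<subseteq> proj_body m U" and d: "d \<in> F"
  show "r * vn n d \<le> 2 / real m * sup_sum n m U d"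
  proof (cases "vn n d = 0")
    case True
    then show ?thesis using n by (simp add: sup_sum_def sum_nonneg supn_nonneg)
  next
    case False
    define v where "v = (1 / vn n d) *\<^sub>R d"
    have "v \<in> F" using d subF by (simp add: v_def subspace_scale)
    then have "v \<in> unit_ball_in n F"
      using False F_Rn by (auto simp: unit_ball_in_def sqrt_ip_self v_def vn_scaleR)
    then have "r *\<^sub>R v \<in> proj_body m U" using sub by auto
    from ip_proj_body_le[OF this d n] show ?thesis
      using False by (simp add: v_def ip_simps ip_self power2_eq_square)
  qed
next
  assume le: "\<forall>d\<in>F. r * vn n d \<le> 2 / real m * sup_sum n m U d"
  show "(\<lambda>x. r *\<^sub>R x) ` unit_ball_in n F \<subseteq> proj_body m U"
  proof
    fix x assume "x \<in> (\<lambda>x. r *\<^sub>R x) ` unit_ball_in n F"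
    then obtain v where v: "x = r *\<^sub>R v" "v \<in> F" "vn n v \<le> 1"
      by (auto simp: unit_ball_in_def sqrt_ip_self)
    show "x \<in> proj_body m U"
    proof (rule in_convex_by_support[OF proj_body_subset convex_proj_body compact_proj_body subF F_Rn])
      show "x \<in> F" using v subF by (simp add: subspace_scale)
      fix d assume d: "d \<in> F"
      obtain z where z: "z \<in> proj_body m U" "ip n z d = 2 / real m * sup_sum n m U d"
        using ip_proj_body_attained[OF d n] .
      have "ip n x d = r * ip n v d" by (simp add: v ip_simps)
      also have "\<dots> \<le> r * (vn n v * vn n d)"
        using abs_ip_le[of n v d] r by (intro mult_left_mono) auto
      also have "\<dots> \<le> r * (1 * vn n d)"
        using v r by (intro mult_left_mono mult_right_mono) (auto simp: L2_set_nonneg)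
      also have "\<dots> \<le> ip n z d" using le d z by simp
      finally show "\<exists>z\<in>proj_body m U. ip n x d \<le> ip n z d" using z by blast
    qed
  qed
qed

text \<open>Outer inclusion needs no separation: testing a point z of the body with the direction z
  itself gives |z|^2 \<le> b |z|.\<close>

lemma proj_body_subset_scaled_ball:
  assumes n: "1 \<le> n" and b: "0 < b"
  shows "proj_body m U \<subseteq> (\<lambda>x. b *\<^sub>R x) ` unit_ball_in n F \<longleftrightarrow>
    (\<forall>d\<in>F. 2 / real m * sup_sum n m U d \<le> b * vn n d)"
proof (intro iffI ballI)
  fix d assume sub: "proj_body m U \<subseteq> (\<lambda>x. b *\<^sub>R x) ` unit_ball_in n F" and d: "d \<in> F"
  obtain z where z: "z \<in> proj_body m U" "ip n z d = 2 / real m * sup_sum n m U d"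
    using ip_proj_body_attained[OF d n] .
  obtain v where v: "z = b *\<^sub>R v" "v \<in> F" "vn n v \<le> 1"
    using sub z by (auto simp: unit_ball_in_def sqrt_ip_self)
  have "ip n z d = b * ip n v d" by (simp add: v ip_simps)
  also have "\<dots> \<le> b * (vn n v * vn n d)"
    using abs_ip_le[of n v d] b by (intro mult_left_mono) auto
  also have "\<dots> \<le> b * (1 * vn n d)"
    using v b by (intro mult_left_mono mult_right_mono) (auto simp: L2_set_nonneg)
  finally show "2 / real m * sup_sum n m U d \<le> b * vn n d" using z by simp
next
  assume le: "\<forall>d\<in>F. 2 / real m * sup_sum n m U d \<le> b * vn n d"
  show "proj_body m U \<subseteq> (\<lambda>x. b *\<^sub>R x) ` unit_ball_in n F"
  proof
    fix z assume z: "z \<in> proj_body m U"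
    then have zF: "z \<in> F" using proj_body_subset by auto
    have "(vn n z)\<^sup>2 \<le> b * vn n z"
      using ip_proj_body_le[OF z zF n] le zF by (fastforce simp: ip_self)
    then have "vn n z \<le> b"
      using b L2_set_nonneg[of z "{..<n}"]
      by (cases "vn n z = 0") (simp_all add: power2_eq_square)
    then have "(1 / b) *\<^sub>R z \<in> unit_ball_in n F"
      using b zF F_Rn subF by (auto simp: unit_ball_in_def sqrt_ip_self vn_scaleR subspace_scale)
    moreover have "z = b *\<^sub>R ((1 / b) *\<^sub>R z)" using b by simp
    ultimately show "z \<in> (\<lambda>x. b *\<^sub>R x) ` unit_ball_in n F"
      by (intro image_eqI[where x = "(1 / b) *\<^sub>R z"])
  qed
qed

text \<open>The best b is the supremum of the support function on the unit sphere of F, and the best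
  a is then B / b. Both directions matter: one yields the distance bound, and together they make the
  event measurable. As the infimum is not known to be attained, the forward direction passes through
  every B' > B.\<close>

lemma geom_dist_le_iff:
  assumes n: "1 \<le> n" and m: "1 \<le> m" and k: "1 \<le> k"
    and U: "\<And>j. j \<in> {1..m} \<Longrightarrow> U j \<in> orthogonal_group n"
  shows "geom_dist (proj_body m U) (unit_ball_in n F) \<le> B \<longleftrightarrow>
    (\<forall>x\<in>F. \<forall>y\<in>F. sup_sum n m U x * vn n y \<le> B * (sup_sum n m U y * vn n x))"
proof -
  define h where "h d = 2 / real m * sup_sum n m U d" for d
  define S where "S = {a * b |a b. 0 < a \<and> 0 < b \<and>
    (\<forall>d\<in>F. inverse a * vn n d \<le> h d) \<and> (\<forall>d\<in>F. h d \<le> b * vn n d)}"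
  have geom: "geom_dist (proj_body m U) (unit_ball_in n F) = Inf S"
    unfolding geom_dist_def S_def h_def
    by (intro arg_cong[of _ _ Inf] Collect_cong ex_cong1 conj_cong refl
        scaled_ball_subset_proj_body[OF n] proj_body_subset_scaled_ball[OF n]) auto
  have h_le: "h d \<le> 2 * vn n d" if "d \<in> F" for d
    using sup_sum_le[OF n U, where x = d] F_Rn that m by (auto simp: h_def field_simps)
  have h_ge: "2 * vn n d \<le> sqrt n * h d" if "d \<in> F" for d
    using sup_sum_ge[OF n U, where x = d] F_Rn that m by (auto simp: h_def field_simps)
  have h_nonneg: "0 \<le> h d" for d
    using n by (simp add: h_def sup_sum_def sum_nonneg supn_nonneg)
  have h_scale: "h (r *\<^sub>R d) = \<bar>r\<bar> * h d" for r d
    using n by (simp add: h_def sup_sum_scaleR)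
  have e0: "e 0 \<in> F" "vn n (e 0) = 1"
    using e_in[of 0] e_orth[of 0 0] k L2_set_nonneg[of "e 0" "{..<n}"]
    by (auto simp: ip_self power2_eq_1_iff)
  have "0 \<le> sqrt n" by simp
  then have h_e0: "0 < h (e 0)"
    using h_ge[OF e0(1)] e0(2) h_nonneg[of "e 0"] by (cases "h (e 0) = 0") auto
  have in_S: "B \<in> S" if B: "\<forall>x\<in>F. \<forall>y\<in>F. h x * vn n y \<le> B * (h y * vn n x)" for B
  proof -
    \<comment> \<open>Take x = y to be a unit vector; B is then positive, so that B / b is an
      admissible scaling.\<close>
    have "1 \<le> B" using B e0 h_e0 by fastforce
    define E where "E = h ` {d \<in> F. vn n d = 1}"
    define b where "b = Sup E"
    have bdd: "bdd_above E"
      unfolding E_def by (rule bdd_aboveI[of _ 2]) (use h_le in fastforce)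
    have hb: "h d \<le> b * vn n d" if "d \<in> F" for d
    proof (cases "vn n d = 0")
      case True
      then show ?thesis using h_le[OF that] by simp
    next
      case False
      define v where "v = (1 / vn n d) *\<^sub>R d"
      have "v \<in> F" "vn n v = 1"
        using False that subF by (simp_all add: v_def vn_scaleR subspace_scale)
      then have "h v \<in> E" by (simp add: E_def)
      then have "h v \<le> b"
        unfolding b_def by (rule cSup_upper[OF _ bdd])
      moreover have "0 < vn n d" using False by (simp add: less_le L2_set_nonneg)
      ultimately show ?thesis by (simp add: v_def h_scale field_simps)
    qed
    have "b * vn n y \<le> B * h y" if y: "y \<in> F" for y
    proof (cases "vn n y = 0")
      case True then show ?thesis using h_nonneg \<open>1 \<le> B\<close> by simp
    next
      case False
      then have pos: "0 < vn n y" by (simp add: less_le L2_set_nonneg)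
      have "b \<le> B * h y / vn n y"
        unfolding b_def
      proof (rule cSup_least)
        show "E \<noteq> {}" using e0 by (auto simp: E_def)
        fix s assume "s \<in> E"
        then obtain d where "d \<in> F" "vn n d = 1" "s = h d" by (auto simp: E_def)
        then show "s \<le> B * h y / vn n y" using B y pos by (fastforce simp: field_simps)
      qed
      then show ?thesis using pos by (simp add: field_simps)
    qed
    then have "\<forall>d\<in>F. inverse (B / b) * vn n d \<le> h d"
      using \<open>1 \<le> B\<close> by (auto simp: field_simps)
    moreover have "0 < b" using hb[OF e0(1)] h_e0 e0(2) by simp
    ultimately show ?thesis
      unfolding S_def using hb \<open>1 \<le> B\<close>
      by (intro CollectI exI[of _ "B / b"] exI[of _ b]) auto
  qed
  have bddS: "bdd_below S" unfolding S_def by (rule bdd_belowI[of _ 0]) auto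
  \<comment> \<open>The trivial bound for the distance; it shows that \<open>Inf\<close> is taken
    over a nonempty set.\<close>
  have "sqrt n \<in> S"
  proof (rule in_S, intro ballI)
    fix x y assume xy: "x \<in> F" "y \<in> F"
    have "h x * vn n y \<le> (2 * vn n x) * vn n y"
      using h_le xy by (intro mult_right_mono) (auto simp: L2_set_nonneg)
    also have "\<dots> = vn n x * (2 * vn n y)" by simp
    also have "\<dots> \<le> vn n x * (sqrt n * h y)"
      using h_ge xy by (intro mult_left_mono) (auto simp: L2_set_nonneg)
    finally show "h x * vn n y \<le> sqrt n * (h y * vn n x)" by (simp add: mult_ac)
  qed
  then have neS: "S \<noteq> {}" by auto
  have "Inf S \<le> B \<longleftrightarrow> (\<forall>x\<in>F. \<forall>y\<in>F. h x * vn n y \<le> B * (h y * vn n x))"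
  proof
    assume B: "Inf S \<le> B"
    show "\<forall>x\<in>F. \<forall>y\<in>F. h x * vn n y \<le> B * (h y * vn n x)"
    proof (intro ballI)
      fix x y assume xy: "x \<in> F" "y \<in> F"
      define c where "c = h y * vn n x"
      have c0: "0 \<le> c" by (simp add: c_def h_nonneg L2_set_nonneg)
      have le: "h x * vn n y \<le> B' * c" if "B < B'" for B'
      proof -
        have "Inf S < B'" using B that by simp
        then obtain s where s: "s \<in> S" "s < B'" using cInf_less_iff[OF neS bddS] by auto
        then obtain a b where ab: "s = a * b" "0 < a" "0 < b"
          "inverse a * vn n y \<le> h y" "h x \<le> b * vn n x" using xy by (auto simp: S_def)
        have "h x * vn n y \<le> (b * vn n x) * (a * h y)"
          using ab h_nonneg by (intro mult_mono) (auto simp: field_simps L2_set_nonneg)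
        also have "\<dots> = s * c" by (simp add: ab c_def)
        also have "\<dots> \<le> B' * c" using s c0 by (intro mult_right_mono) auto
        finally show ?thesis .
      qed
      show "h x * vn n y \<le> B * (h y * vn n x)"
      proof (cases "c = 0")
        case True
        then show ?thesis using le[of "B + 1"] unfolding c_def[symmetric] by simp
      next
        case False
        with c0 have "0 < c" by simp
        have "h x * vn n y / c \<le> B"
          by (rule dense_ge) (use le \<open>0 < c\<close> in \<open>simp add: field_simps\<close>)
        then show ?thesis using \<open>0 < c\<close> by (simp add: c_def field_simps)
      qed
    qed
  next
    assume "\<forall>x\<in>F. \<forall>y\<in>F. h x * vn n y \<le> B * (h y * vn n x)"
    then show "Inf S \<le> B" by (intro cInf_lower in_S bddS)
  qed
  moreover have "h x * vn n y \<le> B * (h y * vn n x) \<longleftrightarrow>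
      sup_sum n m U x * vn n y \<le> B * (sup_sum n m U y * vn n x)" for x y
    using m by (simp add: h_def field_simps)
  ultimately show ?thesis by (simp add: geom)
qed

end

section \<open>Nets of spheres\<close>

text \<open>Two geometric series, one for each sign, with ratio q = exp (- \<delta>) and 1 - q \<ge>
  \<delta> / 2.\<close>

lemma sum_exp_abs_le:
  fixes \<delta> :: real
  assumes "0 < \<delta>" "\<delta> \<le> 1"
  shows "(\<Sum>j\<in>{- int J..int J}. exp (- \<delta> * \<bar>real_of_int j\<bar>)) \<le> 4 / \<delta>"
proof -
  let ?f = "\<lambda>j. exp (- \<delta> * \<bar>real_of_int j\<bar>)"
  define q where "q = exp (- \<delta>)"
  have q: "0 < q" "q < 1" using assms by (auto simp: q_def)
  have pow: "exp (- (\<delta> * real i)) = q ^ i" for i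
    by (simp add: q_def exp_of_nat_mult[symmetric] mult.commute)
  have "(\<Sum>j\<in>{- int J..int J}. ?f j) \<le> (\<Sum>j\<in>int ` {..J} \<union> (\<lambda>i. - int i) ` {..J}. ?f j)"
  proof (rule sum_mono2)
    show "{- int J..int J} \<subseteq> int ` {..J} \<union> (\<lambda>i. - int i) ` {..J}"
    proof
      fix j assume "j \<in> {- int J..int J}"
      then have "j = int (nat \<bar>j\<bar>) \<or> j = - int (nat \<bar>j\<bar>)" "nat \<bar>j\<bar> \<in> {..J}" by auto
      then show "j \<in> int ` {..J} \<union> (\<lambda>i. - int i) ` {..J}" by blast
    qed
  qed auto
  also have "\<dots> \<le> (\<Sum>j\<in>int ` {..J}. ?f j) + (\<Sum>j\<in>(\<lambda>i. - int i) ` {..J}. ?f j)"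
    by (subst sum.union_inter[symmetric]) (auto intro!: sum_nonneg)
  also have "\<dots> = 2 * (\<Sum>i\<le>J. q ^ i)"
    by (simp add: sum.reindex inj_on_def pow)
  also have "\<dots> \<le> 2 * (1 / (1 - q))"
    using sum_le_suminf[of "\<lambda>i. q ^ i" "{..J}"] q by (simp add: suminf_geometric)
  also have "\<dots> \<le> 4 / \<delta>"
  proof -
    have "q \<le> 1 / (1 + \<delta>)"
      using exp_ge_add_one_self[of \<delta>] assms by (simp add: q_def exp_minus field_simps)
    also have "\<dots> \<le> 1 - \<delta> / 2"
      using assms by (simp add: field_simps)
    finally show ?thesis using q assms by (simp add: field_simps)
  qed
  finally show ?thesis .
qed

text \<open>Exponential counting: every admissible lattice point has weight exp (\<delta> L) times
  the product of exp (- \<delta> |z_i|) at least 1, and over the whole box these weights sum to a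
  product of one-dimensional series. The cutoff J keeps everything finite and leaves no trace in the
  bound.\<close>

lemma card_lattice_l1_le:
  fixes \<delta> L :: real
  assumes "0 < \<delta>" "\<delta> \<le> 1"
  shows "real (card {z \<in> {..<k} \<rightarrow>\<^sub>E {- int J..int J}. (\<Sum>i<k. \<bar>real_of_int (z i)\<bar>) \<le> L}) \<le>
    exp (\<delta> * L) * (4 / \<delta>) ^ k"
proof -
  let ?P = "{..<k} \<rightarrow>\<^sub>E {- int J..int J}"
  let ?S = "{z \<in> ?P. (\<Sum>i<k. \<bar>real_of_int (z i)\<bar>) \<le> L}"
  have fin: "finite ?P" by (intro finite_PiE) auto
  have "real (card ?S) = (\<Sum>z\<in>?S. 1)" by simp
  also have "\<dots> \<le> (\<Sum>z\<in>?S. exp (\<delta> * L) * (\<Prod>i<k. exp (- \<delta> * \<bar>real_of_int (z i)\<bar>)))"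
  proof (rule sum_mono)
    fix z assume "z \<in> ?S"
    then have "\<delta> * (\<Sum>i<k. \<bar>real_of_int (z i)\<bar>) \<le> \<delta> * L" using assms by (intro mult_left_mono) auto
    then have "1 \<le> exp (\<delta> * L + (\<Sum>i<k. - \<delta> * \<bar>real_of_int (z i)\<bar>))"
      by (simp add: sum_negf sum_distrib_left)
    then show "1 \<le> exp (\<delta> * L) * (\<Prod>i<k. exp (- \<delta> * \<bar>real_of_int (z i)\<bar>))"
      by (simp only: exp_add exp_sum finite_lessThan)
  qed
  also have "\<dots> \<le> (\<Sum>z\<in>?P. exp (\<delta> * L) * (\<Prod>i<k. exp (- \<delta> * \<bar>real_of_int (z i)\<bar>)))"
    by (rule sum_mono2[OF fin]) (simp_all add: prod_nonneg)
  also have "\<dots> = exp (\<delta> * L) * (\<Prod>i<k. \<Sum>j\<in>{- int J..int J}. exp (- \<delta> * \<bar>real_of_int j\<bar>))"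
    by (subst prod_sum_PiE) (auto simp: sum_distrib_left)
  also have "\<dots> \<le> exp (\<delta> * L) * (\<Prod>i<k. 4 / \<delta>)"
    by (intro mult_left_mono prod_mono conjI sum_nonneg sum_exp_abs_le assms) auto
  finally show ?thesis by simp
qed

context onb
begin

lemma vn_eq_coords: "x \<in> F \<Longrightarrow> vn n x = L2_set (\<lambda>i. ip n x (e i)) {..<k}"
  unfolding sqrt_ip_self[symmetric] by (simp add: ip_expand ip_def[of k])

lemma vn_e: "i < k \<Longrightarrow> vn n (e i) = 1"
  using e_orth[of i i] unfolding sqrt_ip_self[symmetric] by simp

text \<open>Lattice counting in place of volumes: rounding the coordinates to a grid is injective on
  a separated set, and the rounded points have small l1 norm.\<close>

lemma card_separated_ball_le:
  assumes N: "finite N" "N \<subseteq> F" "\<And>x. x \<in> N \<Longrightarrow> vn n x \<le> 2"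
    "\<And>x y. x \<in> N \<Longrightarrow> y \<in> N \<Longrightarrow> x \<noteq> y \<Longrightarrow> \<delta> \<le> vn n (x - y)"
    and \<delta>: "0 < \<delta>" "\<delta> \<le> 1" and k: "1 \<le> k"
  shows "real (card N) \<le> (4 * exp 3 / \<delta>) ^ k"
proof -
  \<comment> \<open>A grid cell of side \<delta> / sqrt k has diameter \<delta>; being half-open, it
    contains no two \<delta>-separated points.\<close>
  define h where "h = \<delta> / sqrt k"
  have h: "0 < h" using \<delta> k by (simp add: h_def)
  define z where "z x = (\<lambda>i\<in>{..<k}. \<lfloor>ip n x (e i) / h\<rfloor>)" for x
  define J where "J = nat \<lceil>2 / h + 1\<rceil>"
  \<comment> \<open>Cauchy-Schwarz bounds the l1 norm of a rounded point by 2 k / \<delta> + k, and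
    \<delta> \<le> 1 absorbs the rounding error k. Then exp (\<delta> L) = exp 3 ^ k.\<close>
  define L where "L = 3 * real k / \<delta>"
  let ?S = "{z \<in> {..<k} \<rightarrow>\<^sub>E {- int J..int J}. (\<Sum>i<k. \<bar>real_of_int (z i)\<bar>) \<le> L}"
  have floor_le: "\<bar>real_of_int \<lfloor>t\<rfloor>\<bar> \<le> \<bar>t\<bar> + 1" for t :: real by linarith
  have "inj_on z N"
  proof (rule inj_onI, rule ccontr)
    fix x y assume x: "x \<in> N" and y: "y \<in> N" and eq: "z x = z y" and ne: "x \<noteq> y"
    have xy: "x - y \<in> F" using x y N subF by (auto intro: subspace_diff)
    have "\<bar>ip n (x - y) (e i)\<bar> < h" if "i < k" for i
    proof -
      have "\<lfloor>ip n x (e i) / h\<rfloor> = \<lfloor>ip n y (e i) / h\<rfloor>"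
        using fun_cong[OF eq, of i] that by (simp add: z_def)
      then have "\<bar>ip n x (e i) / h - ip n y (e i) / h\<bar> < 1" by linarith
      then show ?thesis using h by (simp add: ip_diff_left field_simps abs_less_iff)
    qed
    then have "(ip n (x - y) (e i))\<^sup>2 < h\<^sup>2" if "i < k" for i
      using that h by (metis abs_of_pos abs_square_less_1 abs_le_square_iff not_less)
    then have "(\<Sum>i<k. (ip n (x - y) (e i))\<^sup>2) < (\<Sum>i<k. h\<^sup>2)"
      using k by (intro sum_strict_mono) (auto simp: lessThan_empty_iff)
    also have "\<dots> = \<delta>\<^sup>2" using k by (simp add: h_def power_divide)
    finally have "(\<Sum>i<k. (ip n (x - y) (e i))\<^sup>2) < \<delta>\<^sup>2" .
    moreover have "(vn n (x - y))\<^sup>2 = (\<Sum>i<k. (ip n (x - y) (e i))\<^sup>2)"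
      using ip_expand[OF xy xy] by (simp only: ip_self power2_eq_square)
    ultimately have "(vn n (x - y))\<^sup>2 < \<delta>\<^sup>2" by (rule ord_eq_less_trans[rotated])
    then have "vn n (x - y) < \<delta>" by (rule power2_less_imp_less) (use \<delta> in simp)
    then show False using N(4)[OF x y ne] by simp
  qed
  moreover have "z ` N \<subseteq> ?S"
  proof (rule image_subsetI)
    fix x assume x: "x \<in> N"
    have "z x i \<in> {- int J..int J}" if "i < k" for i
    proof -
      have "\<bar>ip n x (e i)\<bar> \<le> 2" using abs_ip_le[of n x "e i"] N(3)[OF x] vn_e[OF that] by simp
      then have "\<bar>ip n x (e i) / h\<bar> \<le> 2 / h" using h by (simp add: divide_right_mono)
      then have "\<bar>real_of_int \<lfloor>ip n x (e i) / h\<rfloor>\<bar> \<le> 2 / h + 1" using floor_le[of "ip n x (e i) / h"] by linarith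
      also have "\<dots> \<le> real J" unfolding J_def by linarith
      finally show ?thesis using that by (simp add: z_def abs_le_iff)
    qed
    moreover have "(\<Sum>i<k. \<bar>real_of_int (z x i)\<bar>) \<le> L"
    proof -
      \<comment> \<open>The factor |1| is kept so that \<open>L2_set_mult_ineq\<close> can be used
        with the constant function 1.\<close>
      have "(\<Sum>i<k. \<bar>real_of_int (z x i)\<bar>) \<le> (\<Sum>i<k. \<bar>ip n x (e i)\<bar> * \<bar>1\<bar> / h + 1)"
        using h floor_le by (intro sum_mono) (simp add: z_def, metis abs_divide abs_of_pos)
      also have "\<dots> = (\<Sum>i<k. \<bar>ip n x (e i)\<bar> * \<bar>1\<bar>) / h + k"
        by (simp add: sum.distrib sum_divide_distrib)
      also have "(\<Sum>i<k. \<bar>ip n x (e i)\<bar> * \<bar>1\<bar>) \<le> L2_set (\<lambda>i. ip n x (e i)) {..<k} * L2_set (\<lambda>_. 1) {..<k}"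
        by (rule L2_set_mult_ineq)
      also have "\<dots> = vn n x * sqrt k"
        using vn_eq_coords[of x] N x by (auto simp: L2_set_def)
      also have "\<dots> \<le> 2 * sqrt k" using N(3)[OF x] by (intro mult_right_mono) auto
      also have "2 * sqrt k / h = 2 * k / \<delta>" using \<delta> k by (simp add: h_def)
      finally have "(\<Sum>i<k. \<bar>real_of_int (z x i)\<bar>) \<le> 2 * k / \<delta> + k"
        using h by (simp add: divide_right_mono)
      also have "\<dots> \<le> L" using \<delta> by (simp add: L_def field_simps mult_left_le_one_le)
      finally show ?thesis .
    qed
    ultimately show "z x \<in> ?S" by (auto simp: z_def PiE_iff)
  qed
  moreover have "finite ?S"
    by (rule finite_subset[of _ "{..<k} \<rightarrow>\<^sub>E {- int J..int J}"]) (auto intro!: finite_PiE)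
  ultimately have "card N \<le> card ?S" by (rule card_inj_on_le)
  then have "real (card N) \<le> exp (\<delta> * L) * (4 / \<delta>) ^ k"
    using card_lattice_l1_le[OF \<delta>, of k J L] by linarith
  also have "exp (\<delta> * L) = exp 3 ^ k" using \<delta> by (simp add: L_def exp_of_nat2_mult[symmetric] mult.commute)
  finally show ?thesis by (simp add: power_mult_distrib[symmetric] mult.commute)
qed

text \<open>Stacking the scaled copies \<open>(1 + i\<delta>) N\<close> inside the ball of radius 2 gains the factor \<open>\<delta>\<close>
  that turns the exponent \<open>k\<close> of a ball into the exponent \<open>k - 1\<close> of the sphere.\<close>

lemma card_separated_sphere_le:
  assumes N: "finite N" "N \<subseteq> F" "\<And>x. x \<in> N \<Longrightarrow> vn n x = 1"
    "\<And>x y. x \<in> N \<Longrightarrow> y \<in> N \<Longrightarrow> x \<noteq> y \<Longrightarrow> \<delta> \<le> vn n (x - y)"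
    and \<delta>: "0 < \<delta>" "\<delta> \<le> 1" and k: "1 \<le> k"
  shows "real (card N) \<le> (4 * exp 3) ^ k * (1 / \<delta>) ^ (k - 1)"
proof -
  \<comment> \<open>At least 1 / \<delta> shells, while the outermost index M - 1 is still at most 1
    / \<delta>, so that all shells stay in the ball of radius 2.\<close>
  define M where "M = nat \<lceil>1 / \<delta>\<rceil>"
  have M: "1 / \<delta> \<le> real M" unfolding M_def by linarith
  define g where "g = (\<lambda>(x, i). (1 + real i * \<delta>) *\<^sub>R x :: vector)"
  have sep: "\<delta> \<le> vn n (g (x, i) - g (y, j))" if "x \<in> N" "y \<in> N" "(x, i) \<noteq> (y, j)" for x y i j
  proof -
    define r s where "r = 1 + real i * \<delta>" and "s = 1 + real j * \<delta>"
    have rs: "1 \<le> r" "1 \<le> s" using \<delta> by (auto simp: r_def s_def)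
    have one: "ip n x x = 1" "ip n y y = 1" using N that by (auto simp: ip_self)
    have "(vn n (g (x, i) - g (y, j)))\<^sup>2 = ip n (r *\<^sub>R x - s *\<^sub>R y) (r *\<^sub>R x - s *\<^sub>R y)"
      by (simp add: ip_self g_def r_def s_def)
    \<comment> \<open>For unit vectors the squared distance splits into a radial part (r - s)^2 and
      an angular part r s |x - y|^2. Different shells are separated by the first, different points
      of N by the second.\<close>
    also have "\<dots> = (r - s)\<^sup>2 + r * s * (2 - 2 * ip n x y)"
      using one by (simp add: ip_simps ip_commute[of n y x] power2_eq_square algebra_simps)
    also have "2 - 2 * ip n x y = (vn n (x - y))\<^sup>2"
      using one by (simp add: ip_self[symmetric] ip_simps ip_commute[of n y x])
    finally have eq: "(vn n (g (x, i) - g (y, j)))\<^sup>2 = (r - s)\<^sup>2 + r * s * (vn n (x - y))\<^sup>2" .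
    have "\<delta>\<^sup>2 \<le> (vn n (g (x, i) - g (y, j)))\<^sup>2"
    proof (cases "x = y")
      case True
      then have "i \<noteq> j" using that by auto
      then have "1 \<le> \<bar>real i - real j\<bar>" by linarith
      then have "\<delta> \<le> \<bar>real i - real j\<bar> * \<delta>" using \<delta> by simp
      also have "\<dots> = \<bar>r - s\<bar>" using \<delta> by (simp add: r_def s_def abs_mult flip: left_diff_distrib)
      finally have "\<delta>\<^sup>2 \<le> (r - s)\<^sup>2" using \<delta> by (simp add: abs_le_square_iff[symmetric])
      then show ?thesis using True eq by simp
    next
      case False
      have "\<delta>\<^sup>2 \<le> 1 * (vn n (x - y))\<^sup>2" using N(4)[OF that(1,2) False] \<delta> by (simp add: power_mono)
      also have "\<dots> \<le> (r * s) * (vn n (x - y))\<^sup>2"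
        using rs by (intro mult_right_mono) (auto simp: mult_ge1_I)
      finally show ?thesis using eq zero_le_power2[of "r - s"] by linarith
    qed
    then show ?thesis using \<delta> L2_set_nonneg by (simp add: power2_le_iff_abs_le)
  qed
  have inj: "inj_on g (N \<times> {..<M})"
  proof (rule inj_onI, rule ccontr)
    fix a b assume *: "a \<in> N \<times> {..<M}" "b \<in> N \<times> {..<M}" "g a = g b" "a \<noteq> b"
    then show False using sep[of "fst a" "fst b" "snd a" "snd b"] \<delta> by auto
  qed
  have "real (card (g ` (N \<times> {..<M}))) \<le> (4 * exp 3 / \<delta>) ^ k"
  proof (rule card_separated_ball_le)
    show "g ` (N \<times> {..<M}) \<subseteq> F" using N(2) subF by (auto simp: g_def intro: subspace_scale)
    show "vn n x \<le> 2" if "x \<in> g ` (N \<times> {..<M})" for x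
    proof -
      obtain y i where y: "y \<in> N" "i < M" "x = (1 + real i * \<delta>) *\<^sub>R y"
        using \<open>x \<in> _\<close> by (auto simp: g_def)
      have "real i \<le> 1 / \<delta>" using y(2) unfolding M_def by linarith
      then have "real i * \<delta> \<le> 1" using \<delta> by (simp add: field_simps)
      then show ?thesis using N(3)[OF y(1)] \<delta> by (simp add: y(3) vn_scaleR)
    qed
    show "\<delta> \<le> vn n (x - y)" if "x \<in> g ` (N \<times> {..<M})" "y \<in> g ` (N \<times> {..<M})" "x \<noteq> y" for x y
    proof -
      obtain a i b j where "a \<in> N" "x = g (a, i)" "b \<in> N" "y = g (b, j)" using \<open>x \<in> _\<close> \<open>y \<in> _\<close> by auto
      moreover from this have "(a, i) \<noteq> (b, j)" using \<open>x \<noteq> y\<close> by metis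
      ultimately show ?thesis using sep by blast
    qed
  qed (use N \<delta> k in auto)
  then have "real (card N) * real M \<le> (4 * exp 3 / \<delta>) ^ k"
    by (simp add: card_image[OF inj] card_cartesian_product)
  then have "real (card N) * (1 / \<delta>) \<le> (4 * exp 3 / \<delta>) ^ k"
    using mult_left_mono[OF M, of "real (card N)"] by linarith
  also have "\<dots> = ((4 * exp 3) ^ k * (1 / \<delta>) ^ (k - 1)) * (1 / \<delta>)"
    using k by (cases k) (simp_all add: power_divide power_mult_distrib)
  finally show ?thesis using \<delta> by (simp only: mult_le_cancel_right) (simp add: not_less)
qed

text \<open>A \<delta>-separated set of greatest cardinality is a \<delta>-net, since an uncovered
  point could be added. The cardinality bound ensures that a greatest one exists.\<close>

lemma sphere_net:
  assumes \<delta>: "0 < \<delta>" "\<delta> \<le> 1" and k: "1 \<le> k"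
  obtains N where "finite N" "N \<subseteq> {x \<in> F. vn n x = 1}"
    "real (card N) \<le> (4 * exp 3) ^ k * (1 / \<delta>) ^ (k - 1)"
    "\<And>x. x \<in> F \<Longrightarrow> vn n x = 1 \<Longrightarrow> \<exists>y\<in>N. vn n (x - y) \<le> \<delta>"
proof -
  define P where "P N \<longleftrightarrow> finite N \<and> N \<subseteq> {x \<in> F. vn n x = 1} \<and>
    (\<forall>x\<in>N. \<forall>y\<in>N. x \<noteq> y \<longrightarrow> \<delta> \<le> vn n (x - y))" for N
  have card: "real (card N) \<le> (4 * exp 3) ^ k * (1 / \<delta>) ^ (k - 1)" if "P N" for N
    using that by (intro card_separated_sphere_le \<delta> k) (auto simp: P_def)
  have "\<forall>N. P N \<longrightarrow> card N < Suc (nat \<lceil>(4 * exp 3) ^ k * (1 / \<delta>) ^ (k - 1)\<rceil>)"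
  proof (intro allI impI)
    fix N assume "P N"
    from card[OF this] show "card N < Suc (nat \<lceil>(4 * exp 3) ^ k * (1 / \<delta>) ^ (k - 1)\<rceil>)" by linarith
  qed
  moreover have "P {}" by (simp add: P_def)
  ultimately obtain N where N: "P N" "\<And>N'. P N' \<Longrightarrow> card N' \<le> card N"
    using ex_has_greatest_nat[of P "{}" card] by blast
  have "\<exists>y\<in>N. vn n (x - y) \<le> \<delta>" if x: "x \<in> F" "vn n x = 1" for x
  proof (rule ccontr)
    assume far: "\<not> ?thesis"
    have sym: "vn n (y - x) = vn n (x - y)" for y
      using vn_scaleR[where n = n and r = "- 1" and x = "x - y"] by simp
    have "x \<notin> N" using far \<delta> by force
    moreover have "P (insert x N)"
      using N(1) x far unfolding P_def by (auto simp: not_le sym less_imp_le)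
    ultimately show False using N(2)[of "insert x N"] N(1) by (auto simp: P_def)
  qed
  with N(1) card[OF N(1)] show ?thesis by (intro that[of N]) (auto simp: P_def)
qed

end

section \<open>Measurability and reduction to a fixed subspace\<close>

lemma continuous_on_supn:
  assumes "1 \<le> n" "\<And>i. i < n \<Longrightarrow> continuous_on A (\<lambda>x. f x i)"
  shows "continuous_on A (\<lambda>x. supn n (f x))"
  using assms
proof (induction n rule: dec_induct)
  case base
  then show ?case by (auto simp: supn_def lessThan_Suc intro!: continuous_intros)
next
  case (step n)
  have "supn (Suc n) x = max \<bar>x n\<bar> (supn n x)" for x
    using step.hyps unfolding supn_def lessThan_Suc image_insert
    by (subst Max_insert) (auto simp: lessThan_empty_iff)
  then show ?case
    using step by (auto intro!: continuous_intros)
qed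

lemma measurable_coord_borel:
  assumes "f \<in> M \<rightarrow>\<^sub>M (borel :: ('i::countable \<Rightarrow> 'a::second_countable_topology) measure)"
  shows "(\<lambda>x. f x i) \<in> M \<rightarrow>\<^sub>M borel"
proof -
  have "(\<lambda>x :: 'i \<Rightarrow> 'a. x i) \<in> borel \<rightarrow>\<^sub>M borel"
    by (intro borel_measurable_continuous_onI continuous_on_product_coordinates)
  from measurable_compose[OF assms this] show ?thesis .
qed

lemma measurable_supn:
  assumes "1 \<le> n" "\<And>i. i < n \<Longrightarrow> (\<lambda>x. f x i) \<in> borel_measurable M"
  shows "(\<lambda>x. supn n (f x)) \<in> borel_measurable M"
  unfolding supn_def by (rule borel_measurable_Max) (auto intro!: borel_measurable_abs assms(2))

lemma measurable_entry_haar: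
  assumes "haar_orthogonal n \<mu>" shows "(\<lambda>U. U i j) \<in> borel_measurable \<mu>"
proof -
  have "sets \<mu> = sets (restrict_space borel (orthogonal_group n))"
    using assms by (simp add: haar_orthogonal_def)
  from measurable_cong_sets[OF this refl, of borel]
  have eq: "\<mu> \<rightarrow>\<^sub>M (borel :: matrix measure) = restrict_space borel (orthogonal_group n) \<rightarrow>\<^sub>M borel" .
  have "(\<lambda>U. U) \<in> \<mu> \<rightarrow>\<^sub>M borel"
    unfolding eq by (rule measurable_restrict_space1) simp
  then have "(\<lambda>U. U i) \<in> \<mu> \<rightarrow>\<^sub>M borel" by (rule measurable_coord_borel)
  then show ?thesis by (rule measurable_coord_borel)
qed

lemma measurable_proj_matrix_haar:
  assumes "haar_grassmannian n k \<nu>" shows "(\<lambda>F. proj_matrix n F i j) \<in> borel_measurable \<nu>"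
proof -
  have "sets \<nu> = sets (grassmannian_borel n k)"
    using assms by (simp add: haar_grassmannian_def)
  from measurable_cong_sets[OF this refl, of borel]
  have eq: "\<nu> \<rightarrow>\<^sub>M (borel :: matrix measure) = grassmannian_borel n k \<rightarrow>\<^sub>M borel" .
  have "proj_matrix n \<in> \<nu> \<rightarrow>\<^sub>M borel"
    unfolding eq grassmannian_borel_def by (rule measurable_vimage_algebra1) simp
  then have "(\<lambda>F. proj_matrix n F i) \<in> \<nu> \<rightarrow>\<^sub>M borel" by (rule measurable_coord_borel)
  then show ?thesis by (rule measurable_coord_borel)
qed

text \<open>Vectors of F are written as projections of arbitrary vectors, so that the test set D
  does not depend on F. The condition is closed in the pair, hence it extends from a dense set to
  all pairs.\<close>

lemma (in onb) ratio_bound_dense: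
  fixes D :: "(vector \<times> vector) set"
  assumes n: "1 \<le> n"
    and D: "\<And>X. open X \<Longrightarrow> X \<noteq> {} \<Longrightarrow> \<exists>d\<in>D. d \<in> X"
    and P: "P = mat_vec n (proj_matrix n F)"
  shows "(\<forall>x\<in>F. \<forall>y\<in>F. sup_sum n m U x * vn n y \<le> B * (sup_sum n m U y * vn n x)) \<longleftrightarrow>
    (\<forall>d\<in>D. sup_sum n m U (P (fst d)) * vn n (P (snd d))
      \<le> B * (sup_sum n m U (P (snd d)) * vn n (P (fst d))))"
    (is "?L \<longleftrightarrow> ?R")
proof
  have Peq: "P = orth_proj n F" using P mat_vec_proj_matrix by auto
  show "?L \<Longrightarrow> ?R" by (simp add: Peq orth_proj_in)
  assume R: ?R
  let ?C = "{d :: vector \<times> vector. sup_sum n m U (P (fst d)) * vn n (P (snd d))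
      \<le> B * (sup_sum n m U (P (snd d)) * vn n (P (fst d)))}"
  have coord: "continuous_on A (\<lambda>x. mat_vec n M (f x) i)"
    if "continuous_on A f" for A and f :: "vector \<times> vector \<Rightarrow> vector" and M i
    using continuous_on_compose2[OF continuous_on_mat_vec that, of UNIV n M]
    by (rule continuous_on_product_then_coordinatewise) auto
  have cont: "continuous_on UNIV (\<lambda>d. sup_sum n m U (P (f d)))" "continuous_on UNIV (\<lambda>d. vn n (P (f d)))"
    if "continuous_on UNIV f" for f :: "vector \<times> vector \<Rightarrow> vector"
    unfolding sup_sum_def P L2_set_def
    using that n continuous_on_compose2[OF continuous_on_mat_vec that, of UNIV]
    by (auto intro!: continuous_intros continuous_on_supn coord)
  have "closed ?C"
    by (intro closed_Collect_le continuous_intros cont)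
  then have "open (- ?C)" by (simp add: closed_def)
  then have "- ?C = {}" using D R by blast
  then have C: "(x, y) \<in> ?C" for x y by blast
  show ?L
  proof (intro ballI)
    fix x y assume "x \<in> F" "y \<in> F"
    then show "sup_sum n m U x * vn n y \<le> B * (sup_sum n m U y * vn n x)"
      using C[of x y] by (simp add: Peq orth_proj_id)
  qed
qed

lemma space_joint_law:
  assumes "haar_orthogonal n \<mu>" "haar_grassmannian n k \<nu>"
  shows "space (joint_law m \<mu> \<nu>) = ({1..m} \<rightarrow>\<^sub>E orthogonal_group n) \<times> grassmannian n k"
  using assms
  by (simp add: joint_law_def space_pair_measure space_PiM haar_orthogonal_def haar_grassmannian_def)

text \<open>By \<open>geom_dist_le_iff\<close> and \<open>ratio_bound_dense\<close> the event is a
  countable intersection of inequalities between measurable functions of the entries of the U_j and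
  of the projection matrix.\<close>

lemma geom_dist_event_measurable:
  assumes \<mu>: "haar_orthogonal n \<mu>" and \<nu>: "haar_grassmannian n k \<nu>"
    and n: "1 \<le> n" and m: "1 \<le> m" and k: "1 \<le> k"
  shows "{(U, F) \<in> space (joint_law m \<mu> \<nu>).
    geom_dist (orth_proj n F ` avg_body n m U) (unit_ball_in n F) \<le> B} \<in> sets (joint_law m \<mu> \<nu>)"
proof -
  let ?J = "joint_law m \<mu> \<nu>"
  obtain D :: "(vector \<times> vector) set" where D: "countable D"
    "\<And>X. open X \<Longrightarrow> X \<noteq> {} \<Longrightarrow> \<exists>d\<in>D. d \<in> X"
    using countable_dense_exists by blast
  define P where "P F = mat_vec n (proj_matrix n F)" for F
  define Q where "Q d \<omega> \<longleftrightarrow> sup_sum n m (fst \<omega>) (P (snd \<omega>) (fst d)) * vn n (P (snd \<omega>) (snd d))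
      \<le> B * (sup_sum n m (fst \<omega>) (P (snd \<omega>) (snd d)) * vn n (P (snd \<omega>) (fst d)))" for d \<omega>
  have proj: "(\<lambda>\<omega>. proj_matrix n (snd \<omega>) i j) \<in> borel_measurable ?J" for i j
    unfolding joint_law_def
    by (rule measurable_compose[OF measurable_snd measurable_proj_matrix_haar[OF \<nu>]])
  have entry: "(\<lambda>\<omega>. fst \<omega> l i j) \<in> borel_measurable ?J" if "l \<in> {1..m}" for l i j
    unfolding joint_law_def
    by (rule measurable_compose[OF measurable_fst],
        rule measurable_compose[OF measurable_component_singleton[OF that] measurable_entry_haar[OF \<mu>]])
  have Pm: "(\<lambda>\<omega>. P (snd \<omega>) x i) \<in> borel_measurable ?J" for x i
    unfolding P_def mat_vec_def by (intro borel_measurable_sum borel_measurable_times proj) auto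
  have vnm: "(\<lambda>\<omega>. vn n (P (snd \<omega>) x)) \<in> borel_measurable ?J" for x
    unfolding L2_set_def
    by (rule measurable_compose[OF _ borel_measurable_sqrt]) (intro borel_measurable_sum borel_measurable_power Pm)
  have supm: "(\<lambda>\<omega>. sup_sum n m (fst \<omega>) (P (snd \<omega>) x)) \<in> borel_measurable ?J" for x
    unfolding sup_sum_def
    by (intro borel_measurable_sum measurable_supn n)
      (unfold mat_vec_def, intro borel_measurable_sum borel_measurable_times Pm entry)
  have "Measurable.pred ?J (Q d)" for d
    unfolding Q_def pred_def
    by (intro borel_measurable_le borel_measurable_times borel_measurable_const vnm supm)
  then have "Measurable.pred ?J (\<lambda>\<omega>. \<forall>i. Q (from_nat_into D i) \<omega>)"
    by (rule pred_intros_countable(1))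
  moreover have "D \<noteq> {}" using D(2)[of UNIV] by auto
  then have "(\<forall>i. Q (from_nat_into D i) \<omega>) \<longleftrightarrow> (\<forall>d\<in>D. Q d \<omega>)" for \<omega>
    using D(1) by (metis from_nat_into from_nat_into_surj)
  ultimately have "Measurable.pred ?J (\<lambda>\<omega>. \<forall>d\<in>D. Q d \<omega>)" by simp
  then have "{\<omega> \<in> space ?J. \<forall>d\<in>D. Q d \<omega>} \<in> sets ?J" by (simp add: pred_def)
  moreover have "geom_dist (orth_proj n F ` avg_body n m U) (unit_ball_in n F) \<le> B \<longleftrightarrow> (\<forall>d\<in>D. Q d (U, F))"
    if "(U, F) \<in> space ?J" for U F
  proof -
    have UF: "U \<in> {1..m} \<rightarrow>\<^sub>E orthogonal_group n" "F \<in> grassmannian n k"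
      using that by (auto simp: space_joint_law[OF \<mu> \<nu>])
    obtain e where "onb n F k e" using onb_grassmannian[OF UF(2) k] .
    then interpret onb n F k e .
    have "\<And>j. j \<in> {1..m} \<Longrightarrow> U j \<in> orthogonal_group n" using UF(1) by auto
    from geom_dist_le_iff[OF n m k this] show ?thesis
      unfolding Q_def fst_conv snd_conv
      by (subst ratio_bound_dense[OF n D(2), symmetric]) (auto simp: P_def)
  qed
  ultimately show ?thesis by (auto elim!: back_subst[of "\<lambda>A. A \<in> sets ?J"])
qed

text \<open>Fubini with F integrated last: a bound on the bad fibre over F that is uniform in F
  survives the integration. The set A only has to cover the bad fibre.\<close>

lemma joint_law_prob_ge:
  assumes \<mu>: "haar_orthogonal n \<mu>" and \<nu>: "haar_grassmannian n k \<nu>"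
    and E: "E \<in> sets (joint_law m \<mu> \<nu>)"
    and bad: "\<And>F. F \<in> grassmannian n k \<Longrightarrow> \<exists>A\<in>sets (\<Pi>\<^sub>M j\<in>{1..m}. \<mu>).
      emeasure (\<Pi>\<^sub>M j\<in>{1..m}. \<mu>) A \<le> ennreal \<epsilon> \<and>
      (\<forall>U \<in> {1..m} \<rightarrow>\<^sub>E orthogonal_group n. U \<notin> A \<longrightarrow> (U, F) \<in> E)"
    and \<epsilon>: "0 \<le> \<epsilon>"
  shows "1 - \<epsilon> \<le> measure (joint_law m \<mu> \<nu>) E"
proof -
  let ?Q = "\<Pi>\<^sub>M j\<in>{1..m}. \<mu>"
  let ?J = "joint_law m \<mu> \<nu>"
  interpret U: prob_space \<mu> using \<mu> by (simp add: haar_orthogonal_def)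
  interpret Q: prob_space ?Q by (intro prob_space_PiM) (rule U.prob_space_axioms)
  interpret F: prob_space \<nu> using \<nu> by (simp add: haar_grassmannian_def)
  interpret QF: pair_prob_space ?Q \<nu> ..
  have J: "?J = ?Q \<Otimes>\<^sub>M \<nu>" by (simp add: joint_law_def)
  interpret J: prob_space ?J unfolding J by (rule QF.prob_space_axioms)
  have spF: "space \<nu> = grassmannian n k" using \<nu> by (simp add: haar_grassmannian_def)
  have spQ: "space ?Q = {1..m} \<rightarrow>\<^sub>E orthogonal_group n"
    using \<mu> by (simp add: space_PiM haar_orthogonal_def)
  let ?C = "space ?J - E"
  have C: "?C \<in> sets (?Q \<Otimes>\<^sub>M \<nu>)" using E by (auto simp: J)
  have "emeasure ?J ?C = (\<integral>\<^sup>+F. emeasure ?Q ((\<lambda>x. (x, F)) -` ?C) \<partial>\<nu>)"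
    unfolding J by (rule QF.emeasure_pair_measure_alt2) (use C J in auto)
  also have "\<dots> \<le> (\<integral>\<^sup>+F. ennreal \<epsilon> \<partial>\<nu>)"
  proof (rule nn_integral_mono)
    fix F assume "F \<in> space \<nu>"
    then have "F \<in> grassmannian n k" by (simp add: spF)
    from bad[OF this] obtain A where A: "A \<in> sets ?Q" "emeasure ?Q A \<le> ennreal \<epsilon>"
      "\<forall>U \<in> {1..m} \<rightarrow>\<^sub>E orthogonal_group n. U \<notin> A \<longrightarrow> (U, F) \<in> E"
      by (elim bexE conjE)
    have "(\<lambda>x. (x, F)) -` ?C \<subseteq> A"
      unfolding space_joint_law[OF \<mu> \<nu>] using A(3) by blast
    then show "emeasure ?Q ((\<lambda>x. (x, F)) -` ?C) \<le> ennreal \<epsilon>"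
      by (rule order_trans[OF emeasure_mono[OF _ A(1)] A(2)])
  qed
  also have "\<dots> = ennreal \<epsilon>" by (simp add: F.emeasure_space_1)
  finally have "J.prob ?C \<le> \<epsilon>" using \<epsilon> by (simp add: J.emeasure_eq_measure)
  then show ?thesis using J.prob_compl[OF E] by simp
qed

section \<open>Gaussian vectors and Haar measure\<close>

definition gauss :: "real \<Rightarrow> real measure"
  where "gauss s = density lborel (\<lambda>x. ennreal (normal_density 0 s x))"

definition gauss_vec :: "nat \<Rightarrow> real \<Rightarrow> vector measure"
  where "gauss_vec n s = (\<Pi>\<^sub>M i\<in>{..<n}. gauss s)"

lemma prob_space_gauss: "0 < s \<Longrightarrow> prob_space (gauss s)"
  unfolding gauss_def by (rule prob_space_normal_density)

lemma prob_space_gauss_vec: "0 < s \<Longrightarrow> prob_space (gauss_vec n s)"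
  unfolding gauss_vec_def by (intro prob_space_PiM prob_space_gauss)

lemma sets_gauss [measurable_cong]: "sets (gauss s) = sets borel"
  by (simp add: gauss_def)

lemma nn_integral_gauss:
  "f \<in> borel_measurable borel \<Longrightarrow> (\<integral>\<^sup>+x. f x \<partial>gauss s) = (\<integral>\<^sup>+x. ennreal (normal_density 0 s x) * f x \<partial>lborel)"
  unfolding gauss_def by (subst nn_integral_density) auto

lemma nn_integral_normal_density: "0 < s \<Longrightarrow> (\<integral>\<^sup>+x. ennreal (normal_density z s x) \<partial>lborel) = 1"
  using prob_space.emeasure_space_1[OF prob_space_normal_density, of s z]
  by (simp add: emeasure_density)

lemma nn_integral_gauss_vec_prod:
  assumes "0 < s" "\<And>i. i < n \<Longrightarrow> f i \<in> borel_measurable borel"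
  shows "(\<integral>\<^sup>+G. (\<Prod>i<n. f i (G i)) \<partial>gauss_vec n s) = (\<Prod>i<n. \<integral>\<^sup>+x. f i x \<partial>gauss s)"
proof -
  interpret prob_space "gauss s" using assms(1) by (rule prob_space_gauss)
  interpret product_sigma_finite "\<lambda>_ :: nat. gauss s" ..
  show ?thesis
    unfolding gauss_vec_def using assms(2)
    by (intro product_nn_integral_prod) (auto simp: measurable_cong_sets[OF sets_gauss refl])
qed

text \<open>Completing the square: the integrand is c times a normal density of mean b / v and
  variance 1 / v with v = 1 + 2 a.\<close>

lemma nn_integral_gauss_exp:
  assumes "- 1 / 2 < a"
  shows "(\<integral>\<^sup>+x. ennreal (exp (- a * x\<^sup>2 + b * x)) \<partial>gauss 1) =
    ennreal (1 / sqrt (1 + 2 * a) * exp (b\<^sup>2 / (2 * (1 + 2 * a))))"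
proof -
  define v where "v = 1 + 2 * a"
  have v: "0 < v" using assms by (simp add: v_def)
  define c where "c = 1 / sqrt v * exp (b\<^sup>2 / (2 * v))"
  have "c * normal_density (b / v) (1 / sqrt v) x = normal_density 0 1 x * exp (- a * x\<^sup>2 + b * x)" for x
  proof -
    have "b\<^sup>2 / (2 * v) - (x - b / v)\<^sup>2 / (2 * (1 / sqrt v)\<^sup>2) = - x\<^sup>2 / 2 + (- a * x\<^sup>2 + b * x)"
      using v by (simp add: power_divide divide_simps) (simp add: v_def power2_eq_square algebra_simps)
    then have "exp (b\<^sup>2 / (2 * v)) * exp (- (x - b / v)\<^sup>2 / (2 * (1 / sqrt v)\<^sup>2)) =
        exp (- x\<^sup>2 / 2) * exp (- a * x\<^sup>2 + b * x)"
      by (simp only: exp_add[symmetric] minus_divide_left[symmetric] diff_conv_add_uminus)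
    moreover have "1 / sqrt v * (1 / sqrt (2 * pi * (1 / sqrt v)\<^sup>2)) = 1 / sqrt (2 * pi)"
      using v by (simp add: power_divide real_sqrt_divide)
    ultimately show ?thesis
      by (simp add: c_def normal_density_def field_simps)
  qed
  then have "(\<integral>\<^sup>+x. ennreal (exp (- a * x\<^sup>2 + b * x)) \<partial>gauss 1) =
      (\<integral>\<^sup>+x. ennreal c * ennreal (normal_density (b / v) (1 / sqrt v) x) \<partial>lborel)"
    using v by (subst nn_integral_gauss) (simp_all add: ennreal_mult[symmetric] c_def)
  also have "\<dots> = ennreal c"
    using v by (subst nn_integral_cmult) (simp_all add: nn_integral_normal_density)
  finally show ?thesis by (simp add: c_def v_def)
qed

lemma measurable_gauss_vec_coord:
  "i < n \<Longrightarrow> (\<lambda>G. G i) \<in> borel_measurable (gauss_vec n s)"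
proof -
  assume "i < n"
  then have "(\<lambda>G. G i) \<in> gauss_vec n s \<rightarrow>\<^sub>M gauss s"
    unfolding gauss_vec_def by (intro measurable_component_singleton) simp
  then show ?thesis by (simp add: measurable_cong_sets[OF refl sets_gauss])
qed

lemma measurable_vn_gauss_vec [measurable]: "(\<lambda>G. vn n G) \<in> borel_measurable (gauss_vec n s)"
  unfolding L2_set_def
  by (rule measurable_compose[OF _ borel_measurable_sqrt])
    (auto intro!: borel_measurable_sum borel_measurable_power measurable_gauss_vec_coord)

lemma vn_square: "(vn n x)\<^sup>2 = (\<Sum>i<n. (x i)\<^sup>2)"
  by (simp add: L2_set_def sum_nonneg)

lemma nn_integral_gauss_vec_exp:
  assumes "- 1 / 2 < a"
  shows "(\<integral>\<^sup>+G. ennreal (exp (- a * (vn n G)\<^sup>2 + b * ip n x G)) \<partial>gauss_vec n 1) =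
    ennreal ((1 / sqrt (1 + 2 * a)) ^ n * exp (b\<^sup>2 * (vn n x)\<^sup>2 / (2 * (1 + 2 * a))))"
proof -
  have "exp (- a * (vn n G)\<^sup>2 + b * ip n x G) = (\<Prod>i<n. exp (- a * (G i)\<^sup>2 + (b * x i) * G i))" for G
    by (subst exp_sum[symmetric]) (simp_all add: vn_square ip_def sum.distrib sum_distrib_left sum_subtractf sum_negf mult.assoc)
  then have "(\<integral>\<^sup>+G. ennreal (exp (- a * (vn n G)\<^sup>2 + b * ip n x G)) \<partial>gauss_vec n 1) =
      (\<integral>\<^sup>+G. (\<Prod>i<n. ennreal (exp (- a * (G i)\<^sup>2 + (b * x i) * G i))) \<partial>gauss_vec n 1)"
    by (simp add: prod_ennreal)
  also have "\<dots> = (\<Prod>i<n. \<integral>\<^sup>+t. ennreal (exp (- a * t\<^sup>2 + (b * x i) * t)) \<partial>gauss 1)"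
    by (rule nn_integral_gauss_vec_prod) auto
  also have "\<dots> = ennreal (\<Prod>i<n. 1 / sqrt (1 + 2 * a) * exp ((b * x i)\<^sup>2 / (2 * (1 + 2 * a))))"
    using assms by (simp only: nn_integral_gauss_exp) (subst prod_ennreal, auto)
  also have "(\<Prod>i<n. 1 / sqrt (1 + 2 * a) * exp ((b * x i)\<^sup>2 / (2 * (1 + 2 * a)))) =
      (1 / sqrt (1 + 2 * a)) ^ n * exp (\<Sum>i<n. (b * x i)\<^sup>2 / (2 * (1 + 2 * a)))"
    by (simp only: prod.distrib exp_sum finite_lessThan prod_constant card_lessThan)
  also have "(\<Sum>i<n. (b * x i)\<^sup>2 / (2 * (1 + 2 * a))) = b\<^sup>2 * (vn n x)\<^sup>2 / (2 * (1 + 2 * a))"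
    by (simp add: vn_square power_mult_distrib sum_distrib_left flip: sum_divide_distrib)
  finally show ?thesis .
qed

section \<open>The image of a fixed unit vector under a Haar matrix\<close>

lemma mat_mul_in_orthogonal_group:
  assumes "V \<in> orthogonal_group n" "U \<in> orthogonal_group n"
  shows "mat_mul n V U \<in> orthogonal_group n"
proof -
  have "mat_mul n V U i j = 0" if "n \<le> i \<or> n \<le> j" for i j
    using that assms by (auto simp: mat_mul_def orthogonal_group_def)
  moreover have "ip n (mat_vec n (mat_mul n V U) x) (mat_vec n (mat_mul n V U) y) = ip n x y"
    if "x \<in> Rn n" "y \<in> Rn n" for x y
    using assms that mat_vec_in_Rn[OF assms(2)] unfolding mat_vec_mat_mul
    by (simp add: orthogonal_group_def)
  ultimately show ?thesis by (simp add: orthogonal_group_def)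
qed

locale haar_unit_vector =
  fixes n :: nat and \<mu> :: "matrix measure" and \<theta> :: vector
  assumes haar: "haar_orthogonal n \<mu>" and n: "1 \<le> n" and \<theta>: "\<theta> \<in> Rn n" "vn n \<theta> = 1"
begin

sublocale U: prob_space \<mu>
  using haar by (simp add: haar_orthogonal_def)

abbreviation X :: "matrix \<Rightarrow> vector" where "X U \<equiv> mat_vec n U \<theta>"

lemma space_haar: "space \<mu> = orthogonal_group n"
  using haar by (simp add: haar_orthogonal_def)

lemma vn_X: "U \<in> space \<mu> \<Longrightarrow> vn n (X U) = 1"
  using \<theta> by (simp add: space_haar vn_mat_vec)

lemma X_in_Rn: "U \<in> space \<mu> \<Longrightarrow> X U \<in> Rn n"
  by (simp add: space_haar mat_vec_in_Rn)

lemma measurable_X [measurable]: "(\<lambda>U. X U i) \<in> borel_measurable \<mu>"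
  unfolding mat_vec_def
  by (intro borel_measurable_sum borel_measurable_times borel_measurable_const measurable_entry_haar[OF haar])

lemma measurable_ip_X [measurable]: "(\<lambda>U. ip n y (X U)) \<in> borel_measurable \<mu>"
  unfolding ip_def by measurable

lemma measurable_supn_X [measurable]: "(\<lambda>U. supn n (X U)) \<in> borel_measurable \<mu>"
  using n by (intro measurable_supn measurable_X)

lemma measurable_mat_mul:
  assumes V: "V \<in> orthogonal_group n" shows "mat_mul n V \<in> \<mu> \<rightarrow>\<^sub>M \<mu>"
proof -
  have "sets \<mu> = sets (restrict_space borel (orthogonal_group n))"
    using haar by (simp add: haar_orthogonal_def)
  from measurable_cong_sets[OF refl this, of \<mu>]
  have eq: "\<mu> \<rightarrow>\<^sub>M \<mu> = \<mu> \<rightarrow>\<^sub>M restrict_space borel (orthogonal_group n)" .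
  have "(\<lambda>U. mat_mul n V U i j) \<in> borel_measurable \<mu>" for i j
    unfolding mat_mul_def
    by (intro borel_measurable_sum borel_measurable_times borel_measurable_const measurable_entry_haar[OF haar])
  then have "mat_mul n V \<in> borel_measurable \<mu>"
    by (intro measurable_coordinatewise_then_product)
  then show ?thesis
    unfolding eq using mat_mul_in_orthogonal_group[OF V]
    by (intro measurable_restrict_space2) (auto simp: space_haar)
qed

text \<open>The point where invariance of \<mu> enters: a reflection V carries z to y, replacing U
  by V U does not change the integral, and V drops out of the inner product <V z, V X>.\<close>

lemma nn_integral_ip_X_cong:
  assumes f: "f \<in> borel_measurable borel" and y: "y \<in> Rn n" "z \<in> Rn n" "vn n y = vn n z"
  shows "(\<integral>\<^sup>+U. f (ip n y (X U)) \<partial>\<mu>) = (\<integral>\<^sup>+U. f (ip n z (X U)) \<partial>\<mu>)"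
proof -
  obtain V where V: "V \<in> orthogonal_group n" "mat_vec n V z = y"
    using orthogonal_group_transitive[OF y(2,1) y(3)[symmetric]] .
  have "(\<integral>\<^sup>+U. f (ip n y (X U)) \<partial>\<mu>) = (\<integral>\<^sup>+U. f (ip n y (X U)) \<partial>distr \<mu> \<mu> (mat_mul n V))"
    using haar V(1) by (simp add: haar_orthogonal_def)
  also have "\<dots> = (\<integral>\<^sup>+U. f (ip n y (X (mat_mul n V U))) \<partial>\<mu>)"
    by (rule nn_integral_distr[OF measurable_mat_mul[OF V(1)]]) (simp add: measurable_compose[OF measurable_ip_X f])
  also have "\<dots> = (\<integral>\<^sup>+U. f (ip n z (X U)) \<partial>\<mu>)"
  proof (intro nn_integral_cong)
    fix U assume "U \<in> space \<mu>"
    then have "ip n (mat_vec n V z) (mat_vec n V (X U)) = ip n z (X U)"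
      using V(1) y(2) X_in_Rn by (simp add: orthogonal_group_def)
    then show "f (ip n y (X (mat_mul n V U))) = f (ip n z (X U))"
      by (simp add: mat_vec_mat_mul V(2))
  qed
  finally show ?thesis .
qed

abbreviation J :: "(matrix \<times> vector) measure" where "J \<equiv> \<mu> \<Otimes>\<^sub>M gauss_vec n 1"

text \<open>As \<open>|G| \<langle>y, X\<rangle>\<close> and \<open>|y| \<langle>G, X\<rangle>\<close> have the same law, the integral over \<open>X\<close> turns into one over the
  product measure of \<open>G\<close>.\<close>

lemma nn_integral_radial_exp:
  assumes a: "- 1 / 2 < a" and y: "y \<in> Rn n"
  shows "(\<integral>\<^sup>+\<omega>. ennreal (exp (- a * (vn n (snd \<omega>))\<^sup>2 + b * (vn n (snd \<omega>) * ip n y (X (fst \<omega>))))) \<partial>J) =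
    ennreal ((1 / sqrt (1 + 2 * a)) ^ n * exp (b\<^sup>2 * (vn n y)\<^sup>2 / (2 * (1 + 2 * a))))"
proof -
  interpret G: prob_space "gauss_vec n 1" by (rule prob_space_gauss_vec) simp
  interpret UG: pair_prob_space \<mu> "gauss_vec n 1" ..
  define f where "f U G = ennreal (exp (- a * (vn n G)\<^sup>2 + b * (vn n G * ip n y (X U))))" for U G
  define g where "g U G = ennreal (exp (- a * (vn n G)\<^sup>2 + b * (vn n y * ip n G (X U))))" for U G
  have f: "(\<lambda>(U, G). f U G) \<in> borel_measurable J" unfolding f_def by measurable
  have ipm: "(\<lambda>\<omega>. ip n (snd \<omega>) (X (fst \<omega>))) \<in> borel_measurable J"
    unfolding ip_def
    by (intro borel_measurable_sum borel_measurable_times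
        measurable_compose[OF measurable_fst measurable_X]
        measurable_compose[OF measurable_snd measurable_gauss_vec_coord]) auto
  have g: "(\<lambda>(U, G). g U G) \<in> borel_measurable J"
    unfolding g_def split_beta
    by (intro measurable_compose[OF _ measurable_ennreal] measurable_compose[OF _ borel_measurable_exp]
        borel_measurable_add borel_measurable_times borel_measurable_const ipm borel_measurable_power
        measurable_compose[OF measurable_snd measurable_vn_gauss_vec])
  have "(\<integral>\<^sup>+\<omega>. f (fst \<omega>) (snd \<omega>) \<partial>J) = (\<integral>\<^sup>+U. \<integral>\<^sup>+G. f U G \<partial>gauss_vec n 1 \<partial>\<mu>)"
    using G.nn_integral_fst[OF f] by (simp add: case_prod_beta')
  also have "\<dots> = (\<integral>\<^sup>+G. \<integral>\<^sup>+U. f U G \<partial>\<mu> \<partial>gauss_vec n 1)"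
    by (rule UG.Fubini'[OF f, symmetric])
  also have "\<dots> = (\<integral>\<^sup>+G. \<integral>\<^sup>+U. g U G \<partial>\<mu> \<partial>gauss_vec n 1)"
  proof (rule nn_integral_cong)
    fix G :: vector
    define G' where "G' = (\<lambda>i. if i < n then G i else 0)"
    have G': "G' \<in> Rn n" "vn n G' = vn n G" "\<And>z. ip n G' z = ip n G z"
      by (auto simp: G'_def mem_Rn L2_set_def ip_def)
    have "(\<integral>\<^sup>+U. ennreal (exp (- a * (vn n G)\<^sup>2 + b * ip n (vn n G *\<^sub>R y) (X U))) \<partial>\<mu>) =
        (\<integral>\<^sup>+U. ennreal (exp (- a * (vn n G)\<^sup>2 + b * ip n (vn n y *\<^sub>R G') (X U))) \<partial>\<mu>)"
      using y G' by (intro nn_integral_ip_X_cong[where y = "vn n G *\<^sub>R y" and z = "vn n y *\<^sub>R G'"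
            and f = "\<lambda>t. ennreal (exp (- a * (vn n G)\<^sup>2 + b * t))"])
        (simp_all add: vn_scaleR L2_set_nonneg subspace_scale[OF subspace_Rn])
    then show "(\<integral>\<^sup>+U. f U G \<partial>\<mu>) = (\<integral>\<^sup>+U. g U G \<partial>\<mu>)"
      by (simp add: f_def g_def ip_simps G' mult.assoc)
  qed
  also have "\<dots> = (\<integral>\<^sup>+U. \<integral>\<^sup>+G. g U G \<partial>gauss_vec n 1 \<partial>\<mu>)"
    by (rule UG.Fubini'[OF g])
  also have "\<dots> = (\<integral>\<^sup>+U. ennreal ((1 / sqrt (1 + 2 * a)) ^ n * exp (b\<^sup>2 * (vn n y)\<^sup>2 / (2 * (1 + 2 * a)))) \<partial>\<mu>)"
  proof (intro nn_integral_cong)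
    fix U assume "U \<in> space \<mu>"
    then show "(\<integral>\<^sup>+G. g U G \<partial>gauss_vec n 1) =
        ennreal ((1 / sqrt (1 + 2 * a)) ^ n * exp (b\<^sup>2 * (vn n y)\<^sup>2 / (2 * (1 + 2 * a))))"
      using nn_integral_gauss_vec_exp[OF a, of n "b * vn n y" "X U"]
      by (simp add: g_def vn_X mult.assoc ip_commute[of n _ "X U"] power_mult_distrib)
  qed
  also have "\<dots> = ennreal ((1 / sqrt (1 + 2 * a)) ^ n * exp (b\<^sup>2 * (vn n y)\<^sup>2 / (2 * (1 + 2 * a))))"
    by (simp add: U.emeasure_space_1)
  finally show ?thesis by (simp add: f_def)
qed

text \<open>Vectors of the product space are undefined beyond \<open>n\<close>, hence the version without \<open>y \<in> Rn n\<close>.\<close>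

lemma nn_integral_radial_exp':
  assumes a: "- 1 / 2 < a"
  shows "(\<integral>\<^sup>+\<omega>. ennreal (exp (- a * (vn n (snd \<omega>))\<^sup>2 + b * (vn n (snd \<omega>) * ip n y (X (fst \<omega>))))) \<partial>J) =
    ennreal ((1 / sqrt (1 + 2 * a)) ^ n * exp (b\<^sup>2 * (vn n y)\<^sup>2 / (2 * (1 + 2 * a))))"
proof -
  define y' where "y' = (\<lambda>i. if i < n then y i else 0)"
  have "y' \<in> Rn n" "vn n y' = vn n y" "\<And>z. ip n y' z = ip n y z"
    by (auto simp: y'_def mem_Rn L2_set_def ip_def)
  then show ?thesis using nn_integral_radial_exp[OF a, of y' b] by simp
qed

lemma nn_integral_J_prod:
  assumes f [measurable]: "f \<in> borel_measurable \<mu>" and g [measurable]: "g \<in> borel_measurable (gauss_vec n 1)"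
  shows "(\<integral>\<^sup>+\<omega>. f (fst \<omega>) * g (snd \<omega>) \<partial>J) = (\<integral>\<^sup>+U. f U \<partial>\<mu>) * (\<integral>\<^sup>+G. g G \<partial>gauss_vec n 1)"
proof -
  interpret G: prob_space "gauss_vec n 1" by (rule prob_space_gauss_vec) simp
  have "(\<integral>\<^sup>+\<omega>. f (fst \<omega>) * g (snd \<omega>) \<partial>J) = (\<integral>\<^sup>+U. \<integral>\<^sup>+G. f U * g G \<partial>gauss_vec n 1 \<partial>\<mu>)"
    by (subst G.nn_integral_fst[symmetric]) simp_all
  also have "\<dots> = (\<integral>\<^sup>+U. f U * (\<integral>\<^sup>+G. g G \<partial>gauss_vec n 1) \<partial>\<mu>)"
    by (intro nn_integral_cong nn_integral_cmult g)
  also have "\<dots> = (\<integral>\<^sup>+U. f U \<partial>\<mu>) * (\<integral>\<^sup>+G. g G \<partial>gauss_vec n 1)"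
    by (rule nn_integral_multc[OF f])
  finally show ?thesis .
qed

end

section \<open>The norm of a Gaussian vector is of order sqrt n\<close>

lemma emeasure_le_nn_integral:
  assumes "A \<in> sets M" "\<And>x. x \<in> A \<Longrightarrow> 1 \<le> f x"
  shows "emeasure M A \<le> (\<integral>\<^sup>+x. f x \<partial>M)"
  unfolding nn_integral_indicator[OF assms(1), symmetric]
  by (intro nn_integral_mono) (auto simp: indicator_def assms(2))

lemma nn_integral_gauss_vec_square_exp:
  "- 1 / 2 < a \<Longrightarrow> (\<integral>\<^sup>+G. ennreal (exp (- a * (vn n G)\<^sup>2)) \<partial>gauss_vec n 1) = ennreal ((1 / sqrt (1 + 2 * a)) ^ n)"
  using nn_integral_gauss_vec_exp[of a n 0 0] by simp

text \<open>Markov's inequality for exp (t n - a |G|^2). The bound is an n-th power of a number at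
  most 3 / 4, so its value at n = 1 serves every n.\<close>

lemma measure_gauss_vec_exp_le:
  assumes a: "- 1 / 2 < a"
    and le: "\<And>G. G \<in> A \<Longrightarrow> a * (vn n G)\<^sup>2 \<le> t * real n" and A: "A \<in> sets (gauss_vec n 1)"
    and q: "exp t / sqrt (1 + 2 * a) \<le> 3 / 4" and n: "1 \<le> n"
  shows "measure (gauss_vec n 1) A \<le> 3 / 4"
proof -
  interpret G: prob_space "gauss_vec n 1" by (rule prob_space_gauss_vec) simp
  have "emeasure (gauss_vec n 1) A \<le> (\<integral>\<^sup>+G. ennreal (exp (t * n)) * ennreal (exp (- a * (vn n G)\<^sup>2)) \<partial>gauss_vec n 1)"
  proof (rule emeasure_le_nn_integral[OF A])
    fix G assume "G \<in> A"
    then show "1 \<le> ennreal (exp (t * n)) * ennreal (exp (- a * (vn n G)\<^sup>2))"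
      using le[of G] by (simp add: ennreal_mult[symmetric] exp_add[symmetric])
  qed
  also have "\<dots> = ennreal (exp (t * n)) * ennreal ((1 / sqrt (1 + 2 * a)) ^ n)"
    by (subst nn_integral_cmult, measurable) (simp only: nn_integral_gauss_vec_square_exp[OF a])
  also have "\<dots> = ennreal ((exp t / sqrt (1 + 2 * a)) ^ n)"
    using a by (simp add: ennreal_mult[symmetric] power_divide exp_of_nat2_mult)
  also have "\<dots> \<le> ennreal (3 / 4)"
  proof (intro ennreal_leI)
    have "(exp t / sqrt (1 + 2 * a)) ^ n \<le> (exp t / sqrt (1 + 2 * a)) ^ 1"
    proof (rule power_decreasing)
      show "exp t / sqrt (1 + 2 * a) \<le> 1" using q by linarith
    qed (use n a in auto)
    then show "(exp t / sqrt (1 + 2 * a)) ^ n \<le> 3 / 4" using q unfolding power_one_right by linarith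
  qed
  finally show ?thesis by (simp add: G.emeasure_eq_measure)
qed

lemma gauss_vec_norm_ge:
  assumes n: "1 \<le> n"
  shows "1 / 4 \<le> measure (gauss_vec n 1) {G \<in> space (gauss_vec n 1). sqrt n / 2 \<le> vn n G}"
proof -
  interpret G: prob_space "gauss_vec n 1" by (rule prob_space_gauss_vec) simp
  let ?A = "{G \<in> space (gauss_vec n 1). sqrt n / 2 \<le> vn n G}"
  have A: "?A \<in> sets (gauss_vec n 1)" by measurable
  have "G.prob (space (gauss_vec n 1) - ?A) \<le> 3 / 4"
  \<comment> \<open>These values give exp (1 / 4) / sqrt 3, and 1.29 / 1.72 is exactly 3 /
    4.\<close>
  proof (rule measure_gauss_vec_exp_le[where a = 1 and t = "1 / 4", OF _ _ _ _ n])
    fix G assume "G \<in> space (gauss_vec n 1) - ?A"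
    then have "(vn n G)\<^sup>2 \<le> (sqrt n / 2)\<^sup>2" by (intro power_mono) (auto simp: L2_set_nonneg)
    then show "1 * (vn n G)\<^sup>2 \<le> 1 / 4 * real n" by (simp add: power_divide)
  next
    have "(exp (1 / 4 :: real)) ^ 4 = exp 1" by (simp flip: exp_of_nat_mult)
    also have "\<dots> \<le> 272 / 100" using e_less_272 by simp
    also have "\<dots> \<le> (129 / 100) ^ 4" by (simp add: power_divide)
    finally have "exp (1 / 4 :: real) \<le> 129 / 100" by (subst (asm) power_mono_iff) auto
    moreover have "172 / 100 \<le> sqrt 3" by (rule real_le_rsqrt) (simp add: power2_eq_square)
    ultimately have "exp (1 / 4) / sqrt 3 \<le> (129 / 100) / (172 / 100)"
      by (intro frac_le) auto
    then show "exp (1 / 4) / sqrt (1 + 2 * 1) \<le> 3 / 4" by simp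
  qed (use A in auto)
  then show ?thesis using G.prob_compl[OF A] by simp
qed

lemma gauss_vec_norm_le:
  assumes n: "1 \<le> n"
  shows "1 / 4 \<le> measure (gauss_vec n 1) {G \<in> space (gauss_vec n 1). vn n G \<le> 2 * sqrt n}"
proof -
  interpret G: prob_space "gauss_vec n 1" by (rule prob_space_gauss_vec) simp
  let ?A = "{G \<in> space (gauss_vec n 1). vn n G \<le> 2 * sqrt n}"
  have A: "?A \<in> sets (gauss_vec n 1)" by measurable
  have "G.prob (space (gauss_vec n 1) - ?A) \<le> 3 / 4"
  \<comment> \<open>A negative a penalises large norms: |G|^2 \<ge> 4 n gives t = - 1, and exp (- 1)
    * sqrt 2 is below 3 / 4.\<close>
  proof (rule measure_gauss_vec_exp_le[where a = "- 1 / 4" and t = "- 1", OF _ _ _ _ n])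
    fix G assume "G \<in> space (gauss_vec n 1) - ?A"
    then have "(2 * sqrt n)\<^sup>2 \<le> (vn n G)\<^sup>2" by (intro power_mono) auto
    then show "- 1 / 4 * (vn n G)\<^sup>2 \<le> - 1 * real n" by (simp add: power_mult_distrib)
  next
    have "2 \<le> exp (1 :: real)" using exp_ge_add_one_self[of "1 :: real"] by simp
    moreover have "2 / 3 \<le> sqrt (1 / 2)" by (rule real_le_rsqrt) (simp add: power2_eq_square)
    ultimately have "4 / 3 \<le> exp 1 * sqrt (1 / 2)"
      using mult_mono[of 2 "exp 1" "2 / 3" "sqrt (1 / 2)"] by simp
    then have "3 / 4 * (4 / 3) \<le> 3 / 4 * (exp 1 * sqrt (1 / 2))" by (intro mult_left_mono) auto
    then have "1 / (exp 1 * sqrt (1 / 2)) \<le> 3 / 4" by (subst pos_divide_le_eq) auto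
    then show "exp (- 1) / sqrt (1 + 2 * (- 1 / 4)) \<le> 3 / 4" by (simp add: exp_minus divide_simps)
  qed (use A in auto)
  then show ?thesis using G.prob_compl[OF A] by simp
qed

section \<open>Exponential moments of the sup norm\<close>

context haar_unit_vector
begin

text \<open>Transfer to the Gaussian scale: X and G are independent under \<open>J\<close>, and |G|
  \<ge> sqrt n / 2 has probability at least 1 / 4, whence the factor 4. On the half space s X_i
  \<ge> 0 this lower bound on |G| may be inserted into the exponent, which explains the
  indicator.\<close>

lemma nn_integral_exp_coord_le:
  assumes i: "i < n" and s: "\<bar>s\<bar> = 1" and l: "0 \<le> l"
  shows "(\<integral>\<^sup>+U. ennreal (exp (l * (s * X U i))) * indicator {U. 0 \<le> s * X U i} U \<partial>\<mu>)
    \<le> ennreal (4 * exp (2 * l\<^sup>2 / n))"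
    (is "?I \<le> _")
proof -
  interpret G: prob_space "gauss_vec n 1" by (rule prob_space_gauss_vec) simp
  define y :: vector where "y = (\<lambda>j. if j = i then s else 0)"
  have vy: "(vn n y)\<^sup>2 = 1"
  proof -
    have "(vn n y)\<^sup>2 = (\<Sum>j<n. if j = i then s\<^sup>2 else 0)"
      unfolding vn_square by (rule sum.cong) (auto simp: y_def)
    also have "\<dots> = 1" using i s by (simp add: abs_square_eq_1[symmetric] power2_eq_1_iff abs_eq_iff')
    finally show ?thesis .
  qed
  have ipy: "ip n y z = s * z i" for z
  proof -
    have "ip n y z = (\<Sum>j<n. if j = i then s * z j else 0)"
      unfolding ip_def by (rule sum.cong) (auto simp: y_def)
    then show ?thesis using i by simp
  qed
  \<comment> \<open>Chosen so that b |G| \<ge> l as soon as |G| \<ge> sqrt n / 2; then b^2 / 2 = 2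
    l^2 / n.\<close>
  define b where "b = 2 * l / sqrt n"
  let ?A = "{G \<in> space (gauss_vec n 1). sqrt n / 2 \<le> vn n G}"
  have A: "?A \<in> sets (gauss_vec n 1)" by measurable
  define f :: "matrix \<Rightarrow> ennreal" where "f U = ennreal (exp (l * (s * X U i))) * indicator {U. 0 \<le> s * X U i} U" for U
  have f: "f \<in> borel_measurable \<mu>"
  proof -
    have "f = (\<lambda>U. if 0 \<le> s * X U i then ennreal (exp (l * (s * X U i))) else 0)"
      by (auto simp: f_def)
    then show ?thesis by simp
  qed
  have "(\<integral>\<^sup>+\<omega>. f (fst \<omega>) * indicator ?A (snd \<omega>) \<partial>J) \<le>
      (\<integral>\<^sup>+\<omega>. ennreal (exp (- 0 * (vn n (snd \<omega>))\<^sup>2 + b * (vn n (snd \<omega>) * ip n y (X (fst \<omega>))))) \<partial>J)"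
  proof (rule nn_integral_mono)
    fix \<omega> assume "\<omega> \<in> space J"
    obtain U G where \<omega>: "\<omega> = (U, G)" by (cases \<omega>)
    show "f (fst \<omega>) * indicator ?A (snd \<omega>) \<le>
      ennreal (exp (- 0 * (vn n (snd \<omega>))\<^sup>2 + b * (vn n (snd \<omega>) * ip n y (X (fst \<omega>)))))"
    proof (cases "0 \<le> s * X U i \<and> G \<in> ?A")
      case True
      have "l = b * (sqrt n / 2)" using n by (simp add: b_def)
      also have "\<dots> \<le> b * vn n G" using True l by (intro mult_left_mono) (auto simp: b_def)
      finally have "l * (s * X U i) \<le> b * vn n G * (s * X U i)"
        using True by (intro mult_right_mono) auto
      then show ?thesis using True by (simp add: \<omega> f_def ipy mult.assoc)
    next
      case False
      then show ?thesis by (auto simp: \<omega> f_def)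
    qed
  qed
  also have "\<dots> = ennreal (exp (2 * l\<^sup>2 / n))"
    by (subst nn_integral_radial_exp') (auto simp: vy b_def power_mult_distrib power_divide)
  finally have "?I * emeasure (gauss_vec n 1) ?A \<le> ennreal (exp (2 * l\<^sup>2 / n))"
    using A by (subst (asm) nn_integral_J_prod[OF f]) (auto simp: f_def[abs_def])
  moreover have "ennreal (1 / 4) \<le> emeasure (gauss_vec n 1) ?A"
    unfolding G.emeasure_eq_measure by (intro ennreal_leI gauss_vec_norm_ge n)
  ultimately have "?I * ennreal (1 / 4) \<le> ennreal (exp (2 * l\<^sup>2 / n))"
    by (meson mult_left_mono order_trans zero_le)
  then have "?I * ennreal (1 / 4) * ennreal 4 \<le> ennreal (exp (2 * l\<^sup>2 / n)) * ennreal 4"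
    by (rule mult_right_mono) simp
  moreover have "ennreal (1 / 4) * ennreal 4 = 1"
    by (subst ennreal_mult[symmetric]) auto
  then have "?I * ennreal (1 / 4) * ennreal 4 = ?I"
    by (simp only: mult.assoc mult_1_right)
  ultimately have "?I \<le> ennreal (exp (2 * l\<^sup>2 / n)) * ennreal 4" by (simp only:)
  also have "\<dots> = ennreal (4 * exp (2 * l\<^sup>2 / n))"
    by (subst ennreal_mult[symmetric]) (simp_all add: mult.commute)
  finally show ?thesis .
qed

text \<open>The sup norm is one of the 2 n signed coordinates, so the exponential is at most the sum
  of their contributions.\<close>

lemma nn_integral_exp_supn_le:
  assumes l: "0 \<le> l"
  shows "(\<integral>\<^sup>+U. ennreal (exp (l * supn n (X U))) \<partial>\<mu>) \<le> ennreal (8 * real n * exp (2 * l\<^sup>2 / n))"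
proof -
  define f :: "nat \<Rightarrow> real \<Rightarrow> matrix \<Rightarrow> ennreal"
    where "f i s U = ennreal (exp (l * (s * X U i))) * indicator {U. 0 \<le> s * X U i} U" for i s U
  have f: "f i s \<in> borel_measurable \<mu>" for i s
  proof -
    have "f i s = (\<lambda>U. if 0 \<le> s * X U i then ennreal (exp (l * (s * X U i))) else 0)"
      by (auto simp: f_def)
    then show ?thesis by simp
  qed
  have "(\<integral>\<^sup>+U. ennreal (exp (l * supn n (X U))) \<partial>\<mu>) \<le> (\<integral>\<^sup>+U. (\<Sum>i<n. f i 1 U + f i (-1) U) \<partial>\<mu>)"
  proof (rule nn_integral_mono)
    fix U
    obtain i where i: "i < n" "supn n (X U) = \<bar>X U i\<bar>" using n by (rule supn_attained)
    have "ennreal (exp (l * supn n (X U))) \<le> f i 1 U + f i (-1) U"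
      by (cases "0 \<le> X U i") (auto simp: f_def i)
    also have "\<dots> \<le> (\<Sum>i<n. f i 1 U + f i (-1) U)"
      by (rule member_le_sum) (use i in auto)
    finally show "ennreal (exp (l * supn n (X U))) \<le> (\<Sum>i<n. f i 1 U + f i (-1) U)" .
  qed
  also have "\<dots> = (\<Sum>i<n. (\<integral>\<^sup>+U. f i 1 U \<partial>\<mu>) + (\<integral>\<^sup>+U. f i (-1) U \<partial>\<mu>))"
    using f by (subst nn_integral_sum) (auto simp: nn_integral_add)
  also have "\<dots> \<le> (\<Sum>i<n. ennreal (4 * exp (2 * l\<^sup>2 / n)) + ennreal (4 * exp (2 * l\<^sup>2 / n)))"
    unfolding f_def by (intro sum_mono add_mono nn_integral_exp_coord_le l) auto
  also have "\<dots> = ennreal (8 * real n * exp (2 * l\<^sup>2 / n))"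
    by (simp add: ennreal_plus[symmetric] ennreal_of_nat_eq_real_of_nat ennreal_mult[symmetric] del: ennreal_plus)
  finally show ?thesis .
qed

end

section \<open>The small ball estimate for the sup norm\<close>

context haar_unit_vector
begin

text \<open>Chebyshev: leaving the interval means a deviation of at least T from the mean z. The
  loss 1 / (2 n) is what a product over n coordinates can afford.\<close>

lemma normal_density_interval_ge:
  fixes T s z :: real
  assumes T: "0 < T" and s: "0 < s" "s\<^sup>2 \<le> T\<^sup>2 / (2 * real n)" and z: "\<bar>z\<bar> \<le> T"
  shows "ennreal (1 - 1 / (2 * real n)) \<le> (\<integral>\<^sup>+t. ennreal (normal_density z s t) * indicator {-2*T..2*T} t \<partial>lborel)"
    (is "_ \<le> ?h")
proof -
  have var: "(\<integral>\<^sup>+t. ennreal (normal_density z s t * (t - z)\<^sup>2) \<partial>lborel) = ennreal (s\<^sup>2)"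
  proof -
    have "has_bochner_integral lborel (\<lambda>t. normal_density z s t * (t - z)\<^sup>2) (s\<^sup>2)"
      using normal_moment_even[OF s(1), of z 1] by (simp add: fact_numeral numeral_2_eq_2[symmetric])
    then show ?thesis
      by (intro nn_integral_eq_integral[THEN trans] arg_cong[of _ _ ennreal])
        (auto simp: has_bochner_integral_iff)
  qed
  have "1 = (\<integral>\<^sup>+t. ennreal (normal_density z s t) \<partial>lborel)"
    using s(1) by (simp add: nn_integral_normal_density)
  also have "\<dots> \<le> (\<integral>\<^sup>+t. ennreal (normal_density z s t) * indicator {-2*T..2*T} t
      + ennreal (1 / T\<^sup>2) * ennreal (normal_density z s t * (t - z)\<^sup>2) \<partial>lborel)"
  proof (rule nn_integral_mono)
    fix t :: real
    show "ennreal (normal_density z s t) \<le> ennreal (normal_density z s t) * indicator {-2*T..2*T} t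
      + ennreal (1 / T\<^sup>2) * ennreal (normal_density z s t * (t - z)\<^sup>2)"
    proof (cases "t \<in> {-2*T..2*T}")
      case False
      then have "T \<le> \<bar>t - z\<bar>" using z by auto
      then have "T\<^sup>2 \<le> (t - z)\<^sup>2" using T by (simp add: abs_le_square_iff[symmetric])
      then have "1 \<le> 1 / T\<^sup>2 * (t - z)\<^sup>2" using T by simp
      then have "normal_density z s t * 1 \<le> normal_density z s t * (1 / T\<^sup>2 * (t - z)\<^sup>2)"
        by (intro mult_left_mono) auto
      then show ?thesis using False by (simp add: ennreal_mult[symmetric] mult_ac)
    qed simp
  qed
  also have "\<dots> = ?h + ennreal (1 / T\<^sup>2) * ennreal (s\<^sup>2)"
    by (subst nn_integral_add) (auto simp: nn_integral_cmult var)
  also have "ennreal (1 / T\<^sup>2) * ennreal (s\<^sup>2) \<le> ennreal (1 / (2 * real n))"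
    using s(2) T n by (simp add: ennreal_mult[symmetric] field_simps)
  finally have le: "1 \<le> ?h + ennreal (1 / (2 * real n))" by (simp add: add_left_mono)
  show ?thesis
  proof (cases ?h)
    case (real r)
    then have "ennreal 1 \<le> ennreal (r + 1 / (2 * real n))" using le by simp
    then have "1 \<le> r + 1 / (2 * real n)" using real by (subst (asm) ennreal_le_iff) auto
    then show ?thesis unfolding real(2) by (intro ennreal_leI) simp
  qed simp
qed

text \<open>The interval just to the right of the box carries mass at least c, and 1 - c \<le> exp
  (- c). There the density is at least 1 / 4 * exp (- 1) * exp (- 4 T^2) because the variance lies
  between 1 and 2; this is the origin of 1 / 12.\<close>

lemma normal_density_interval_le:
  fixes T s :: real
  assumes T: "0 < T" and s: "0 < s" "s \<le> 1"
  shows "(\<integral>\<^sup>+t. ennreal (normal_density 0 (sqrt (1 + s\<^sup>2)) t) * indicator {-2*T..2*T} t \<partial>lborel)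
    \<le> ennreal (exp (- (1 / 12) * exp (- 4 * T\<^sup>2)))" (is "?h \<le> _")
proof -
  define r where "r = sqrt (1 + s\<^sup>2)"
  have r: "0 < r" "1 \<le> r\<^sup>2" "r\<^sup>2 \<le> 2" using s by (auto simp: r_def add_pos_nonneg power_le_one)
  define c where "c = (1 / 12) * exp (- 4 * T\<^sup>2)"
  have dens: "c \<le> normal_density 0 r t" if t: "t \<in> {2*T<..2*T+1}" for t
  proof -
    have "t\<^sup>2 \<le> (2*T+1)\<^sup>2" using t T by (intro power_mono) auto
    also have "\<dots> \<le> 8 * T\<^sup>2 + 2" using zero_le_power2[of "2*T-1"] by (simp add: power2_eq_square algebra_simps)
    finally have "t\<^sup>2 / (2 * r\<^sup>2) \<le> (8 * T\<^sup>2 + 2) / 2" by (rule frac_le[rotated]) (use r in auto)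
    then have "- 4 * T\<^sup>2 - 1 \<le> - t\<^sup>2 / (2 * r\<^sup>2)" by simp
    then have e: "exp (- 4 * T\<^sup>2 - 1) \<le> exp (- t\<^sup>2 / (2 * r\<^sup>2))" by simp
    have "2 * pi * r\<^sup>2 \<le> 2 * 4 * 2"
      by (rule mult_mono) (use r pi_less_4 in simp_all)
    then have "sqrt (2 * pi * r\<^sup>2) \<le> sqrt (4\<^sup>2)" by (intro real_sqrt_le_mono) simp
    then have "sqrt (2 * pi * r\<^sup>2) \<le> 4" by simp
    moreover have "0 < sqrt (2 * pi * r\<^sup>2)" using r by simp
    ultimately have q: "1 / 4 \<le> 1 / sqrt (2 * pi * r\<^sup>2)" by (intro divide_left_mono) auto
    have "(1::real) / 3 \<le> exp (- 1)" using exp_le by (simp add: exp_minus field_simps)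
    then have "1 / 3 * exp (- 4 * T\<^sup>2) \<le> exp (- 1) * exp (- 4 * T\<^sup>2)" by (rule mult_right_mono) simp
    then have "c \<le> 1 / 4 * (exp (- 1) * exp (- 4 * T\<^sup>2))" unfolding c_def by linarith
    also have "\<dots> = 1 / 4 * exp (- 4 * T\<^sup>2 - 1)" by (simp add: exp_add[symmetric])
    also have "\<dots> \<le> 1 / sqrt (2 * pi * r\<^sup>2) * exp (- t\<^sup>2 / (2 * r\<^sup>2))"
      using q e by (intro mult_mono) auto
    finally show ?thesis by (simp add: normal_density_def)
  qed
  have "?h + ennreal c = (\<integral>\<^sup>+t. ennreal (normal_density 0 r t) * indicator {-2*T..2*T} t
      + ennreal c * indicator {2*T<..2*T+1} t \<partial>lborel)"
    by (subst nn_integral_add) (auto simp: r_def nn_integral_cmult_indicator)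
  also have "\<dots> \<le> (\<integral>\<^sup>+t. ennreal (normal_density 0 r t) \<partial>lborel)"
    using dens by (intro nn_integral_mono) (auto simp: indicator_def intro!: ennreal_leI)
  also have "\<dots> = 1" using r by (simp add: nn_integral_normal_density)
  finally have le: "?h + ennreal c \<le> 1" .
  show ?thesis
  proof (cases ?h)
    case (real x)
    have "ennreal (x + c) \<le> ennreal 1" using le real by (simp add: c_def)
    then have "x + c \<le> 1" by (subst (asm) ennreal_le_iff) auto
    then have "x \<le> exp (- c)" using exp_ge_add_one_self[of "- c"] by linarith
    then show ?thesis unfolding real(2) c_def by (intro ennreal_leI) simp
  next
    case top
    with le show ?thesis by (simp add: top_unique)
  qed
qed

text \<open>Fubini for the integral of the density of \<open>|G| X + s G'\<close> over a box, with \<open>G, G'\<close> independent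
  standard Gaussian vectors. The smoothing \<open>s G'\<close> makes the integrand an exponential, so that
  \<open>nn_integral_radial_exp'\<close> applies, and the law of \<open>|G| X + s G'\<close> is seen to be that of
  \<open>sqrt (1 + s\<^sup>2) G\<close> without any uniqueness theorem for Haar measure.\<close>

lemma box_probability:
  fixes s T :: real
  assumes s: "0 < s" and T: "0 < T"
  defines "h \<equiv> \<lambda>z. \<integral>\<^sup>+t. ennreal (normal_density z s t) * indicator {-2*T..2*T} t \<partial>lborel"
  shows "(\<integral>\<^sup>+\<omega>. (\<Prod>i<n. h (vn n (snd \<omega>) * X (fst \<omega>) i)) \<partial>J) =
    (\<integral>\<^sup>+t. ennreal (normal_density 0 (sqrt (1 + s\<^sup>2)) t) * indicator {-2*T..2*T} t \<partial>lborel) ^ n"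
proof -
  interpret G: prob_space "gauss_vec n 1" by (rule prob_space_gauss_vec) simp
  interpret S: prob_space "gauss_vec n s" by (rule prob_space_gauss_vec[OF s])
  interpret JJ: pair_prob_space \<mu> "gauss_vec n 1" ..
  interpret JS: pair_prob_space J "gauss_vec n s" ..
  \<comment> \<open>Coefficients of the expanded square (u_i - |G| X_i)^2 / (2 s^2): b from the
    mixed terms, a from the squared means, which sum to |G|^2 because X is a unit vector.\<close>
  define a b where "a = 1 / (2 * s\<^sup>2)" and "b = 1 / s\<^sup>2"
  have a: "- 1 / 2 < a" and b: "0 < b" using s by (auto simp: a_def b_def less_le_trans[of _ 0])
  define ind :: "real \<Rightarrow> ennreal" where "ind = indicator {-2*T..2*T}"
  have ind [measurable]: "ind \<in> borel_measurable borel" by (simp add: ind_def)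
  \<comment> \<open>Indicator of the box times the density at u of |G| X + s G', with |G| X fixed,
    relative to the law of s G'.\<close>
  define f where "f \<omega> u = (\<Prod>i<n. ind (u i)) *
    ennreal (exp (- a * (vn n (snd \<omega>))\<^sup>2 + b * (vn n (snd \<omega>) * ip n u (X (fst \<omega>)))))"
    for \<omega> :: "matrix \<times> vector" and u
  have coordS: "(\<lambda>u. u i) \<in> borel_measurable (gauss_vec n s)" if "i < n" for i
    using that by (rule measurable_gauss_vec_coord)
  have X: "(\<lambda>\<omega>. X (fst \<omega>) i) \<in> borel_measurable J" for i
    by (rule measurable_compose[OF measurable_fst measurable_X])
  have f: "(\<lambda>(\<omega>, u). f \<omega> u) \<in> borel_measurable (J \<Otimes>\<^sub>M gauss_vec n s)"
    unfolding f_def split_beta ip_def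
    by (intro borel_measurable_times_ennreal borel_measurable_prod_ennreal
        measurable_compose[OF _ measurable_ennreal] measurable_compose[OF _ borel_measurable_exp]
        borel_measurable_add borel_measurable_times borel_measurable_const borel_measurable_power borel_measurable_sum
        measurable_compose[OF measurable_snd measurable_compose[OF coordS ind]]
        measurable_compose[OF measurable_snd coordS]
        measurable_compose[OF measurable_fst X]
        measurable_compose[OF measurable_fst measurable_compose[OF measurable_snd measurable_vn_gauss_vec]])
      auto
  have "(\<integral>\<^sup>+\<omega>. (\<Prod>i<n. h (vn n (snd \<omega>) * X (fst \<omega>) i)) \<partial>J) = (\<integral>\<^sup>+\<omega>. \<integral>\<^sup>+u. f \<omega> u \<partial>gauss_vec n s \<partial>J)"
  proof (rule nn_integral_cong)
    fix \<omega> assume "\<omega> \<in> space J"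
    then obtain U G where \<omega>: "\<omega> = (U, G)" and U: "U \<in> space \<mu>" by (auto simp: space_pair_measure)
    define R where "R = vn n G"
    define x where "x = X U"
    have x1: "(\<Sum>i<n. (x i)\<^sup>2) = 1" using vn_X[OF U] vn_square[where n = n and x = "X U"] by (simp add: x_def)
    have "f \<omega> u = ennreal (exp (- a * R\<^sup>2)) * (\<Prod>i<n. ind (u i) * ennreal (exp (b * R * x i * u i)))" for u
    proof -
      have "exp (- a * R\<^sup>2 + b * (R * ip n u x)) = exp (- a * R\<^sup>2) * (\<Prod>i<n. exp (b * R * x i * u i))"
      proof -
        have "b * (R * ip n u x) = (\<Sum>i<n. b * R * x i * u i)"
          by (simp add: ip_def sum_distrib_left mult_ac)
        then show ?thesis by (simp only: exp_add exp_sum finite_lessThan)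
      qed
      then show ?thesis
        by (simp add: f_def \<omega> R_def x_def prod.distrib ennreal_mult[symmetric] prod_ennreal prod_nonneg mult_ac)
    qed
    then have "(\<integral>\<^sup>+u. f \<omega> u \<partial>gauss_vec n s) =
        ennreal (exp (- a * R\<^sup>2)) * (\<integral>\<^sup>+u. (\<Prod>i<n. ind (u i) * ennreal (exp (b * R * x i * u i))) \<partial>gauss_vec n s)"
      using coordS by (simp add: nn_integral_cmult)
    also have "(\<integral>\<^sup>+u. (\<Prod>i<n. ind (u i) * ennreal (exp (b * R * x i * u i))) \<partial>gauss_vec n s) =
        (\<Prod>i<n. \<integral>\<^sup>+t. ind t * ennreal (exp (b * R * x i * t)) \<partial>gauss s)"
      by (rule nn_integral_gauss_vec_prod[OF s]) measurable
    also have "\<dots> = (\<Prod>i<n. ennreal (exp (a * R\<^sup>2 * (x i)\<^sup>2)) * h (R * x i))"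
    proof (rule prod.cong[OF refl])
      fix i
      have dens: "normal_density 0 s t * exp (b * R * x i * t) = exp (a * R\<^sup>2 * (x i)\<^sup>2) * normal_density (R * x i) s t" for t
      proof -
        have "- t\<^sup>2 / (2 * s\<^sup>2) + b * R * x i * t = a * R\<^sup>2 * (x i)\<^sup>2 + - (t - R * x i)\<^sup>2 / (2 * s\<^sup>2)"
          using s by (simp add: a_def b_def field_simps power2_eq_square)
        then have "exp (- t\<^sup>2 / (2 * s\<^sup>2)) * exp (b * R * x i * t) =
            exp (a * R\<^sup>2 * (x i)\<^sup>2) * exp (- (t - R * x i)\<^sup>2 / (2 * s\<^sup>2))"
          by (simp only: exp_add[symmetric])
        then show ?thesis by (simp add: normal_density_def)
      qed
      have "ennreal (normal_density 0 s t) * (ind t * ennreal (exp (b * R * x i * t))) =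
          ennreal (exp (a * R\<^sup>2 * (x i)\<^sup>2)) * (ennreal (normal_density (R * x i) s t) * ind t)" for t
      proof -
        have "ennreal (normal_density 0 s t) * (ind t * ennreal (exp (b * R * x i * t))) =
            ind t * ennreal (normal_density 0 s t * exp (b * R * x i * t))"
          by (simp add: ennreal_mult mult.left_commute)
        also have "\<dots> = ind t * ennreal (exp (a * R\<^sup>2 * (x i)\<^sup>2) * normal_density (R * x i) s t)"
          by (simp only: dens)
        finally show ?thesis by (simp add: ennreal_mult mult_ac)
      qed
      then show "(\<integral>\<^sup>+t. ind t * ennreal (exp (b * R * x i * t)) \<partial>gauss s) =
          ennreal (exp (a * R\<^sup>2 * (x i)\<^sup>2)) * h (R * x i)"
        by (simp add: nn_integral_gauss nn_integral_cmult h_def ind_def)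
    qed
    also have "\<dots> = ennreal (exp (a * R\<^sup>2)) * (\<Prod>i<n. h (R * x i))"
      by (simp add: prod.distrib prod_ennreal exp_sum[symmetric] sum_distrib_left[symmetric] x1)
    finally show "(\<Prod>i<n. h (vn n (snd \<omega>) * X (fst \<omega>) i)) = (\<integral>\<^sup>+u. f \<omega> u \<partial>gauss_vec n s)"
      by (simp add: \<omega> R_def x_def mult.assoc[symmetric] exp_add[symmetric] flip: ennreal_mult)
  qed
  also have "\<dots> = (\<integral>\<^sup>+u. \<integral>\<^sup>+\<omega>. f \<omega> u \<partial>J \<partial>gauss_vec n s)"
    by (rule JS.Fubini'[OF f, symmetric])
  also have "\<dots> = (\<integral>\<^sup>+u. (\<Prod>i<n. ind (u i) * ennreal (1 / sqrt (1 + 2 * a) * exp (b\<^sup>2 * (u i)\<^sup>2 / (2 * (1 + 2 * a))))) \<partial>gauss_vec n s)"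
  proof (rule nn_integral_cong)
    fix u :: vector
    have "(\<lambda>\<omega>. ennreal (exp (- a * (vn n (snd \<omega>))\<^sup>2 + b * (vn n (snd \<omega>) * ip n u (X (fst \<omega>)))))) \<in> borel_measurable J"
      by measurable
    then have "(\<integral>\<^sup>+\<omega>. f \<omega> u \<partial>J) = (\<Prod>i<n. ind (u i)) *
        ennreal ((1 / sqrt (1 + 2 * a)) ^ n * exp (b\<^sup>2 * (vn n u)\<^sup>2 / (2 * (1 + 2 * a))))"
      unfolding f_def nn_integral_radial_exp'[OF a, symmetric] by (rule nn_integral_cmult)
    also have "(1 / sqrt (1 + 2 * a)) ^ n * exp (b\<^sup>2 * (vn n u)\<^sup>2 / (2 * (1 + 2 * a))) =
        (\<Prod>i<n. 1 / sqrt (1 + 2 * a) * exp (b\<^sup>2 * (u i)\<^sup>2 / (2 * (1 + 2 * a))))"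
      by (simp only: prod.distrib prod_constant card_lessThan vn_square sum_distrib_left sum_divide_distrib
          exp_sum finite_lessThan)
    finally show "(\<integral>\<^sup>+\<omega>. f \<omega> u \<partial>J) =
        (\<Prod>i<n. ind (u i) * ennreal (1 / sqrt (1 + 2 * a) * exp (b\<^sup>2 * (u i)\<^sup>2 / (2 * (1 + 2 * a)))))"
      using a by (simp add: prod.distrib prod_ennreal)
  qed
  also have "\<dots> = (\<Prod>i<n. \<integral>\<^sup>+t. ind t * ennreal (1 / sqrt (1 + 2 * a) * exp (b\<^sup>2 * t\<^sup>2 / (2 * (1 + 2 * a)))) \<partial>gauss s)"
    by (rule nn_integral_gauss_vec_prod[OF s]) measurable
  also have "(\<integral>\<^sup>+t. ind t * ennreal (1 / sqrt (1 + 2 * a) * exp (b\<^sup>2 * t\<^sup>2 / (2 * (1 + 2 * a)))) \<partial>gauss s) =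
      (\<integral>\<^sup>+t. ennreal (normal_density 0 (sqrt (1 + s\<^sup>2)) t) * ind t \<partial>lborel)"
  proof -
    have dens: "normal_density 0 s t * (1 / sqrt (1 + 2 * a) * exp (b\<^sup>2 * t\<^sup>2 / (2 * (1 + 2 * a)))) =
        normal_density 0 (sqrt (1 + s\<^sup>2)) t" for t
    proof -
      have v: "1 + 2 * a = (1 + s\<^sup>2) / s\<^sup>2" using s by (simp add: a_def field_simps)
      have p: "0 < 1 + s\<^sup>2" by (simp add: add_pos_nonneg)
      have "b\<^sup>2 * t\<^sup>2 / (2 * (1 + 2 * a)) = t\<^sup>2 / (2 * s\<^sup>2 * (1 + s\<^sup>2))"
        unfolding v b_def using s p by (simp add: divide_simps) (simp add: power2_eq_square power4_eq_xxxx algebra_simps)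
      moreover have "- t\<^sup>2 / (2 * s\<^sup>2) + t\<^sup>2 / (2 * s\<^sup>2 * (1 + s\<^sup>2)) = - t\<^sup>2 / (2 * (1 + s\<^sup>2))"
        using s p by (simp add: divide_simps) (simp add: algebra_simps)
      ultimately have e: "exp (- t\<^sup>2 / (2 * s\<^sup>2)) * exp (b\<^sup>2 * t\<^sup>2 / (2 * (1 + 2 * a))) = exp (- t\<^sup>2 / (2 * (1 + s\<^sup>2)))"
        by (simp only: exp_add[symmetric])
      have "1 / sqrt (2 * pi * s\<^sup>2) * (1 / sqrt (1 + 2 * a)) = 1 / sqrt (2 * pi * (1 + s\<^sup>2))"
        unfolding v using s by (simp flip: real_sqrt_mult)
      then have "1 / sqrt (2 * pi * s\<^sup>2) * (1 / sqrt (1 + 2 * a)) * (exp (- t\<^sup>2 / (2 * s\<^sup>2)) * exp (b\<^sup>2 * t\<^sup>2 / (2 * (1 + 2 * a))))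
          = 1 / sqrt (2 * pi * (1 + s\<^sup>2)) * exp (- t\<^sup>2 / (2 * (1 + s\<^sup>2)))"
        unfolding e by (rule arg_cong)
      then show ?thesis using p by (simp add: normal_density_def mult_ac)
    qed
    have "ennreal (normal_density 0 s t) * (ind t * ennreal (1 / sqrt (1 + 2 * a) * exp (b\<^sup>2 * t\<^sup>2 / (2 * (1 + 2 * a))))) =
      ennreal (normal_density 0 (sqrt (1 + s\<^sup>2)) t) * ind t" for t
      unfolding dens[symmetric] using a by (subst ennreal_mult) (simp_all add: mult.commute mult.left_commute)
    then show ?thesis by (simp add: nn_integral_gauss)
  qed
  finally show ?thesis by (simp add: ind_def)
qed

text \<open>If the sup norm of X is at most T / (2 sqrt n) and |G| \<le> 2 sqrt n, then |G| X lies
  in the box of half-width T, and its smoothing lies in the doubled box with probability at least 1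
  / 2. The factor 8 is the inverse of 1 / 2 * 1 / 4, the second factor being the bound for the
  probability of |G| \<le> 2 sqrt n.\<close>

lemma small_ball:
  assumes T: "0 < T"
  shows "emeasure \<mu> {U \<in> space \<mu>. supn n (X U) \<le> T / (2 * sqrt n)}
    \<le> ennreal (8 * exp (- (real n / 12) * exp (- 4 * T\<^sup>2)))" (is "emeasure \<mu> ?A \<le> _")
proof -
  interpret G: prob_space "gauss_vec n 1" by (rule prob_space_gauss_vec) simp
  \<comment> \<open>The cap 1 keeps the variance 1 + s^2 at most 2 for the upper bound; the other
    term is the Chebyshev condition for the lower bound.\<close>
  define s where "s = sqrt (min 1 (T\<^sup>2 / (2 * real n)))"
  have s: "0 < s" "s \<le> 1" "s\<^sup>2 \<le> T\<^sup>2 / (2 * real n)" using T n by (auto simp: s_def)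
  define h where "h = (\<lambda>z. \<integral>\<^sup>+t. ennreal (normal_density z s t) * indicator {-2*T..2*T} t \<partial>lborel)"
  let ?B = "{G \<in> space (gauss_vec n 1). vn n G \<le> 2 * sqrt n}"
  have A: "?A \<in> sets \<mu>" by measurable
  have B: "?B \<in> sets (gauss_vec n 1)" by measurable
  have "(\<integral>\<^sup>+\<omega>. (ennreal (1 / 2) * indicator ?A (fst \<omega>)) * indicator ?B (snd \<omega>) \<partial>J)
      \<le> (\<integral>\<^sup>+\<omega>. (\<Prod>i<n. h (vn n (snd \<omega>) * X (fst \<omega>) i)) \<partial>J)"
  proof (rule nn_integral_mono)
    fix \<omega> assume "\<omega> \<in> space J"
    show "(ennreal (1 / 2) * indicator ?A (fst \<omega>)) * indicator ?B (snd \<omega>) \<le> (\<Prod>i<n. h (vn n (snd \<omega>) * X (fst \<omega>) i))"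
    proof (cases "fst \<omega> \<in> ?A \<and> snd \<omega> \<in> ?B")
      case True
      have "ennreal (1 - 1 / (2 * real n)) \<le> h (vn n (snd \<omega>) * X (fst \<omega>) i)" if i: "i < n" for i
      proof -
        have "\<bar>vn n (snd \<omega>) * X (fst \<omega>) i\<bar> \<le> (2 * sqrt n) * (T / (2 * sqrt n))"
          unfolding abs_mult using True abs_le_supn[OF i, of "X (fst \<omega>)"]
          by (intro mult_mono) (auto simp: L2_set_nonneg)
        then have "\<bar>vn n (snd \<omega>) * X (fst \<omega>) i\<bar> \<le> T" using n by simp
        then show ?thesis unfolding h_def by (rule normal_density_interval_ge[OF T s(1,3)])
      qed
      then have prod: "(\<Prod>i<n. ennreal (1 - 1 / (2 * real n))) \<le> (\<Prod>i<n. h (vn n (snd \<omega>) * X (fst \<omega>) i))"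
        by (intro prod_mono_ennreal) auto
      have "1 / 2 \<le> (1 - 1 / (2 * real n)) ^ n"
        using Bernoulli_inequality[of "- 1 / (2 * real n)" n] n by (simp add: field_simps)
      then have "ennreal (1 / 2) \<le> ennreal ((1 - 1 / (2 * real n)) ^ n)" by (rule ennreal_leI)
      moreover have "0 \<le> 1 - 1 / (2 * real n)" using n by (simp add: field_simps)
      ultimately have half: "ennreal (1 / 2) \<le> (\<Prod>i<n. ennreal (1 - 1 / (2 * real n)))"
        by (simp only: ennreal_power prod_constant card_lessThan)
      show ?thesis using True order_trans[OF half prod] by simp
    next
      case False then show ?thesis by (auto simp: indicator_def)
    qed
  qed
  also have "\<dots> = (\<integral>\<^sup>+t. ennreal (normal_density 0 (sqrt (1 + s\<^sup>2)) t) * indicator {-2*T..2*T} t \<partial>lborel) ^ n"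
    unfolding h_def by (rule box_probability[OF s(1) T])
  also have "\<dots> \<le> ennreal (exp (- (1 / 12) * exp (- 4 * T\<^sup>2))) ^ n"
    by (intro power_mono normal_density_interval_le T s) simp
  also have "\<dots> = ennreal (exp (- (real n / 12) * exp (- 4 * T\<^sup>2)))"
    by (simp add: ennreal_power exp_of_nat_mult[symmetric])
  also have "(\<integral>\<^sup>+\<omega>. (ennreal (1 / 2) * indicator ?A (fst \<omega>)) * indicator ?B (snd \<omega>) \<partial>J) =
      ennreal (1 / 2) * emeasure \<mu> ?A * emeasure (gauss_vec n 1) ?B"
    using A B by (subst nn_integral_J_prod) (auto simp: nn_integral_cmult)
  finally have le: "ennreal (1 / 2) * emeasure \<mu> ?A * emeasure (gauss_vec n 1) ?B
      \<le> ennreal (exp (- (real n / 12) * exp (- 4 * T\<^sup>2)))" .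
  have "1 / 2 * U.prob ?A * G.prob ?B \<le> exp (- (real n / 12) * exp (- 4 * T\<^sup>2))"
  proof -
    have "ennreal (1 / 2 * U.prob ?A * G.prob ?B) = ennreal (1 / 2) * ennreal (U.prob ?A) * ennreal (G.prob ?B)"
      by (subst ennreal_mult, simp, simp, subst ennreal_mult, simp, simp, rule refl)
    also have "\<dots> \<le> ennreal (exp (- (real n / 12) * exp (- 4 * T\<^sup>2)))"
      using le unfolding U.emeasure_eq_measure G.emeasure_eq_measure .
    finally show ?thesis by (subst (asm) ennreal_le_iff) auto
  qed
  moreover have "1 / 2 * U.prob ?A * (1 / 4) \<le> 1 / 2 * U.prob ?A * G.prob ?B"
    using gauss_vec_norm_le[OF n] by (intro mult_left_mono) auto
  ultimately have "U.prob ?A \<le> 8 * exp (- (real n / 12) * exp (- 4 * T\<^sup>2))" by simp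
  then show ?thesis unfolding U.emeasure_eq_measure by (rule ennreal_leI)
qed

end

section \<open>Moments and tails\<close>

text \<open>Merges the two contributions to the negative moment into one p-th power; this is a place
  where p \<ge> 1 is needed.\<close>

lemma powr_superadditive:
  fixes a b p :: real
  assumes "0 \<le> a" "0 \<le> b" "1 \<le> p"
  shows "a powr p + b powr p \<le> (a + b) powr p"
proof -
  have *: "c powr p \<le> c * (a + b) powr (p - 1)" if "0 \<le> c" "c \<le> a + b" for c
  proof (cases "c = 0")
    case False
    have "c powr p = c * c powr (p - 1)" using that by (simp add: powr_mult_base)
    also have "\<dots> \<le> c * (a + b) powr (p - 1)"
      using that False assms by (simp add: mult_left_mono powr_mono2)
    finally show ?thesis .
  qed simp
  have "a powr p + b powr p \<le> a * (a + b) powr (p - 1) + b * (a + b) powr (p - 1)"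
    using *[of a] *[of b] assms by simp
  also have "\<dots> = (a + b) * (a + b) powr (p - 1)" by (simp add: distrib_right)
  also have "\<dots> = (a + b) powr p" using assms by (simp add: powr_mult_base)
  finally show ?thesis .
qed

lemma ell_ge_1: "0 \<le> p \<Longrightarrow> 1 \<le> ell n p"
proof -
  assume "0 \<le> p"
  then have "ln (exp 1) \<le> ell n p" unfolding ell_def by (subst ln_le_cancel_iff) (auto intro: add_pos_nonneg)
  then show ?thesis by simp
qed

text \<open>With w the argument of the logarithm in \<open>ell\<close> and r = sqrt w, exp (- ell /
  2) = 1 / r and n / r grows like p r, whereas ln ell is only logarithmic in r. So the small ball
  probability pays for a factor ell^(- p / 2) up to exp (6 p).\<close>

lemma small_ball_exponent:
  fixes p :: real
  assumes p: "1 \<le> p"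
  shows "- (real n / 12) * exp (- (ell n p / 2)) \<le> p * (6 - ln (ell n p) / 2)"
proof -
  define w where "w = exp 1 + real n / (1 + p)"
  have w: "1 < w" "ell n p = ln w" "exp 1 \<le> w"
    using p one_less_exp_iff[of "1 :: real"] by (auto simp: w_def ell_def intro: less_le_trans[of _ "exp 1"])
  define r where "r = sqrt w"
  have r: "1 < r" "r * r = w" using w by (auto simp: r_def)
  have "ln w = 2 * ln r" using r w by (simp add: r_def ln_sqrt)
  then have ellr: "ell n p \<le> 2 * r" using ln_le_minus_one[of r] r w by simp
  have "exp (- (ell n p / 2)) = 1 / r"
    using r w by (simp add: exp_minus \<open>ln w = 2 * ln r\<close> field_simps)
  moreover have "real n / r \<ge> p * r - 4 * p"
  proof -
    have n: "real n = (1 + p) * (w - exp 1)" using p by (simp add: w_def)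
    have "exp 1 \<le> 2 * r"
    proof -
      have "(exp 1 :: real) \<le> 3" by (rule exp_le)
      moreover have "3 / 2 \<le> r" unfolding r_def
        by (rule real_le_rsqrt) (use w(3) exp_lower_Taylor_quadratic[of "1::real"] in \<open>simp add: power2_eq_square\<close>)
      ultimately show ?thesis by simp
    qed
    then have "r * r - 2 * r \<le> w - exp 1" using r by simp
    then have "(1 + p) * (r * r - 2 * r) \<le> real n" unfolding n using p by (intro mult_left_mono) auto
    then have "(1 + p) * (r - 2) * r \<le> real n" by (simp add: algebra_simps)
    then have "(1 + p) * (r - 2) \<le> real n / r" using r by (simp add: field_simps)
    moreover have "p * r - 4 * p \<le> (1 + p) * (r - 2)" using p r by (simp add: algebra_simps)
    ultimately show ?thesis by simp
  qed
  \<comment> \<open>The tangent of ln at scale 12 yields the slope 1 / 12 in r, the same as that of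
    the gain from the small ball exponent.\<close>
  moreover have "ln (ell n p) / 2 \<le> r / 12 + 5"
  proof -
    have l1: "0 < ell n p" using ell_ge_1[of p n] p by simp
    have "ln (ell n p / 12) \<le> ell n p / 12 - 1" using l1 by (intro ln_le_minus_one) simp
    moreover have "ln (ell n p / 12) = ln (ell n p) - ln 12" using l1 by (simp add: ln_div)
    moreover have "ln (12::real) \<le> 11" using ln_le_minus_one[of "12::real"] by simp
    ultimately show ?thesis using ellr by simp
  qed
  then have "p * (ln (ell n p) / 2) \<le> p * (r / 12 + 5)" using p by (intro mult_left_mono) auto
  ultimately show ?thesis using p by (simp add: algebra_simps)
qed

text \<open>The summands are the constants of the two parts in \<open>negative_moment\<close>: above
  and below the truncation level.\<close>

definition moment_const :: real where "moment_const = 6 + 8 * exp 6"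

lemma moment_const_ge: "6 \<le> moment_const" by (simp add: moment_const_def)

definition moment_bound :: "nat \<Rightarrow> real \<Rightarrow> real" where "moment_bound n p = moment_const * sqrt (real n / ell n p)"

context haar_unit_vector
begin

lemma supn_X_ge: "U \<in> space \<mu> \<Longrightarrow> 1 / sqrt n \<le> supn n (X U)"
  using vn_le_supn[where n = n and x = "X U"] n by (simp add: vn_X field_simps)

lemma supn_X_pos: "U \<in> space \<mu> \<Longrightarrow> 0 < supn n (X U)"
  by (rule less_le_trans[OF _ supn_X_ge]) (use n in simp_all)

text \<open>Truncate at a level s of order sqrt (ell / n). Above s the power is at most s^(- p);
  below s the deterministic bound gives n^(p / 2), and the small ball probability turns it into (n /
  ell)^(p / 2) up to a constant to the power p.\<close>

lemma negative_moment:
  assumes p: "1 \<le> p"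
  shows "(\<integral>\<^sup>+U. ennreal (supn n (X U) powr (- p)) \<partial>\<mu>) \<le> ennreal (moment_bound n p powr p)"
proof -
  have l: "1 \<le> ell n p" using p by (intro ell_ge_1) simp
  define D0 where "D0 = sqrt (real n / ell n p)"
  have D0: "0 < D0" using l n by (simp add: D0_def)
  \<comment> \<open>Makes exp (- 4 T^2) equal to exp (- ell / 2), the quantity treated in
    \<open>small_ball_exponent\<close>.\<close>
  define T where "T = sqrt (ell n p / 8)"
  have T: "0 < T" "4 * T\<^sup>2 = ell n p / 2" using l by (auto simp: T_def)
  define s where "s = T / (2 * sqrt n)"
  have s: "0 < s" using T n by (simp add: s_def)
  let ?A = "{U \<in> space \<mu>. supn n (X U) \<le> s}"
  have A: "?A \<in> sets \<mu>" by measurable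
  have "(\<integral>\<^sup>+U. ennreal (supn n (X U) powr (- p)) \<partial>\<mu>) \<le>
      (\<integral>\<^sup>+U. ennreal (s powr (- p)) + ennreal (sqrt n powr p) * indicator ?A U \<partial>\<mu>)"
  proof (rule nn_integral_mono)
    fix U assume U: "U \<in> space \<mu>"
    show "ennreal (supn n (X U) powr (- p)) \<le> ennreal (s powr (- p)) + ennreal (sqrt n powr p) * indicator ?A U"
    proof (cases "supn n (X U) \<le> s")
      case True
      have "supn n (X U) powr (- p) \<le> (1 / sqrt n) powr (- p)"
        using supn_X_ge[OF U] n p by (intro powr_mono2') auto
      also have "\<dots> = sqrt n powr p" using n by (simp add: powr_minus powr_divide)
      finally have "ennreal (supn n (X U) powr (- p)) \<le> ennreal (sqrt n powr p)" by (rule ennreal_leI)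
      then show ?thesis using True U by (simp add: add_increasing)
    next
      case False
      have "supn n (X U) powr (- p) \<le> s powr (- p)"
        using False s p by (intro powr_mono2') auto
      then show ?thesis using False by (simp add: ennreal_leI)
    qed
  qed
  also have "\<dots> = ennreal (s powr (- p)) + ennreal (sqrt n powr p) * emeasure \<mu> ?A"
    using A by (simp add: nn_integral_add nn_integral_cmult_indicator U.emeasure_space_1)
  also have "\<dots> \<le> ennreal ((6 * D0) powr p) + ennreal ((8 * exp 6 * D0) powr p)"
  proof (rule add_mono)
    have "1 / s \<le> 6 * D0"
    proof -
      have "1 / s = 2 * sqrt (8 * (real n / ell n p))"
        using l n by (simp add: s_def T_def real_sqrt_divide field_simps flip: real_sqrt_mult)
      also have "\<dots> = 2 * sqrt 8 * D0" unfolding D0_def by (simp only: real_sqrt_mult)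
      also have "\<dots> \<le> 6 * D0"
        using D0 real_sqrt_le_mono[of 8 9] by (intro mult_right_mono) (simp_all add: real_sqrt_unique[of 3 9])
      finally show ?thesis .
    qed
    then have "(1 / s) powr p \<le> (6 * D0) powr p" using s p by (intro powr_mono2) auto
    moreover have "s powr (- p) = (1 / s) powr p" using s by (simp add: powr_minus powr_divide inverse_eq_divide)
    ultimately show "ennreal (s powr (- p)) \<le> ennreal ((6 * D0) powr p)" by (simp add: ennreal_leI)
  next
    have "exp (- (real n / 12) * exp (- 4 * T\<^sup>2)) \<le> exp (p * (6 - ln (ell n p) / 2))"
    proof -
      have "- 4 * T\<^sup>2 = - (ell n p / 2)" using T(2) by linarith
      then show ?thesis using small_ball_exponent[OF p, of n] by (simp only: exp_le_cancel_iff)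
    qed
    then have "emeasure \<mu> ?A \<le> ennreal (8 * exp (p * (6 - ln (ell n p) / 2)))"
      unfolding s_def using small_ball[OF T(1)] by (elim order_trans) (simp add: ennreal_leI)
    then have "ennreal (sqrt n powr p) * emeasure \<mu> ?A \<le>
        ennreal (sqrt n powr p) * ennreal (8 * exp (p * (6 - ln (ell n p) / 2)))"
      by (rule mult_left_mono) simp
    also have "\<dots> = ennreal (sqrt n powr p * (8 * exp (p * (6 - ln (ell n p) / 2))))"
      by (rule ennreal_mult[symmetric]) auto
    also have "sqrt n powr p * (8 * exp (p * (6 - ln (ell n p) / 2))) = 8 * (exp 6 * D0) powr p"
    proof -
      have "exp (p * (6 - ln (ell n p) / 2)) = (exp 6 / sqrt (ell n p)) powr p"
        using l by (simp add: powr_def ln_div ln_sqrt)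
      moreover have "exp 6 * D0 = sqrt n * (exp 6 / sqrt (ell n p))" by (simp add: D0_def real_sqrt_divide)
      ultimately show ?thesis using l n by (simp only: powr_mult)
    qed
    also have "\<dots> \<le> 8 powr p * (exp 6 * D0) powr p"
      using p powr_mono[of 1 p "8::real"] by (intro mult_right_mono) auto
    also have "\<dots> = (8 * exp 6 * D0) powr p" using D0 by (simp add: powr_mult mult.assoc)
    finally show "ennreal (sqrt n powr p) * emeasure \<mu> ?A \<le> ennreal ((8 * exp 6 * D0) powr p)"
      by (simp add: ennreal_leI)
  qed
  also have "\<dots> = ennreal ((6 * D0) powr p + (8 * exp 6 * D0) powr p)" by simp
  also have "\<dots> \<le> ennreal ((6 * D0 + 8 * exp 6 * D0) powr p)"
    using D0 p by (intro ennreal_leI powr_superadditive) auto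
  also have "6 * D0 + 8 * exp 6 * D0 = moment_bound n p" by (simp add: moment_bound_def moment_const_def D0_def algebra_simps)
  finally show ?thesis .
qed

section \<open>Tails of sums of independent sup norms\<close>

abbreviation Q :: "nat \<Rightarrow> (nat \<Rightarrow> matrix) measure" where "Q m \<equiv> \<Pi>\<^sub>M j\<in>{1..m}. \<mu>"

lemma measurable_sup_sum [measurable]: "(\<lambda>U. sup_sum n m U \<theta>) \<in> borel_measurable (Q m)"
  unfolding sup_sum_def
  by (intro borel_measurable_sum)
    (rule measurable_compose[OF _ measurable_supn_X], rule measurable_component_singleton)

lemma nn_integral_Q_prod:
  assumes "f \<in> borel_measurable \<mu>"
  shows "(\<integral>\<^sup>+U. (\<Prod>j\<in>{1..m}. f (U j)) \<partial>Q m) = (\<integral>\<^sup>+U. f U \<partial>\<mu>) ^ m"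
proof -
  interpret product_sigma_finite "\<lambda>_ :: nat. \<mu>" ..
  show ?thesis using product_nn_integral_prod[of "{1..m}" "\<lambda>_. f"] assms by simp
qed

lemma space_Q: "U \<in> space (Q m) \<Longrightarrow> j \<in> {1..m} \<Longrightarrow> U j \<in> space \<mu>"
  by (auto simp: space_PiM)

text \<open>Passing from the sum to the product lets independence factor the moment: Markov is
  applied to the product of the p-th negative powers, so each factor needs only order p although the
  resulting exponent is m p.\<close>

lemma sup_sum_lower_tail:
  assumes p: "1 \<le> p" and t: "0 < t" and m: "1 \<le> m"
  shows "emeasure (Q m) {U \<in> space (Q m). sup_sum n m U \<theta> \<le> real m * t}
    \<le> ennreal ((t * moment_bound n p) powr (real m * p))" (is "emeasure _ ?A \<le> _")
proof -
  have "0 \<le> ell n p" using ell_ge_1[of p n] p by linarith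
  then have D: "0 \<le> moment_bound n p" using moment_const_ge by (simp add: moment_bound_def)
  define f where "f U = ennreal (t powr p) * ennreal (supn n (X U) powr (- p))" for U
  have f [measurable]: "f \<in> borel_measurable \<mu>" unfolding f_def by measurable
  have "emeasure (Q m) ?A \<le> (\<integral>\<^sup>+U. (\<Prod>j\<in>{1..m}. f (U j)) \<partial>Q m)"
  proof (rule emeasure_le_nn_integral)
    show "?A \<in> sets (Q m)" by measurable
    fix U assume U: "U \<in> ?A"
    let ?x = "\<lambda>j. supn n (X (U j))"
    have pos: "0 < ?x j" if "j \<in> {1..m}" for j using U that by (intro supn_X_pos space_Q[of U m]) auto
    have "(\<Prod>j\<in>{1..m}. ?x j) powr (1 / real (card {1..m})) \<le> (\<Sum>j\<in>{1..m}. ?x j / real (card {1..m}))"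
      using pos m by (intro arith_geom_mean) (auto simp: less_imp_le)
    also have "\<dots> = sup_sum n m U \<theta> / m" by (simp add: sup_sum_def sum_divide_distrib)
    also have "\<dots> \<le> t" using U m by (simp add: field_simps)
    finally have gm: "(\<Prod>j\<in>{1..m}. ?x j) powr (1 / m) \<le> t" by simp
    have P: "0 < (\<Prod>j\<in>{1..m}. ?x j)" using pos by (rule prod_pos)
    have "(\<Prod>j\<in>{1..m}. ?x j) powr p = ((\<Prod>j\<in>{1..m}. ?x j) powr (1 / m)) powr (m * p)"
      using m by (simp add: powr_powr)
    also have "\<dots> \<le> t powr (m * p)" using gm p by (intro powr_mono2) auto
    finally have le: "(\<Prod>j\<in>{1..m}. ?x j) powr p \<le> t powr (m * p)" .
    have "1 \<le> a * b powr (- p)" if "0 < b" "b powr p \<le> a" for a b :: real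
      using that by (simp add: powr_minus field_simps)
    from this[OF P le] have "1 \<le> t powr (m * p) * (\<Prod>j\<in>{1..m}. ?x j) powr (- p)" .
    also have "t powr (m * p) = (\<Prod>j\<in>{1..m}. t powr p)"
      using t by (simp add: powr_realpow[symmetric] powr_powr mult.commute)
    also have "(\<Prod>j\<in>{1..m}. ?x j) powr (- p) = (\<Prod>j\<in>{1..m}. ?x j powr (- p))"
      using pos by (intro prod_powr_distrib)
    finally have "1 \<le> (\<Prod>j\<in>{1..m}. t powr p * ?x j powr (- p))" by (simp only: prod.distrib)
    then have "ennreal 1 \<le> ennreal (\<Prod>j\<in>{1..m}. t powr p * ?x j powr (- p))" by (rule ennreal_leI)
    also have "\<dots> = (\<Prod>j\<in>{1..m}. f (U j))"
      by (subst prod_ennreal[symmetric]) (auto simp: f_def ennreal_mult)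
    finally show "1 \<le> (\<Prod>j\<in>{1..m}. f (U j))" by simp
  qed
  also have "\<dots> = (\<integral>\<^sup>+U. f U \<partial>\<mu>) ^ m" by (rule nn_integral_Q_prod[OF f])
  also have "\<dots> \<le> ennreal ((t * moment_bound n p) powr p) ^ m"
  proof (intro power_mono)
    have "(\<integral>\<^sup>+U. f U \<partial>\<mu>) = ennreal (t powr p) * (\<integral>\<^sup>+U. ennreal (supn n (X U) powr (- p)) \<partial>\<mu>)"
      unfolding f_def by (rule nn_integral_cmult) measurable
    also have "\<dots> \<le> ennreal (t powr p) * ennreal (moment_bound n p powr p)"
      by (intro mult_left_mono negative_moment p) simp
    also have "\<dots> = ennreal ((t * moment_bound n p) powr p)"
      using t D by (simp add: ennreal_mult[symmetric] powr_mult)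
    finally show "(\<integral>\<^sup>+U. f U \<partial>\<mu>) \<le> ennreal ((t * moment_bound n p) powr p)" .
  qed simp
  also have "\<dots> = ennreal (((t * moment_bound n p) powr p) ^ m)" by (rule ennreal_power) simp
  \<comment> \<open>\<open>powr_realpow\<close> asks for a positive base; if the base is 0, both
    sides vanish because m \<ge> 1.\<close>
  also have "((t * moment_bound n p) powr p) ^ m = (t * moment_bound n p) powr (real m * p)"
  proof (cases "t * moment_bound n p = 0")
    case False
    then show ?thesis by (simp add: powr_realpow[symmetric] powr_powr mult.commute)
  next
    case True
    then show ?thesis unfolding True using m by (simp add: power_0_left)
  qed
  finally show ?thesis .
qed

lemma sup_sum_upper_tail:
  assumes S: "0 \<le> S"
  shows "emeasure (Q m) {U \<in> space (Q m). real m * S / sqrt n \<le> sup_sum n m U \<theta>}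
    \<le> ennreal ((8 * real n) ^ m * exp (- (real m * S\<^sup>2 / 8)))" (is "emeasure _ ?A \<le> _")
proof -
  \<comment> \<open>The minimiser of - l S / sqrt n + 2 l^2 / n, with minimum - S^2 / 8.\<close>
  define l where "l = sqrt n * S / 4"
  have l: "0 \<le> l" using S by (simp add: l_def)
  define f where "f U = ennreal (exp (- l * S / sqrt n)) * ennreal (exp (l * supn n (X U)))" for U
  have f [measurable]: "f \<in> borel_measurable \<mu>" unfolding f_def by measurable
  have "emeasure (Q m) ?A \<le> (\<integral>\<^sup>+U. (\<Prod>j\<in>{1..m}. f (U j)) \<partial>Q m)"
  proof (rule emeasure_le_nn_integral)
    show "?A \<in> sets (Q m)" by measurable
    fix U assume U: "U \<in> ?A"
    then have "l * (real m * S / sqrt n) \<le> l * sup_sum n m U \<theta>" using l by (intro mult_left_mono) auto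
    then have "0 \<le> (\<Sum>j\<in>{1..m}. - l * S / sqrt n + l * supn n (X (U j)))"
      by (simp add: sum.distrib sum_subtractf sum_distrib_left[symmetric] sup_sum_def mult_ac)
    then have "1 \<le> exp (\<Sum>j\<in>{1..m}. - l * S / sqrt n + l * supn n (X (U j)))" by simp
    also have "\<dots> = (\<Prod>j\<in>{1..m}. exp (- l * S / sqrt n) * exp (l * supn n (X (U j))))"
      by (simp only: exp_sum finite_atLeastAtMost exp_add)
    finally have "ennreal 1 \<le> ennreal (\<Prod>j\<in>{1..m}. exp (- l * S / sqrt n) * exp (l * supn n (X (U j))))"
      by (rule ennreal_leI)
    also have "\<dots> = (\<Prod>j\<in>{1..m}. f (U j))"
      by (subst prod_ennreal[symmetric]) (auto simp: f_def ennreal_mult)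
    finally show "1 \<le> (\<Prod>j\<in>{1..m}. f (U j))" by simp
  qed
  also have "\<dots> = (\<integral>\<^sup>+U. f U \<partial>\<mu>) ^ m" by (rule nn_integral_Q_prod[OF f])
  also have "\<dots> \<le> ennreal (8 * real n * exp (- (S\<^sup>2 / 8))) ^ m"
  proof (intro power_mono)
    have "(\<integral>\<^sup>+U. f U \<partial>\<mu>) = ennreal (exp (- l * S / sqrt n)) * (\<integral>\<^sup>+U. ennreal (exp (l * supn n (X U))) \<partial>\<mu>)"
      unfolding f_def by (rule nn_integral_cmult) measurable
    also have "\<dots> \<le> ennreal (exp (- l * S / sqrt n)) * ennreal (8 * real n * exp (2 * l\<^sup>2 / n))"
      by (intro mult_left_mono nn_integral_exp_supn_le l) simp
    also have "\<dots> = ennreal (exp (- l * S / sqrt n) * (8 * real n * exp (2 * l\<^sup>2 / n)))"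
      by (rule ennreal_mult[symmetric]) auto
    also have "exp (- l * S / sqrt n) * (8 * real n * exp (2 * l\<^sup>2 / n)) =
        8 * real n * exp (- l * S / sqrt n + 2 * l\<^sup>2 / n)" by (simp only: exp_add) simp
    also have "- l * S / sqrt n + 2 * l\<^sup>2 / n = - (S\<^sup>2 / 8)"
      using n by (simp add: l_def power_mult_distrib power_divide) (simp add: power2_eq_square)
    finally show "(\<integral>\<^sup>+U. f U \<partial>\<mu>) \<le> ennreal (8 * real n * exp (- (S\<^sup>2 / 8)))" .
  qed simp
  also have "\<dots> = ennreal ((8 * real n * exp (- (S\<^sup>2 / 8))) ^ m)" by (rule ennreal_power) simp
  also have "(8 * real n * exp (- (S\<^sup>2 / 8))) ^ m = (8 * real n) ^ m * exp (- (real m * S\<^sup>2 / 8))"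
    by (simp add: power_mult_distrib exp_of_nat_mult[symmetric])
  finally show ?thesis .
qed

end

section \<open>The distance bound\<close>

context onb
begin

text \<open>The supremum M on the sphere satisfies M \<le> b + M / 2 by the triangle inequality at a
  net point. A priori M \<le> m is finite, so the inequality can be solved for M.\<close>

lemma sup_sum_le_from_net:
  assumes n: "1 \<le> n" and U: "\<And>j. j \<in> {1..m} \<Longrightarrow> U j \<in> orthogonal_group n"
    and N: "N \<subseteq> F" "\<And>x. x \<in> F \<Longrightarrow> vn n x = 1 \<Longrightarrow> \<exists>y\<in>N. vn n (x - y) \<le> 1 / 2"
    and b: "\<And>y. y \<in> N \<Longrightarrow> sup_sum n m U y \<le> b" and x: "x \<in> F"
  shows "sup_sum n m U x \<le> 2 * b * vn n x"
proof (cases "vn n x = 0")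
  case True
  then show ?thesis using sup_sum_le[OF n U, where x = x] x F_Rn by auto
next
  case False
  define g where "g = sup_sum n m U"
  define E where "E = g ` {d \<in> F. vn n d = 1}"
  define M where "M = Sup E"
  have bdd: "bdd_above E"
  proof (rule bdd_aboveI)
    fix s assume "s \<in> E"
    then obtain d where "d \<in> F" "vn n d = 1" "s = g d" by (auto simp: E_def)
    then show "s \<le> real m" using sup_sum_le[OF n U, where x = d] F_Rn by (auto simp: g_def)
  qed
  have le: "g z \<le> M * vn n z" if z: "z \<in> F" for z
  proof (cases "vn n z = 0")
    case True
    then show ?thesis using sup_sum_le[OF n U, where x = z] z F_Rn by (auto simp: g_def)
  next
    case False
    define v where "v = (1 / vn n z) *\<^sub>R z"
    have "v \<in> F" "vn n v = 1"
      using False that subF by (simp_all add: v_def vn_scaleR subspace_scale)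
    then have "g v \<in> E" by (simp add: E_def)
    then have "g v \<le> M" unfolding M_def by (rule cSup_upper[OF _ bdd])
    moreover have "0 < vn n z" using False by (simp add: less_le L2_set_nonneg)
    ultimately show ?thesis using n by (simp add: v_def g_def sup_sum_scaleR field_simps)
  qed
  define v where "v = (1 / vn n x) *\<^sub>R x"
  have v: "v \<in> F" "vn n v = 1"
    using False x subF by (simp_all add: v_def vn_scaleR subspace_scale)
  have "0 \<le> g v" using n by (simp add: g_def sup_sum_def sum_nonneg supn_nonneg)
  then have M0: "0 \<le> M" using le[OF v(1)] v(2) by simp
  have "M \<le> b + M / 2"
    unfolding M_def
  proof (rule cSup_least)
    show "E \<noteq> {}" using v by (auto simp: E_def)
    fix s assume "s \<in> E"
    then obtain d where d: "d \<in> F" "vn n d = 1" "s = g d" by (auto simp: E_def)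
    obtain y where y: "y \<in> N" "vn n (d - y) \<le> 1 / 2" using N(2)[OF d(1,2)] by auto
    have "g d \<le> g y + g (d - y)"
      using sup_sum_triangle[OF n, of m U y "d - y"] by (simp add: g_def)
    also have "g y \<le> b" using b[OF y(1)] by (simp add: g_def)
    also have "g (d - y) \<le> M * vn n (d - y)"
      using y N(1) d subF by (intro le subspace_diff) auto
    also have "\<dots> \<le> M * (1 / 2)" using y M0 by (intro mult_left_mono) auto
    finally show "s \<le> b + Sup E / 2" by (simp add: d M_def)
  qed
  then have "M \<le> 2 * b" by simp
  then have "M * vn n x \<le> 2 * b * vn n x" by (rule mult_right_mono) (rule L2_set_nonneg)
  then show ?thesis using le[OF x] by (simp add: g_def)
qed

text \<open>The Lipschitz constant m costs m t over a distance t, half of the margin 2 m t at the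
  net points.\<close>

lemma sup_sum_ge_from_net:
  assumes n: "1 \<le> n" and U: "\<And>j. j \<in> {1..m} \<Longrightarrow> U j \<in> orthogonal_group n"
    and N: "N \<subseteq> F" "\<And>x. x \<in> F \<Longrightarrow> vn n x = 1 \<Longrightarrow> \<exists>y\<in>N. vn n (x - y) \<le> t"
    and b: "\<And>y. y \<in> N \<Longrightarrow> real m * (2 * t) \<le> sup_sum n m U y" and x: "x \<in> F"
  shows "real m * t * vn n x \<le> sup_sum n m U x"
proof (cases "vn n x = 0")
  case True
  then show ?thesis using n by (simp add: sup_sum_def sum_nonneg supn_nonneg)
next
  case False
  define v where "v = (1 / vn n x) *\<^sub>R x"
  have v: "v \<in> F" "vn n v = 1"
    using False x subF by (simp_all add: v_def vn_scaleR subspace_scale)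
  obtain y where y: "y \<in> N" "vn n (v - y) \<le> t" using N(2)[OF v] by auto
  have yF: "y - v \<in> F" using y v N subF by (auto intro: subspace_diff)
  have "real m * (2 * t) \<le> sup_sum n m U y" by (rule b[OF y(1)])
  also have "\<dots> \<le> sup_sum n m U v + sup_sum n m U (y - v)"
    using sup_sum_triangle[OF n, of m U v "y - v"] by simp
  also have "sup_sum n m U (y - v) \<le> real m * vn n (y - v)"
    using yF F_Rn by (intro sup_sum_le[OF n U]) auto
  also have "vn n (y - v) = vn n (v - y)"
    using vn_scaleR[where n = n and r = "- 1" and x = "v - y"] by simp
  also have "real m * \<dots> \<le> real m * t" using y(2) by (intro mult_left_mono) auto
  finally have "real m * t \<le> sup_sum n m U v" by (simp add: algebra_simps)
  moreover have "0 < vn n x" using False by (simp add: less_le L2_set_nonneg)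
  ultimately show ?thesis using n by (simp add: v_def sup_sum_scaleR field_simps)
qed

end

section \<open>Elementary estimates for \<open>ell\<close> and \<open>Delta\<close>\<close>

lemma exp_3_ge: "8 \<le> exp (3 :: real)"
proof -
  have "(2 :: real) ^ 3 \<le> exp 1 ^ 3"
    using exp_ge_add_one_self[of "1 :: real"] by (intro power_mono) auto
  also have "\<dots> = exp 3" by (simp flip: exp_of_nat_mult)
  finally show ?thesis by simp
qed

lemma ln_en_ge_1: "1 \<le> n \<Longrightarrow> 1 \<le> ln (exp 1 * real n)"
  by (simp add: ln_mult)

lemma Delta_pos: "2 * real k / real m \<le> p \<Longrightarrow> 1 \<le> m \<Longrightarrow> 1 \<le> k \<Longrightarrow> real k < Delta m k p"
  by (simp add: Delta_def field_simps)

text \<open>Guarantees n / ell \<ge> 1, so that the bases of the powers in the distance bound are at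
  least 1 and the powers are monotone in the exponent.\<close>

lemma ell_le:
  assumes "2 \<le> n" "0 \<le> p" shows "ell n p \<le> real n"
proof -
  have "real n / (1 + p) \<le> real n / 1" using assms by (intro divide_left_mono) auto
  also have "\<dots> \<le> exp 1 * (real n / 2)"
    using exp_ge_add_one_self[of "1 :: real"] mult_right_mono[of 2 "exp 1 :: real" "real n / 2"] by simp
  finally have "exp 1 + real n / (1 + p) \<le> exp 1 * (1 + real n / 2)" by (simp add: distrib_left)
  then have "ell n p \<le> ln (exp 1 * (1 + real n / 2))"
    unfolding ell_def using assms by (subst ln_le_cancel_iff) (auto intro!: add_pos_nonneg mult_pos_pos)
  also have "\<dots> = 1 + ln (1 + real n / 2)" by (subst ln_mult) (auto simp: add_pos_nonneg)
  also have "\<dots> \<le> 1 + real n / 2" using ln_add_one_self_le_self[of "real n / 2"] by simp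
  finally show ?thesis using assms by simp
qed

text \<open>For p < 1 the argument e + n / (1 + p) is at most the square of its value e + n / 2 at
  1, so the logarithm at most doubles.\<close>

lemma ell_max_1:
  assumes "0 \<le> p" shows "ell n p \<le> 2 * ell n (max p 1)"
proof (cases "1 \<le> p")
  case True
  then show ?thesis using ell_ge_1[of p n] by (simp add: max_def)
next
  case False
  have e: "1 \<le> exp (1 :: real)" by simp
  have "real n / (1 + p) \<le> real n / 1" using assms by (intro divide_left_mono) auto
  then have "exp 1 + real n / (1 + p) \<le> exp 1 + real n" by simp
  also have "\<dots> \<le> exp 1 * exp 1 + exp 1 * real n"
  proof (rule add_mono)
    show "exp 1 \<le> exp 1 * exp (1 :: real)" using mult_left_mono[OF e, of "exp 1"] by simp
    show "real n \<le> exp 1 * real n" using mult_right_mono[OF e, of "real n"] by simp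
  qed
  also have "\<dots> \<le> (exp 1 + real n / 2)\<^sup>2"
    using zero_le_power2[of "real n / 2"] by (simp add: power2_eq_square algebra_simps)
  finally have le: "exp 1 + real n / (1 + p) \<le> (exp 1 + real n / 2)\<^sup>2" .
  have "0 < exp 1 + real n / (1 + p)" using assms by (intro add_pos_nonneg) auto
  then have "ell n p \<le> ln ((exp 1 + real n / 2)\<^sup>2)"
    unfolding ell_def by (rule ln_mono[OF le])
  also have "\<dots> = 2 * ell n 1" by (simp add: ell_def ln_realpow add_pos_nonneg)
  finally show ?thesis using False by (simp add: max_def)
qed

text \<open>Two union bounds, each failing with probability at most exp (- k): a 1/2-net controls
  the maximum of g and a t-net the minimum. B is any number above the resulting ratio, so that later
  estimates can be inserted directly.\<close>

lemma distance_bound_core: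
  assumes \<mu>: "haar_orthogonal n \<mu>" and \<nu>: "haar_grassmannian n k \<nu>"
    and n: "2 \<le> n" and m: "1 \<le> m" and k: "1 \<le> k"
    and p: "1 \<le> p" "2 * real k / real m \<le> p"
    and B: "32 * moment_const * (sqrt (ln (exp 1 * real n) / ell n p) + sqrt (real k / (real m * ell n p)))
        * (2 * moment_bound n p) powr ((real k - 1) / Delta m k p) * exp (7 * real k / Delta m k p) \<le> B"
  shows "1 - 2 * exp (- real k) \<le> measure (joint_law m \<mu> \<nu>) {(U, F) \<in> space (joint_law m \<mu> \<nu>).
    geom_dist (orth_proj n F ` avg_body n m U) (unit_ball_in n F) \<le> B}"
proof (rule joint_law_prob_ge[OF \<mu> \<nu> geom_dist_event_measurable[OF \<mu> \<nu> _ m k]])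
  show n1: "1 \<le> n" using n by simp
  fix F assume F: "F \<in> grassmannian n k"
  obtain e where "onb n F k e" using onb_grassmannian[OF F k] .
  then interpret onb n F k e .
  interpret \<mu>: prob_space \<mu> using \<mu> by (simp add: haar_orthogonal_def)
  let ?Q = "\<Pi>\<^sub>M j\<in>{1..m}. \<mu>"
  interpret Q: prob_space ?Q by (intro prob_space_PiM) (rule \<mu>.prob_space_axioms)
  have unit: "haar_unit_vector n \<mu> x" if "x \<in> F" "vn n x = 1" for x
    using that \<mu> n1 F_Rn by (intro haar_unit_vector.intro) auto
  define L where "L = ln (exp 1 * real n)"
  have L: "1 \<le> L" unfolding L_def using n by (intro ln_en_ge_1) simp
  define l where "l = ell n p"
  have l: "1 \<le> l" "l \<le> real n" unfolding l_def using n p by (auto intro!: ell_ge_1 ell_le)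
  define D where "D = moment_bound n p"
  define \<Delta> where "\<Delta> = Delta m k p"
  have \<Delta>: "real k < \<Delta>" unfolding \<Delta>_def by (rule Delta_pos[OF p(2) m k])
  have "1 \<le> sqrt (real n / l)" using l by simp
  then have D: "1 \<le> 2 * D" unfolding D_def moment_bound_def l_def[symmetric]
    using moment_const_ge mult_mono[of 1 moment_const 1 "sqrt (real n / l)"] by simp
  \<comment> \<open>Ensures m S^2 / 8 \<ge> 8 k + 8 m L: the second term absorbs (8 n)^m \<le> exp
    (3 L m), the first leaves exp (- 7 k) to pay for the net.\<close>
  define S where "S = 8 * (sqrt (real k / real m) + sqrt L)"
  have S0: "0 \<le> S" using L by (simp add: S_def)
  \<comment> \<open>The reciprocal of t, solved from (2 D)^(m p) t^Delta = exp (- 7 k) with m p =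
    Delta + k - 1.\<close>
  define r where "r = 2 * D * (2 * D) powr ((real k - 1) / \<Delta>) * exp (7 * real k / \<Delta>)"
  have r: "1 \<le> r"
  proof -
    have "1 \<le> (2 * D) powr ((real k - 1) / \<Delta>)"
      using D \<Delta> k by (intro ge_one_powr_ge_zero) auto
    moreover have "1 \<le> exp (7 * real k / \<Delta>)" using \<Delta> by simp
    ultimately show ?thesis unfolding r_def by (intro mult_ge1_I[OF mult_ge1_I[OF D]])
  qed
  define t where "t = 1 / r"
  have t: "0 < t" "t \<le> 1" using r by (auto simp: t_def)
  obtain N1 where N1: "finite N1" "N1 \<subseteq> {x \<in> F. vn n x = 1}"
    "real (card N1) \<le> (4 * exp 3) ^ k * (1 / (1 / 2)) ^ (k - 1)"
    "\<And>x. x \<in> F \<Longrightarrow> vn n x = 1 \<Longrightarrow> \<exists>y\<in>N1. vn n (x - y) \<le> 1 / 2"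
    using sphere_net[of "1 / 2", OF _ _ k] by auto
  obtain N2 where N2: "finite N2" "N2 \<subseteq> {x \<in> F. vn n x = 1}"
    "real (card N2) \<le> (4 * exp 3) ^ k * (1 / t) ^ (k - 1)"
    "\<And>x. x \<in> F \<Longrightarrow> vn n x = 1 \<Longrightarrow> \<exists>y\<in>N2. vn n (x - y) \<le> t"
    using sphere_net[OF t k] by auto
  define A1 where "A1 x = {U \<in> space ?Q. real m * S / sqrt n \<le> sup_sum n m U x}" for x
  define A2 where "A2 x = {U \<in> space ?Q. sup_sum n m U x \<le> real m * (2 * t)}" for x
  have A1s: "A1 x \<in> sets ?Q" if "x \<in> N1" for x
  proof -
    interpret haar_unit_vector n \<mu> x using that N1 by (intro unit) auto
    show ?thesis unfolding A1_def by measurable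
  qed
  have A2s: "A2 x \<in> sets ?Q" if "x \<in> N2" for x
  proof -
    interpret haar_unit_vector n \<mu> x using that N2 by (intro unit) auto
    show ?thesis unfolding A2_def by measurable
  qed
  have A1: "Q.prob (A1 x) \<le> exp (- 7 * real k)" if "x \<in> N1" for x
  proof -
    interpret haar_unit_vector n \<mu> x using that N1 by (intro unit) auto
    have "emeasure ?Q (A1 x) \<le> ennreal ((8 * real n) ^ m * exp (- (real m * S\<^sup>2 / 8)))"
      unfolding A1_def by (rule sup_sum_upper_tail[OF S0])
    then have "Q.prob (A1 x) \<le> (8 * real n) ^ m * exp (- (real m * S\<^sup>2 / 8))"
      unfolding Q.emeasure_eq_measure by (subst (asm) ennreal_le_iff) auto
    also have "\<dots> \<le> exp (3 * L * real m) * exp (- (8 * real k + 8 * real m * L))"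
    proof (intro mult_mono)
      have "8 * real n \<le> exp 3 * real n ^ 3"
        using exp_3_ge n self_le_power[of "real n" 3] by (intro mult_mono) auto
      also have "\<dots> = exp L ^ 3" using n by (simp add: L_def power_mult_distrib flip: exp_of_nat_mult)
      also have "\<dots> = exp (3 * L)" by (simp flip: exp_of_nat_mult)
      finally have "(8 * real n) ^ m \<le> exp (3 * L) ^ m" by (intro power_mono) auto
      then show "(8 * real n) ^ m \<le> exp (3 * L * real m)" by (simp add: exp_of_nat2_mult)
      have "real k / real m + L \<le> (sqrt (real k / real m) + sqrt L)\<^sup>2"
        using L by (simp add: power2_sum)
      then have "64 * (real k / real m + L) \<le> 64 * (sqrt (real k / real m) + sqrt L)\<^sup>2"
        by (rule mult_left_mono) simp
      also have "\<dots> = S\<^sup>2" unfolding S_def power_mult_distrib by simp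
      finally have "64 * (real k / real m + L) \<le> S\<^sup>2" .
      then have "real m * (64 * (real k / real m + L)) \<le> real m * S\<^sup>2" by (intro mult_left_mono) auto
      moreover have "real m * (64 * (real k / real m + L)) = 64 * real k + 64 * real m * L"
        using m by (simp add: field_simps)
      ultimately show "exp (- (real m * S\<^sup>2 / 8)) \<le> exp (- (8 * real k + 8 * real m * L))" by simp
    qed auto
    also have "\<dots> \<le> exp (- 7 * real k)"
    proof -
      have "0 \<le> real m * L" using L by simp
      moreover have "3 * L * real m + - (8 * real k + 8 * real m * L) = - 8 * real k - 5 * (real m * L)"
        by (simp add: algebra_simps)
      ultimately have "3 * L * real m + - (8 * real k + 8 * real m * L) \<le> - 7 * real k" by linarith
      then show ?thesis unfolding exp_add[symmetric] exp_le_cancel_iff .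
    qed
    finally show ?thesis .
  qed
  have A2: "Q.prob (A2 x) \<le> (2 * t * D) powr (real m * p)" if "x \<in> N2" for x
  proof -
    interpret haar_unit_vector n \<mu> x using that N2 by (intro unit) auto
    have "emeasure ?Q (A2 x) \<le> ennreal ((2 * t * D) powr (real m * p))"
      unfolding A2_def D_def by (rule sup_sum_lower_tail[OF p(1) _ m]) (use t in simp)
    then show ?thesis unfolding Q.emeasure_eq_measure by (subst (asm) ennreal_le_iff) auto
  qed
  let ?A = "(\<Union>x\<in>N1. A1 x) \<union> (\<Union>x\<in>N2. A2 x)"
  \<comment> \<open>The spare factor 2^k is consumed by the mesh 1 / 2 of the first net; either net
    then contributes a factor exp (6 k), leaving exp (- k).\<close>
  have e4: "(4 * exp 3) ^ k \<le> exp (6 * real k) / 2 ^ k"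
  proof -
    have "(8 * exp 3) ^ k \<le> (exp 3 * exp (3::real)) ^ k" using exp_3_ge by (intro power_mono mult_right_mono) auto
    also have "\<dots> = exp 6 ^ k" by (simp flip: exp_add)
    also have "\<dots> = exp (6 * real k)" by (simp add: exp_of_nat2_mult)
    finally have "(2 * (4 * exp 3)) ^ k \<le> exp (6 * real k)" by simp
    then show ?thesis by (simp only: power_mult_distrib) (simp add: field_simps)
  qed
  have "Q.prob (\<Union>x\<in>N1. A1 x) \<le> (\<Sum>x\<in>N1. Q.prob (A1 x))"
    using N1(1) A1s by (intro Q.finite_measure_subadditive_finite) auto
  also have "\<dots> \<le> real (card N1) * exp (- 7 * real k)"
    by (rule sum_bounded_above[OF A1])
  also have "\<dots> \<le> exp (6 * real k) * exp (- 7 * real k)"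
  proof (rule mult_right_mono)
    have "(1 / (1 / 2)) ^ (k - 1) \<le> (2::real) ^ k" by (simp add: power_increasing)
    then have "(4 * exp 3) ^ k * (1 / (1 / 2)) ^ (k - 1) \<le> (exp (6 * real k) / 2 ^ k) * 2 ^ k"
      using e4 by (intro mult_mono) auto
    then show "real (card N1) \<le> exp (6 * real k)" using N1(3) by simp
  qed simp
  also have "\<dots> = exp (- real k)" by (simp flip: exp_add)
  finally have P1: "Q.prob (\<Union>x\<in>N1. A1 x) \<le> exp (- real k)" .
  have "Q.prob (\<Union>x\<in>N2. A2 x) \<le> (\<Sum>x\<in>N2. Q.prob (A2 x))"
    using N2(1) A2s by (intro Q.finite_measure_subadditive_finite) auto
  also have "\<dots> \<le> real (card N2) * (2 * t * D) powr (real m * p)"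
    by (rule sum_bounded_above[OF A2])
  also have "\<dots> \<le> ((4 * exp 3) ^ k * (1 / t) ^ (k - 1)) * (2 * t * D) powr (real m * p)"
    by (rule mult_right_mono[OF N2(3)]) simp
  also have "\<dots> = (4 * exp 3) ^ k * exp (- 7 * real k)"
  proof -
    have D0: "0 < 2 * D" using D by simp
    have f1: "(1 / t) ^ (k - 1) = t powr (- (real k - 1))"
      unfolding powr_minus using t k
      by (simp add: powr_realpow[symmetric] of_nat_diff power_one_over inverse_eq_divide)
    have f2: "(2 * t * D) powr (real m * p) = t powr (real m * p) * (2 * D) powr (real m * p)"
      using t D by (simp add: powr_mult[symmetric] mult_ac)
    have f3: "t powr (- (real k - 1)) * t powr (real m * p) = t powr \<Delta>"
      unfolding powr_add[symmetric] by (rule arg_cong[where f = "(powr) t"]) (simp add: \<Delta>_def Delta_def)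
    \<comment> \<open>The defining equation of r in logarithmic form, multiplied by Delta.\<close>
    have f4: "t powr \<Delta> = (2 * D) powr (- (real m * p)) * exp (- 7 * real k)"
    proof -
      have lnr: "ln r = ln (2 * D) + (real k - 1) / \<Delta> * ln (2 * D) + 7 * real k / \<Delta>"
        using D0 by (simp add: r_def ln_mult ln_powr)
      have lnt: "ln t = - ln r" using r by (simp add: t_def ln_div)
      have d: "\<Delta> * ((real k - 1) / \<Delta>) = real k - 1" "\<Delta> * (7 * real k / \<Delta>) = 7 * real k"
        using \<Delta> k by auto
      have "\<Delta> * ln t = - (\<Delta> * ln (2 * D) + \<Delta> * ((real k - 1) / \<Delta>) * ln (2 * D) + \<Delta> * (7 * real k / \<Delta>))"
        unfolding lnt lnr by (simp only: distrib_left mult_minus_right mult.assoc)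
      then have "\<Delta> * ln t = - (\<Delta> * ln (2 * D) + (real k - 1) * ln (2 * D) + 7 * real k)"
        unfolding d .
      also have "\<dots> = - (real m * p) * ln (2 * D) + - 7 * real k"
        by (simp add: \<Delta>_def Delta_def algebra_simps)
      finally have "\<Delta> * ln t = - (real m * p) * ln (2 * D) + - 7 * real k" .
      moreover have "t powr \<Delta> = exp (\<Delta> * ln t)" "(2 * D) powr (- (real m * p)) = exp (- (real m * p) * ln (2 * D))"
        using t D0 by (simp_all add: powr_def)
      ultimately show ?thesis by (simp only: exp_add)
    qed
    have f5: "(2 * D) powr (- (real m * p)) * (2 * D) powr (real m * p) = 1"
      using D0 by (simp flip: powr_add)
    let ?c = "(4 * exp 3) ^ k :: real"
    have "(?c * (1 / t) ^ (k - 1)) * (2 * t * D) powr (real m * p) =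
        ?c * ((t powr (- (real k - 1)) * t powr (real m * p)) * (2 * D) powr (real m * p))"
      unfolding f1 f2 by (simp only: mult.assoc)
    also have "\<dots> = ?c * exp (- 7 * real k) * ((2 * D) powr (- (real m * p)) * (2 * D) powr (real m * p))"
      unfolding f3 f4 by (simp only: mult_ac)
    finally show ?thesis unfolding f5 by simp
  qed
  also have "\<dots> \<le> exp (6 * real k) * exp (- 7 * real k)"
  proof (rule mult_right_mono)
    have "exp (6 * real k) / 2 ^ k \<le> exp (6 * real k) / 1" by (rule divide_left_mono) auto
    then show "(4 * exp 3) ^ k \<le> exp (6 * real k)" using e4 by simp
  qed simp
  also have "\<dots> = exp (- real k)" by (simp flip: exp_add)
  finally have P2: "Q.prob (\<Union>x\<in>N2. A2 x) \<le> exp (- real k)" .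
  have A1U: "(\<Union>x\<in>N1. A1 x) \<in> sets ?Q" and A2U: "(\<Union>x\<in>N2. A2 x) \<in> sets ?Q"
    using N1(1) N2(1) A1s A2s by auto
  have "Q.prob ?A \<le> 2 * exp (- real k)"
    using measure_Un_le[OF A1U A2U] P1 P2 by simp
  then have "emeasure ?Q ?A \<le> ennreal (2 * exp (- real k))"
    unfolding Q.emeasure_eq_measure by (rule ennreal_leI)
  moreover have "(U, F) \<in> {(U, F) \<in> space (joint_law m \<mu> \<nu>).
      geom_dist (orth_proj n F ` avg_body n m U) (unit_ball_in n F) \<le> B}"
    if U: "U \<in> {1..m} \<rightarrow>\<^sub>E orthogonal_group n" "U \<notin> ?A" for U
  proof -
    have UQ: "U \<in> space ?Q" using U(1) \<mu> by (simp add: space_PiM haar_orthogonal_def)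
    have Uj: "\<And>j. j \<in> {1..m} \<Longrightarrow> U j \<in> orthogonal_group n" using U(1) by auto
    define g where "g = sup_sum n m U"
    have up: "g x \<le> 2 * (real m * S / sqrt n) * vn n x" if "x \<in> F" for x
      unfolding g_def
      by (rule sup_sum_le_from_net[OF n1 Uj, where N = N1])
        (use N1 U(2) UQ that in \<open>auto simp: A1_def\<close>)
    have lo: "real m * t * vn n x \<le> g x" if "x \<in> F" for x
      unfolding g_def
      by (rule sup_sum_ge_from_net[OF n1 Uj, where N = N2])
        (use N2 U(2) UQ that in \<open>auto simp: A2_def\<close>)
    have g0: "0 \<le> g x" for x using n1 by (simp add: g_def sup_sum_def sum_nonneg supn_nonneg)
    have "g x * vn n y \<le> B * (g y * vn n x)" if "x \<in> F" "y \<in> F" for x y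
    proof -
      have "g x * vn n y \<le> (2 * (real m * S / sqrt n) * vn n x) * (g y / (real m * t))"
        using up[OF that(1)] lo[OF that(2)] m t g0
        by (intro mult_mono) (auto simp: field_simps L2_set_nonneg S0)
      also have "\<dots> = (2 * S / sqrt n * r) * (g y * vn n x)"
        using m by (simp add: t_def field_simps)
      also have "\<dots> \<le> B * (g y * vn n x)"
      proof (rule mult_right_mono)
        \<comment> \<open>The sqrt n in D cancels the 1 / sqrt n of the maximum, which is how ell
          replaces n in the two square roots.\<close>
        have "D = moment_const * (sqrt n / sqrt l)" by (simp add: D_def moment_bound_def l_def real_sqrt_divide)
        then have "2 * S / sqrt n * (2 * D) = 4 * moment_const * (S / sqrt l)"
          using n by simp
        also have "S / sqrt l = 8 * ((sqrt L + sqrt (real k / real m)) / sqrt l)"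
          by (simp add: S_def add.commute)
        also have "4 * moment_const * (8 * ((sqrt L + sqrt (real k / real m)) / sqrt l)) =
            32 * moment_const * ((sqrt L + sqrt (real k / real m)) / sqrt l)" by simp
        also have "(sqrt L + sqrt (real k / real m)) / sqrt l = sqrt (L / l) + sqrt (real k / (real m * l))"
          by (simp add: add_divide_distrib real_sqrt_divide real_sqrt_mult)
        finally have "2 * S / sqrt n * r = 32 * moment_const * (sqrt (L / l) + sqrt (real k / (real m * l)))
            * (2 * D) powr ((real k - 1) / \<Delta>) * exp (7 * real k / \<Delta>)"
          unfolding r_def by (simp only: mult.assoc[symmetric])
        then show "2 * S / sqrt n * r \<le> B"
          using B by (simp add: L_def l_def D_def \<Delta>_def)
        show "0 \<le> g y * vn n x" by (simp add: g0 L2_set_nonneg)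
      qed
      finally show ?thesis .
    qed
    then have "geom_dist (orth_proj n F ` avg_body n m U) (unit_ball_in n F) \<le> B"
      by (intro geom_dist_le_iff[OF n1 m k, THEN iffD2] Uj) (simp_all add: g_def)
    then show ?thesis using U(1) F by (simp add: space_joint_law[OF \<mu> \<nu>])
  qed
  moreover have "?A \<in> sets ?Q" using A1U A2U by (rule sets.Un)
  ultimately show "\<exists>A\<in>sets ?Q. emeasure ?Q A \<le> ennreal (2 * exp (- real k)) \<and>
      (\<forall>U \<in> {1..m} \<rightarrow>\<^sub>E orthogonal_group n. U \<notin> A \<longrightarrow> (U, F) \<in> {(U, F) \<in> space (joint_law m \<mu> \<nu>).
      geom_dist (orth_proj n F ` avg_body n m U) (unit_ball_in n F) \<le> B})"
    by blast
qed simp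

section \<open>From the core bound to the two stated forms\<close>

definition dist_bound :: "real \<Rightarrow> nat \<Rightarrow> nat \<Rightarrow> nat \<Rightarrow> real \<Rightarrow> real"
  where "dist_bound C n m k p =
    C * (sqrt (ln (exp 1 * real n) / ell n p) + sqrt (real k / (real m * ell n p)))
      * (C * sqrt (real n / ell n p)) powr ((real k - 1) / Delta m k p)
      * exp (C * real k / Delta m k p)"

text \<open>The exponent \<open>max p 1\<close> costs only a factor in \<open>ell\<close>, and it increases \<open>Delta\<close>; this reduces
  small \<open>p\<close>, where the negative moment bound fails, to \<open>p = 1\<close>.\<close>

lemma dist_bound_max_1:
  assumes n: "2 \<le> n" and m: "1 \<le> m" and k: "1 \<le> k" and p: "2 * real k / real m \<le> p"
    and C: "64 * moment_const \<le> C"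
  defines "q \<equiv> max p 1"
  shows "32 * moment_const * (sqrt (ln (exp 1 * real n) / ell n q) + sqrt (real k / (real m * ell n q)))
        * (2 * moment_bound n q) powr ((real k - 1) / Delta m k q) * exp (7 * real k / Delta m k q) \<le> dist_bound C n m k p"
proof -
  have p0: "0 \<le> p" using p by (rule order_trans[rotated]) simp
  have q: "1 \<le> q" "p \<le> q" by (auto simp: q_def)
  have moment_const: "6 \<le> moment_const" by (rule moment_const_ge)
  define l l' where "l = ell n p" and "l' = ell n q"
  have l: "1 \<le> l" "1 \<le> l'" "l \<le> 2 * l'" "l' \<le> real n"
    unfolding l_def l'_def q_def using p0 n by (auto intro!: ell_ge_1 ell_le ell_max_1)
  \<comment> \<open>Replacing \<open>l\<close> by \<open>l'\<close> costs at most a factor 2 under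
    the root; the cruder 4 gives a clean factor 2 outside it, which makes 32 into 64 in the
    condition on C.\<close>
  have frac: "sqrt (x / l') \<le> 2 * sqrt (x / l)" if "0 \<le> x" for x
  proof -
    have "x / l' \<le> 4 * (x / l)"
    proof -
      have "x * l \<le> x * (4 * l')" using that l by (intro mult_left_mono) auto
      then show ?thesis using l by (simp add: field_simps)
    qed
    then have "sqrt (x / l') \<le> sqrt (4 * (x / l))" by (rule real_sqrt_le_mono)
    then show ?thesis by (simp only: real_sqrt_mult real_sqrt_four)
  qed
  define \<Delta> \<Delta>' where "\<Delta> = Delta m k p" and "\<Delta>' = Delta m k q"
  have \<Delta>: "0 < \<Delta>" "\<Delta> \<le> \<Delta>'"
    using Delta_pos[OF p m k] q by (auto simp: \<Delta>_def \<Delta>'_def Delta_def intro: mult_left_mono)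
  have L: "0 \<le> ln (exp 1 * real n)" by (rule order_trans[OF zero_le_one ln_en_ge_1]) (use n in simp)
  have a: "32 * moment_const * (sqrt (ln (exp 1 * real n) / l') + sqrt (real k / (real m * l')))
      \<le> C * (sqrt (ln (exp 1 * real n) / l) + sqrt (real k / (real m * l)))"
  proof -
    have "sqrt (ln (exp 1 * real n) / l') + sqrt (real k / (real m * l')) \<le>
        2 * (sqrt (ln (exp 1 * real n) / l) + sqrt (real k / (real m * l)))"
      using frac[OF L] frac[of "real k / real m"] by simp
    then have "32 * moment_const * (sqrt (ln (exp 1 * real n) / l') + sqrt (real k / (real m * l'))) \<le>
        32 * moment_const * (2 * (sqrt (ln (exp 1 * real n) / l) + sqrt (real k / (real m * l))))"
      using moment_const by (intro mult_left_mono) auto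
    also have "\<dots> = 64 * moment_const * (sqrt (ln (exp 1 * real n) / l) + sqrt (real k / (real m * l)))" by simp
    also have "\<dots> \<le> C * (sqrt (ln (exp 1 * real n) / l) + sqrt (real k / (real m * l)))"
      using C L l by (intro mult_right_mono add_nonneg_nonneg) auto
    finally show ?thesis .
  qed
  have b: "(2 * moment_bound n q) powr ((real k - 1) / \<Delta>') \<le> (C * sqrt (real n / l)) powr ((real k - 1) / \<Delta>)"
  proof -
    have s: "1 \<le> sqrt (real n / l')" using l by simp
    have D: "1 \<le> 2 * moment_bound n q" unfolding moment_bound_def l'_def[symmetric]
      using moment_const mult_mono[of 1 moment_const 1 "sqrt (real n / l')"] s by simp
    \<comment> \<open>The base is at least 1, so the larger exponent belonging to the smaller
      denominator gives an upper bound.\<close>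
    have "(2 * moment_bound n q) powr ((real k - 1) / \<Delta>') \<le> (2 * moment_bound n q) powr ((real k - 1) / \<Delta>)"
      using D \<Delta> k by (intro powr_mono divide_left_mono mult_pos_pos) auto
    also have "\<dots> \<le> (C * sqrt (real n / l)) powr ((real k - 1) / \<Delta>)"
    proof (rule powr_mono2)
      have "2 * moment_bound n q \<le> 2 * (moment_const * (2 * sqrt (real n / l)))"
        unfolding moment_bound_def l'_def[symmetric] using frac[of "real n"] moment_const by (intro mult_left_mono) auto
      also have "\<dots> = 4 * moment_const * sqrt (real n / l)" by simp
      also have "\<dots> \<le> C * sqrt (real n / l)" using C moment_const l by (intro mult_right_mono) auto
      finally show "2 * moment_bound n q \<le> C * sqrt (real n / l)" .
    qed (use D \<Delta> k in auto)
    finally show ?thesis .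
  qed
  have c: "exp (7 * real k / \<Delta>') \<le> exp (C * real k / \<Delta>)"
  proof -
    have "7 * real k / \<Delta>' \<le> 7 * real k / \<Delta>" using \<Delta> by (intro divide_left_mono mult_pos_pos) auto
    also have "\<dots> \<le> C * real k / \<Delta>" using \<Delta> C moment_const by (intro divide_right_mono mult_right_mono) auto
    finally show ?thesis by simp
  qed
  show ?thesis
    unfolding dist_bound_def l_def[symmetric] l'_def[symmetric] \<Delta>_def[symmetric] \<Delta>'_def[symmetric]
    using C moment_const L l by (intro mult_mono a b c) (auto intro!: mult_nonneg_nonneg add_nonneg_nonneg)
qed

lemma dist_bound_prob:
  assumes \<mu>: "haar_orthogonal n \<mu>" and \<nu>: "haar_grassmannian n k \<nu>"
    and n: "2 \<le> n" and m: "1 \<le> m" and k: "1 \<le> k" and p: "2 * real k / real m \<le> p"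
    and C: "64 * moment_const \<le> C" and B: "dist_bound C n m k p \<le> B"
  shows "1 - C * exp (- real k) \<le> measure (joint_law m \<mu> \<nu>) {(U, F) \<in> space (joint_law m \<mu> \<nu>).
    geom_dist (orth_proj n F ` avg_body n m U) (unit_ball_in n F) \<le> B}"
proof -
  have "2 * exp (- real k) \<le> C * exp (- real k)"
    using C moment_const_ge by (intro mult_right_mono) auto
  moreover have "1 - 2 * exp (- real k) \<le> measure (joint_law m \<mu> \<nu>) {(U, F) \<in> space (joint_law m \<mu> \<nu>).
    geom_dist (orth_proj n F ` avg_body n m U) (unit_ball_in n F) \<le> B}"
    using p by (intro distance_bound_core[OF \<mu> \<nu> n m k, where p = "max p 1"]
        order_trans[OF dist_bound_max_1[OF n m k p C] B]) auto
  ultimately show ?thesis by linarith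
qed

text \<open>With \<open>p = 2 k ln (en) / m\<close> the exponent \<open>(k - 1) / Delta\<close> is at most \<open>1 / ln (en)\<close>, so both the
  power and the exponential are bounded by constants.\<close>

lemma dist_bound_Lmk:
  assumes n: "2 \<le> n" and m: "1 \<le> m" and k: "1 \<le> k" and C: "1 \<le> C"
  defines "p \<equiv> 2 * real k * ln (exp 1 * real n) / real m"
  shows "2 * real k / real m \<le> p"
    and "dist_bound C n m k p \<le> 2 * C\<^sup>2 * exp (C + 1) *
      (sqrt (ln (exp 1 * real n) / Lmk n m k) + sqrt (real k / (real m * Lmk n m k)))"
proof -
  define L where "L = ln (exp 1 * real n)"
  have L: "1 \<le> L" "L = 1 + ln (real n)" using n by (auto simp: L_def ln_mult)
  have "2 * real k * 1 \<le> 2 * real k * L" using L by (intro mult_left_mono) auto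
  then show p: "2 * real k / real m \<le> p"
    unfolding p_def L_def[symmetric] by (intro divide_right_mono) auto
  have p0: "0 \<le> p" using p by (rule order_trans[rotated]) simp
  define l where "l = ell n p"
  have l: "1 \<le> l" "l \<le> real n" unfolding l_def using n p0 by (auto intro!: ell_ge_1 ell_le)
  define \<Delta> where "\<Delta> = Delta m k p"
  \<comment> \<open>Here m p = 2 k L, and one of the two copies of k L absorbs the - k in
    \<open>Delta\<close>.\<close>
  have \<Delta>: "real k * L \<le> \<Delta>"
  proof -
    have "real k * 1 \<le> real k * L" using L by (intro mult_left_mono) auto
    moreover have "\<Delta> = 2 * (real k * L) - real k + 1" using m by (simp add: \<Delta>_def Delta_def p_def L_def)
    ultimately show ?thesis by linarith
  qed
  have kL: "1 \<le> real k * L" using L k by (intro mult_ge1_I) auto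
  have \<Delta>k: "real k \<le> \<Delta>" using \<Delta> mult_left_mono[OF L(1), of "real k"] by simp
  define M where "M = min (real n) (real m * real n / (real k * L))"
  have M0: "0 \<le> M" using L by (simp add: M_def)
  have Lmk: "Lmk n m k = ln (exp 1 + M)" by (simp add: Lmk_def M_def L_def)
  define z where "z = real k * L / real m"
  have z: "p = 2 * z" by (simp add: z_def p_def L_def)
  \<comment> \<open>M is the minimum of n and n / z, and n / (1 + 2 z) has the same order; z \<le> 1
    and z > 1 decide which term of the minimum is compared.\<close>
  have "M / 3 \<le> real n / (1 + p)"
  proof (cases "z \<le> 1")
    case True
    then have "1 + p \<le> 3" by (simp add: z)
    then have "real n / 3 \<le> real n / (1 + p)" using p0 by (intro divide_left_mono) auto
    moreover have "M \<le> real n" by (simp add: M_def)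
    ultimately show ?thesis by simp
  next
    case False
    then have "1 + p \<le> 3 * (real k * L / real m)" unfolding z z_def[symmetric] by linarith
    then have le: "real n / (3 * (real k * L / real m)) \<le> real n / (1 + p)"
      using p0 kL m by (intro divide_left_mono mult_pos_pos) auto
    have "M / 3 \<le> real m * real n / (real k * L) / 3" by (simp add: M_def divide_right_mono)
    also have "\<dots> = real n / (3 * (real k * L / real m))" by (simp add: mult_ac)
    finally show ?thesis using le by (rule order_trans)
  qed
  then have "M \<le> 3 * (real n / (1 + p))" by (simp only: divide_le_eq) (simp add: mult.commute)
  then have "exp 1 + M \<le> 3 * (exp 1 + real n / (1 + p))"
    unfolding distrib_left by (intro add_mono) auto
  moreover have "0 < exp 1 + M" using M0 by (intro add_pos_nonneg) auto
  ultimately have "Lmk n m k \<le> ln (3 * (exp 1 + real n / (1 + p)))"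
    unfolding Lmk by (intro ln_mono)
  also have "\<dots> = ln 3 + l"
    unfolding l_def ell_def using p0 by (intro ln_mult_pos) (auto intro!: add_pos_nonneg)
  also have "\<dots> \<le> 4 * l" using l ln_le_minus_one[of "3 :: real"] by simp
  finally have Ll: "Lmk n m k \<le> 4 * l" .
  have "ln (exp 1) \<le> Lmk n m k" unfolding Lmk using M0 by (intro ln_mono) auto
  then have Lmk1: "1 \<le> Lmk n m k" by simp
  have frac: "sqrt (x / l) \<le> 2 * sqrt (x / Lmk n m k)" if "0 \<le> x" for x
  proof -
    have "x * Lmk n m k \<le> x * (4 * l)" using that Ll by (intro mult_left_mono)
    then have "x / l \<le> 4 * (x / Lmk n m k)" using l Lmk1 by (simp add: field_simps)
    then have "sqrt (x / l) \<le> sqrt (4 * (x / Lmk n m k))" by (rule real_sqrt_le_mono)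
    then show ?thesis by (simp only: real_sqrt_mult real_sqrt_four)
  qed
  let ?R = "sqrt (L / Lmk n m k) + sqrt (real k / (real m * Lmk n m k))"
  have "sqrt (L / l) + sqrt (real k / (real m * l)) \<le> 2 * ?R"
    using frac[of L] frac[of "real k / real m"] L by simp
  then have a: "C * (sqrt (L / l) + sqrt (real k / (real m * l))) \<le> C * (2 * ?R)"
    using C by (intro mult_left_mono) auto
  have b: "(C * sqrt (real n / l)) powr ((real k - 1) / \<Delta>) \<le> C * exp 1"
  proof -
    have s: "1 \<le> sqrt (real n / l)" using l by simp
    \<comment> \<open>Bounding the root by n is harmless: at exponent 1 / L the power of n is at
      most e, since ln n \<le> L.\<close>
    have "real n / l \<le> real n / 1" using l by (intro divide_left_mono) auto
    also have "\<dots> \<le> (real n)\<^sup>2" using n by (simp add: power2_eq_square)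
    finally have "sqrt (real n / l) \<le> real n" by (intro real_le_lsqrt) (use n l in auto)
    then have "C * sqrt (real n / l) \<le> C * real n" using C by (intro mult_left_mono) auto
    moreover have "1 \<le> C * sqrt (real n / l)" using C s by (intro mult_ge1_I) auto
    ultimately have "(C * sqrt (real n / l)) powr ((real k - 1) / \<Delta>) \<le> (C * real n) powr ((real k - 1) / \<Delta>)"
      using \<Delta>k k by (intro powr_mono2) auto
    also have "\<dots> \<le> (C * real n) powr (1 / L)"
    proof (rule powr_mono)
      have "(real k - 1) / \<Delta> \<le> real k / (real k * L)"
        using \<Delta> kL k L by (intro frac_le) auto
      then show "(real k - 1) / \<Delta> \<le> 1 / L" using k by simp
      show "1 \<le> C * real n" using C n by (intro mult_ge1_I) auto
    qed
    also have "\<dots> = exp ((ln C + ln (real n)) / L)"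
      using C n by (simp add: powr_def ln_mult)
    also have "\<dots> \<le> exp (ln C + 1)"
    proof -
      have "ln C + ln (real n) \<le> ln C * L + 1 * L"
        using L mult_left_mono[of 1 L "ln C"] C by simp
      then have "(ln C + ln (real n)) / L \<le> ln C + 1" using L by (simp add: field_simps)
      then show ?thesis by simp
    qed
    also have "\<dots> = C * exp 1" using C by (simp add: exp_add)
    finally show ?thesis .
  qed
  have c: "exp (C * real k / \<Delta>) \<le> exp C"
  proof -
    have "C * (real k / \<Delta>) \<le> C * 1" using C \<Delta>k k by (intro mult_left_mono) (auto simp: divide_le_eq)
    then show ?thesis by simp
  qed
  have "dist_bound C n m k p \<le> (C * (2 * ?R)) * (C * exp 1) * exp C"
    unfolding dist_bound_def l_def[symmetric] \<Delta>_def[symmetric] L_def[symmetric]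
    using C L l Lmk1 by (intro mult_mono a b c) (auto intro!: mult_nonneg_nonneg add_nonneg_nonneg)
  also have "\<dots> = 2 * C\<^sup>2 * exp (C + 1) * ?R" by (simp add: power2_eq_square exp_add)
  finally show "dist_bound C n m k p \<le> 2 * C\<^sup>2 * exp (C + 1) *
      (sqrt (ln (exp 1 * real n) / Lmk n m k) + sqrt (real k / (real m * Lmk n m k)))"
    by (simp add: L_def)
qed

theorem corollary5p8:
  shows "\<exists>c C :: real. 0 < c \<and> 0 < C \<and>
    (\<forall>n m k :: nat. \<forall>\<mu> \<nu>.
      2 \<le> n \<longrightarrow> 2 \<le> m \<longrightarrow> 1 \<le> k \<longrightarrow> k \<le> n \<longrightarrow>
      haar_orthogonal n \<mu> \<longrightarrow> haar_grassmannian n k \<nu> \<longrightarrow>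
      (\<forall>p :: real. 2 * real k / real m \<le> p \<longrightarrow>
        \<P>((U, F) in joint_law m \<mu> \<nu>.
            geom_dist (orth_proj n F ` avg_body n m U) (unit_ball_in n F)
              \<le> C * (sqrt (ln (exp 1 * real n) / ell n p) + sqrt (real k / (real m * ell n p)))
                  * (C * sqrt (real n / ell n p)) powr ((real k - 1) / Delta m k p)
                  * exp (C * real k / Delta m k p))
          \<ge> 1 - C * exp (- c * real k)) \<and>
      \<P>((U, F) in joint_law m \<mu> \<nu>.
          geom_dist (orth_proj n F ` avg_body n m U) (unit_ball_in n F)
            \<le> C * (sqrt (ln (exp 1 * real n) / Lmk n m k) + sqrt (real k / (real m * Lmk n m k))))
        \<ge> 1 - C * exp (- c * real k))"
proof -
  define C0 where "C0 = 64 * moment_const"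
  have C0: "1 \<le> C0" using moment_const_ge by (simp add: C0_def)
  \<comment> \<open>The second claim applies the distance bound with the smaller constant C0, and
    \<open>dist_bound_Lmk\<close> then produces C; the first claim uses C itself.\<close>
  define C where "C = 2 * C0\<^sup>2 * exp (C0 + 1)"
  have "C0 * 1 \<le> (2 * C0\<^sup>2) * exp (C0 + 1)"
    using C0 self_le_power[of C0 2] by (intro mult_mono) auto
  then have C: "C0 \<le> C" "64 * moment_const \<le> C" "0 < C" using C0 by (auto simp: C_def C0_def)
  show ?thesis
  proof (rule exI[of _ 1], rule exI[of _ C], intro conjI allI impI)
    fix n m k :: nat and \<mu> \<nu>
    assume n: "2 \<le> n" and m: "2 \<le> m" and k: "1 \<le> k"
      and \<mu>: "haar_orthogonal n \<mu>" and \<nu>: "haar_grassmannian n k \<nu>"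
    have m1: "1 \<le> m" using m by simp
    have ev: "{x \<in> space (joint_law m \<mu> \<nu>). case x of (U, F) \<Rightarrow>
          geom_dist (orth_proj n F ` avg_body n m U) (unit_ball_in n F) \<le> B} =
        {(U, F) \<in> space (joint_law m \<mu> \<nu>).
          geom_dist (orth_proj n F ` avg_body n m U) (unit_ball_in n F) \<le> B}" for B
      by auto
    show "1 - C * exp (- 1 * real k) \<le> \<P>((U, F) in joint_law m \<mu> \<nu>.
        geom_dist (orth_proj n F ` avg_body n m U) (unit_ball_in n F)
          \<le> C * (sqrt (ln (exp 1 * real n) / ell n p) + sqrt (real k / (real m * ell n p)))
              * (C * sqrt (real n / ell n p)) powr ((real k - 1) / Delta m k p)
              * exp (C * real k / Delta m k p))" if p: "2 * real k / real m \<le> p" for p :: real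
      using dist_bound_prob[OF \<mu> \<nu> n m1 k p C(2) order_refl]
      unfolding ev dist_bound_def by simp
    note L = dist_bound_Lmk[OF n m1 k C0]
    have "1 - C0 * exp (- real k) \<le> measure (joint_law m \<mu> \<nu>) {(U, F) \<in> space (joint_law m \<mu> \<nu>).
      geom_dist (orth_proj n F ` avg_body n m U) (unit_ball_in n F)
        \<le> C * (sqrt (ln (exp 1 * real n) / Lmk n m k) + sqrt (real k / (real m * Lmk n m k)))}"
      by (rule dist_bound_prob[OF \<mu> \<nu> n m1 k L(1)]) (use L(2) in \<open>simp_all add: C0_def C_def\<close>)
    moreover have "C0 * exp (- real k) \<le> C * exp (- real k)" using C by (intro mult_right_mono) auto
    ultimately have "1 - C * exp (- real k) \<le> measure (joint_law m \<mu> \<nu>) {(U, F) \<in> space (joint_law m \<mu> \<nu>).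
      geom_dist (orth_proj n F ` avg_body n m U) (unit_ball_in n F)
        \<le> C * (sqrt (ln (exp 1 * real n) / Lmk n m k) + sqrt (real k / (real m * Lmk n m k)))}"
      by linarith
    then show "1 - C * exp (- 1 * real k) \<le> \<P>((U, F) in joint_law m \<mu> \<nu>.
        geom_dist (orth_proj n F ` avg_body n m U) (unit_ball_in n F)
          \<le> C * (sqrt (ln (exp 1 * real n) / Lmk n m k) + sqrt (real k / (real m * Lmk n m k))))"
      unfolding ev by simp
  qed (use C in auto)
qed

end
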